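(* Let $X$ be a set of $n$ points in Euclidean space $\mathbb{R}^d$ with distance $\ell_2$, and let $\alpha>1$. There is a data structure for $\alpha$-approximate farthest neighbor over a dynamic partition of $X$ into clusters, supporting the following operations: (1) Initialize$(X,\alpha)$: create the data structure containing a cluster $S_x=\{x\}$ for each $x\in X$, in time $\tilde{O}(n^{1+1/\alpha^2})$; (2) Query$(\mathcal{D},S,q)$: given a cluster $S$ of $\mathcal{D}$ and a query point $q\in X$, return an $\alpha$-approximate farthest neighbor of $q$ in $S$, in time $\tilde{O}(n^{1/\alpha^2})$; (3) Merge$(\mathcal{D},S,S')$: given two clusters $S,S'$ of $\mathcal{D}$, add the cluster $S\sqcup S'$ to $\mathcal{D}$ in time $\tilde{O}(n^{1/\alpha^2}\cdot\min(|S|,|S'|,n^{1/\alpha^2}))$; this consumes $S$ and $S'$, which can no longer be used afterwards. The data structure uses $\tilde{O}(n^{1+1/\alpha^2})$ space. The construction is randomized (in Initialize), and for every $q$ and $S$ the Query operation fails with probability at most $1/n^3$.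
   Context: Given a set $S\subseteq X$ and $q\in X$, a point $r\in S$ is an $\alpha$-approximate farthest neighbor of $q$ in $S$ if $\ell_2(q,r)\ge\frac{1}{\alpha}\max_{p\in S}\ell_2(q,p)$. $\tilde{O}(\cdot)$ hides polylogarithmic factors in $n$. Convention: $d=O(\log n)$ and dependence on $d$ is suppressed in running times. *)

theory Defs
  imports "HOL-Probability.Probability"
begin

section \<open>Points and approximate farthest neighbors\<close>

text \<open>The dimension varies with the input, so a point of \<open>\<real>\<^sup>d\<close> is a list of \<open>d\<close> coordinates.\<close>

type_synonym point = "real list"

definition l2 :: "point \<Rightarrow> point \<Rightarrow> real" where
  "l2 p q = L2_set (\<lambda>j. p ! j - q ! j) {..<length p}"

definition approx_farthest :: "real \<Rightarrow> point set \<Rightarrow> point \<Rightarrow> point \<Rightarrow> bool" where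
  "approx_farthest \<alpha> S q r \<longleftrightarrow> r \<in> S \<and> l2 q r \<ge> (1 / \<alpha>) * Max (l2 q ` S)"


section \<open>The randomized real RAM\<close>

text \<open>
  Running times and space refer to a unit-cost RAM with \<open>m\<close> cells of integer memory and \<open>m\<close> cells
  of real memory. Integer words range over \<open>{0..<m}\<close>, so a word has just enough bits to address the
  memory: a computation whose integer intermediate results leave this range, or which accesses a
  cell outside the memory, is stuck. Exact real numbers can be added, subtracted, multiplied,
  divided and compared, but not rounded, and programs contain no real constants. A program text
  has boundedly many registers.
\<close>

type_synonym reg = nat

datatype iexp =
    IConst nat
  | IReg reg
  | ILoad iexp
  | IAdd iexp iexp
  | ISub iexp iexp
  | IMul iexp iexp
  | IDiv iexp iexp
  | IMod iexp iexp

datatype rexp =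
    RReg reg
  | RLoad iexp
  | ROfInt iexp
  | RAdd rexp rexp
  | RSub rexp rexp
  | RMul rexp rexp
  | RDiv rexp rexp

datatype bexp =
    ILess iexp iexp
  | IEq iexp iexp
  | RLess rexp rexp
  | BNot bexp
  | BAnd bexp bexp

datatype com =
    Skip
  | ISet reg iexp
  | IStore iexp iexp
  | RSet reg rexp
  | RStore iexp rexp
  | Sample reg
  | Seq com com
  | Cond bexp com com
  | While bexp com

text \<open>
  \<open>coins\<close> is the sequence of all random numbers the machine will ever draw, and \<open>used\<close> counts those
  drawn so far.
\<close>

record state =
  ireg :: "reg \<Rightarrow> nat"
  rreg :: "reg \<Rightarrow> real"
  imem :: "nat \<Rightarrow> nat"
  rmem :: "nat \<Rightarrow> real"
  coins :: "nat \<Rightarrow> real"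
  used :: nat

text \<open>Subtraction of words is truncated at zero; division by zero yields zero.\<close>

primrec ival :: "state \<Rightarrow> iexp \<Rightarrow> nat" where
  "ival s (IConst c) = c"
| "ival s (IReg x) = ireg s x"
| "ival s (ILoad e) = imem s (ival s e)"
| "ival s (IAdd e f) = ival s e + ival s f"
| "ival s (ISub e f) = ival s e - ival s f"
| "ival s (IMul e f) = ival s e * ival s f"
| "ival s (IDiv e f) = ival s e div ival s f"
| "ival s (IMod e f) = ival s e mod ival s f"

primrec iok :: "nat \<Rightarrow> state \<Rightarrow> iexp \<Rightarrow> bool" where
  "iok m s (IConst c) \<longleftrightarrow> c < m"
| "iok m s (IReg x) \<longleftrightarrow> ireg s x < m"
| "iok m s (ILoad e) \<longleftrightarrow> iok m s e \<and> imem s (ival s e) < m"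
| "iok m s (IAdd e f) \<longleftrightarrow> iok m s e \<and> iok m s f \<and> ival s e + ival s f < m"
| "iok m s (ISub e f) \<longleftrightarrow> iok m s e \<and> iok m s f"
| "iok m s (IMul e f) \<longleftrightarrow> iok m s e \<and> iok m s f \<and> ival s e * ival s f < m"
| "iok m s (IDiv e f) \<longleftrightarrow> iok m s e \<and> iok m s f"
| "iok m s (IMod e f) \<longleftrightarrow> iok m s e \<and> iok m s f"

primrec rval :: "state \<Rightarrow> rexp \<Rightarrow> real" where
  "rval s (RReg x) = rreg s x"
| "rval s (RLoad e) = rmem s (ival s e)"
| "rval s (ROfInt e) = real (ival s e)"
| "rval s (RAdd e f) = rval s e + rval s f"
| "rval s (RSub e f) = rval s e - rval s f"
| "rval s (RMul e f) = rval s e * rval s f"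
| "rval s (RDiv e f) = rval s e / rval s f"

primrec rok :: "nat \<Rightarrow> state \<Rightarrow> rexp \<Rightarrow> bool" where
  "rok m s (RReg x) \<longleftrightarrow> True"
| "rok m s (RLoad e) \<longleftrightarrow> iok m s e"
| "rok m s (ROfInt e) \<longleftrightarrow> iok m s e"
| "rok m s (RAdd e f) \<longleftrightarrow> rok m s e \<and> rok m s f"
| "rok m s (RSub e f) \<longleftrightarrow> rok m s e \<and> rok m s f"
| "rok m s (RMul e f) \<longleftrightarrow> rok m s e \<and> rok m s f"
| "rok m s (RDiv e f) \<longleftrightarrow> rok m s e \<and> rok m s f"

primrec bval :: "state \<Rightarrow> bexp \<Rightarrow> bool" where
  "bval s (ILess e f) \<longleftrightarrow> ival s e < ival s f"
| "bval s (IEq e f) \<longleftrightarrow> ival s e = ival s f"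
| "bval s (RLess e f) \<longleftrightarrow> rval s e < rval s f"
| "bval s (BNot b) \<longleftrightarrow> \<not> bval s b"
| "bval s (BAnd b c) \<longleftrightarrow> bval s b \<and> bval s c"

primrec bok :: "nat \<Rightarrow> state \<Rightarrow> bexp \<Rightarrow> bool" where
  "bok m s (ILess e f) \<longleftrightarrow> iok m s e \<and> iok m s f"
| "bok m s (IEq e f) \<longleftrightarrow> iok m s e \<and> iok m s f"
| "bok m s (RLess e f) \<longleftrightarrow> rok m s e \<and> rok m s f"
| "bok m s (BNot b) \<longleftrightarrow> bok m s b"
| "bok m s (BAnd b c) \<longleftrightarrow> bok m s b \<and> bok m s c"

text \<open>
  \<open>big_step m c s t s'\<close>: on a machine of size \<open>m\<close>, the program \<open>c\<close> started in \<open>s\<close> halts in \<open>s'\<close> after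
  \<open>t\<close> steps. Evaluating the expressions of a command is included in its unit cost; their size is
  bounded by the program text, so this changes running times by a constant factor only.
\<close>

inductive big_step :: "nat \<Rightarrow> com \<Rightarrow> state \<Rightarrow> nat \<Rightarrow> state \<Rightarrow> bool" for m :: nat where
  Skip: "big_step m Skip s 1 s"
| ISet: "iok m s e \<Longrightarrow> big_step m (ISet x e) s 1 (s\<lparr>ireg := (ireg s)(x := ival s e)\<rparr>)"
| IStore: "iok m s a \<Longrightarrow> iok m s e \<Longrightarrow>
    big_step m (IStore a e) s 1 (s\<lparr>imem := (imem s)(ival s a := ival s e)\<rparr>)"
| RSet: "rok m s e \<Longrightarrow> big_step m (RSet x e) s 1 (s\<lparr>rreg := (rreg s)(x := rval s e)\<rparr>)"
| RStore: "iok m s a \<Longrightarrow> rok m s e \<Longrightarrow>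
    big_step m (RStore a e) s 1 (s\<lparr>rmem := (rmem s)(ival s a := rval s e)\<rparr>)"
| Sample: "big_step m (Sample x) s 1
    (s\<lparr>rreg := (rreg s)(x := coins s (used s)), used := Suc (used s)\<rparr>)"
| Seq: "big_step m c s t s' \<Longrightarrow> big_step m c' s' t' s'' \<Longrightarrow> big_step m (Seq c c') s (t + t') s''"
| CondTrue: "bok m s b \<Longrightarrow> bval s b \<Longrightarrow> big_step m c s t s' \<Longrightarrow>
    big_step m (Cond b c c') s (Suc t) s'"
| CondFalse: "bok m s b \<Longrightarrow> \<not> bval s b \<Longrightarrow> big_step m c' s t s' \<Longrightarrow>
    big_step m (Cond b c c') s (Suc t) s'"
| WhileFalse: "bok m s b \<Longrightarrow> \<not> bval s b \<Longrightarrow> big_step m (While b c) s 1 s"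
| WhileTrue: "bok m s b \<Longrightarrow> bval s b \<Longrightarrow> big_step m c s t s' \<Longrightarrow>
    big_step m (While b c) s' t' s'' \<Longrightarrow> big_step m (While b c) s (Suc (t + t')) s''"

inductive_cases SkipE: "big_step m Skip s t s'"
inductive_cases ISetE: "big_step m (ISet x e) s t s'"
inductive_cases IStoreE: "big_step m (IStore a e) s t s'"
inductive_cases RSetE: "big_step m (RSet x e) s t s'"
inductive_cases RStoreE: "big_step m (RStore a e) s t s'"
inductive_cases SampleE: "big_step m (Sample x) s t s'"
inductive_cases SeqE: "big_step m (Seq c c') s t s'"
inductive_cases CondE: "big_step m (Cond b c c') s t s'"
inductive_cases WhileE: "big_step m (While b c) s t s'"

lemma big_step_deterministic:
  assumes "big_step m c s t1 s1" and "big_step m c s t2 s2"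
  shows "t1 = t2 \<and> s1 = s2"
  using assms
proof (induction arbitrary: t2 s2 rule: big_step.induct)
  case (Seq c s t s' c' t' s'')
  from Seq.prems show ?case by (rule SeqE) (use Seq.IH in blast)
next
  case (CondTrue s b c t s' c')
  from CondTrue.prems show ?case by (rule CondE) (use CondTrue in blast)+
next
  case (CondFalse s b c' t s' c)
  from CondFalse.prems show ?case by (rule CondE) (use CondFalse in blast)+
next
  case (WhileFalse s b c)
  from WhileFalse.prems show ?case by (rule WhileE) (use WhileFalse in auto)
next
  case (WhileTrue s b c t s' t' s'')
  from WhileTrue.prems show ?case by (rule WhileE) (use WhileTrue in blast)+
qed (auto elim: SkipE ISetE IStoreE RSetE RStoreE SampleE)

primrec sample_free :: "com \<Rightarrow> bool" where
  "sample_free Skip \<longleftrightarrow> True"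
| "sample_free (ISet x e) \<longleftrightarrow> True"
| "sample_free (IStore a e) \<longleftrightarrow> True"
| "sample_free (RSet x e) \<longleftrightarrow> True"
| "sample_free (RStore a e) \<longleftrightarrow> True"
| "sample_free (Sample x) \<longleftrightarrow> False"
| "sample_free (Seq c c') \<longleftrightarrow> sample_free c \<and> sample_free c'"
| "sample_free (Cond b c c') \<longleftrightarrow> sample_free c \<and> sample_free c'"
| "sample_free (While b c) \<longleftrightarrow> sample_free c"

definition coin_space :: "(nat \<Rightarrow> real) measure" where
  "coin_space = (\<Pi>\<^sub>M i\<in>UNIV. std_normal_distribution)"


section \<open>Data structures over a dynamic partition\<close>

record data_structure =
  initialize :: com
  query :: com
  merge :: com

text \<open>
  The machine state after initialization is the data structure; the later operations work on it in
  place. A set \<open>X\<close> of points is presented as a list \<open>xs\<close> without repetitions. Initially the real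
  memory holds the coordinates row by row, integer registers 0 and 1 hold \<open>n\<close> and \<open>d\<close>, and real
  register 0 holds \<open>\<alpha>\<close>.
\<close>

definition start :: "point list \<Rightarrow> nat \<Rightarrow> real \<Rightarrow> (nat \<Rightarrow> real) \<Rightarrow> state" where
  "start xs d \<alpha> \<omega> = \<lparr>
     ireg = (\<lambda>_. 0)(0 := length xs, 1 := d),
     rreg = (\<lambda>_. 0)(0 := \<alpha>),
     imem = (\<lambda>_. 0),
     rmem = (\<lambda>a. if a < length xs * d then xs ! (a div d) ! (a mod d) else 0),
     coins = \<omega>,
     used = 0\<rparr>"

text \<open>
  Points are passed to and returned by the operations as positions in \<open>xs\<close>, and clusters as integer
  handles. The handle of an initial cluster \<open>{x}\<close> is the position of \<open>x\<close>; the handle of a merged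
  cluster is chosen by the data structure. Arguments are passed in integer registers 0 and 1, the
  result is returned in integer register 0, and all other registers and the memory persist.
\<close>

definition position :: "point list \<Rightarrow> point \<Rightarrow> nat" where
  "position xs p = (THE i. i < length xs \<and> xs ! i = p)"

definition with_args :: "nat \<Rightarrow> nat \<Rightarrow> state \<Rightarrow> state" where
  "with_args a b s = s\<lparr>ireg := (ireg s)(0 := a, 1 := b)\<rparr>"

datatype operation = Query "point set" point | Merge "point set" "point set"

type_synonym handles = "point set \<Rightarrow> nat"

text \<open>
  \<open>admissible X P ops\<close>: starting from the partition \<open>P\<close>, every operation of \<open>ops\<close> refers to current
  clusters only. Merging consumes its two arguments.
\<close>

fun admissible :: "point set \<Rightarrow> point set set \<Rightarrow> operation list \<Rightarrow> bool" where
  "admissible X P [] \<longleftrightarrow> True"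
| "admissible X P (Query S q # ops) \<longleftrightarrow> S \<in> P \<and> q \<in> X \<and> admissible X P ops"
| "admissible X P (Merge S S' # ops) \<longleftrightarrow> S \<in> P \<and> S' \<in> P \<and> S \<noteq> S' \<and>
     admissible X (insert (S \<union> S') (P - {S, S'})) ops"

definition singletons :: "point set \<Rightarrow> point set set" where
  "singletons X = (\<lambda>x. {x}) ` X"

inductive op_step ::
  "nat \<Rightarrow> data_structure \<Rightarrow> point list \<Rightarrow> state \<times> handles \<Rightarrow> operation \<Rightarrow> nat \<Rightarrow> state \<times> handles \<Rightarrow> bool"
  for m D xs where
  Query: "big_step m (query D) (with_args (h S) (position xs q) s) t s' \<Longrightarrow>
    op_step m D xs (s, h) (Query S q) t (s', h)"
| Merge: "big_step m (merge D) (with_args (h S) (h S') s) t s' \<Longrightarrow>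
    op_step m D xs (s, h) (Merge S S') t (s', h(S \<union> S' := ireg s' 0))"

inductive run ::
  "nat \<Rightarrow> data_structure \<Rightarrow> point list \<Rightarrow> nat \<Rightarrow> real \<Rightarrow> (nat \<Rightarrow> real) \<Rightarrow>
    operation list \<Rightarrow> state \<times> handles \<Rightarrow> bool"
  for m D xs d \<alpha> \<omega> where
  Init: "big_step m (initialize D) (start xs d \<alpha> \<omega>) t s \<Longrightarrow>
    run m D xs d \<alpha> \<omega> [] (s, \<lambda>S. position xs (the_elem S))"
| Step: "run m D xs d \<alpha> \<omega> ops c \<Longrightarrow> op_step m D xs c opn t c' \<Longrightarrow>
    run m D xs d \<alpha> \<omega> (ops @ [opn]) c'"

definition query_succeeds ::
  "nat \<Rightarrow> data_structure \<Rightarrow> point list \<Rightarrow> nat \<Rightarrow> real \<Rightarrow> (nat \<Rightarrow> real) \<Rightarrow>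
    operation list \<Rightarrow> point set \<Rightarrow> point \<Rightarrow> bool" where
  "query_succeeds m D xs d \<alpha> \<omega> ops S q \<longleftrightarrow>
     (\<exists>c t s' h'. run m D xs d \<alpha> \<omega> ops c \<and> op_step m D xs c (Query S q) t (s', h') \<and>
        ireg s' 0 < length xs \<and> approx_farthest \<alpha> S q (xs ! ireg s' 0))"

text \<open>
  The factor hidden by soft-O notation. The logarithm of \<open>n + 1\<close> is at least 1 for every \<open>n \<ge> 1\<close>, and it is
  within a factor 2 of \<open>log 2 n\<close> for \<open>n \<ge> 2\<close>.
\<close>

definition polylog :: "real \<Rightarrow> nat \<Rightarrow> nat \<Rightarrow> real" where
  "polylog K k n = K * log 2 (real n + 1) ^ k"

end

theory Submission
  imports Defs
begin

text \<open>
  Points are projected on Gaussian directions. Write \<open>r\<close> for the distance of the query \<open>q\<close> to its farthest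
  point and put a threshold at \<open>r / \<alpha>\<close> times \<open>sqrt (2 ln n)\<close>. In one direction, a point at distance
  below \<open>r / \<alpha>\<close> exceeds the threshold with probability at most \<open>1 / n\<close>, while the farthest point does so
  with probability \<open>n powr (- 1 / \<alpha>\<^sup>2)\<close> up to a logarithmic factor. Among \<open>L\<close> directions, \<open>L\<close> being
  \<open>n powr (1 / \<alpha>\<^sup>2)\<close> up to logarithms, the farthest point therefore exceeds the threshold at least
  once with constant probability, and by Markov's inequality only \<open>O(L)\<close> pairs of a direction and a near
  point do. Hence the \<open>O(L)\<close> largest projections contain an approximate farthest neighbor. A logarithmic
  number of independent groups of \<open>L\<close> directions reduces the failure probability to \<open>1 / n ^ 3\<close>.

  To list the largest projections of a cluster, a cluster is kept as a forest of perfect tournament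
  trees of distinct ranks, one for each binary digit of its size. The shape of a tree is the same for
  all directions; only the winners at its nodes differ. Two clusters are merged like binary numbers are
  added, with at most one link per rank, so a merge takes \<open>O(L)\<close> time up to logarithms whatever the sizes.
  A query runs a priority queue over all trees and directions of a group and replaces a popped node by its
  two children. A point is popped at most once per rank, so \<open>O(L log n)\<close> pops suffice.
\<close>

section \<open>Weakest preconditions with running times\<close>

text \<open>A query knows neither \<open>r\<close> nor the threshold, and the machine can neither
  round reals nor take roots or logarithms. The threshold therefore occurs only in the analysis: the
  program pops a fixed number of candidates in the order of their projections, and the potential
  argument is quantified over all thresholds and all sets of near points. The exponent
  \<open>1 / \<alpha>\<^sup>2\<close> enters the program only through comparisons of reals that find
  the least \<open>e\<close> with \<open>b \<le> e * \<alpha>\<^sup>2\<close>, where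
  \<open>b\<close> is the bit length of \<open>n\<close>; then \<open>2 ^ e\<close> is within a
  constant factor of the wanted power of \<open>n\<close>. Determinism and chance are kept apart.
  For every outcome of the coins all operations halt, keep the invariant and obey their time bounds,
  and a query is correct whenever one group of directions is good for the cluster \<open>S\<close>
  and the query \<open>q\<close>. Goodness mentions only the coins, \<open>S\<close> and
  \<open>q\<close>, so its probability can be estimated without looking at the operations executed
  before.\<close>

definition wp :: "nat \<Rightarrow> com \<Rightarrow> (nat \<Rightarrow> state \<Rightarrow> bool) \<Rightarrow> state \<Rightarrow> bool" where
  "wp m c Q s \<longleftrightarrow> (\<exists>t s'. big_step m c s t s' \<and> Q t s')"

lemma wp_Skip: "wp m Skip Q s \<longleftrightarrow> Q 1 s"
  unfolding wp_def by (auto elim!: SkipE) (metis big_step.Skip One_nat_def)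

lemma wp_ISet: "wp m (ISet x e) Q s \<longleftrightarrow> iok m s e \<and> Q 1 (s\<lparr>ireg := (ireg s)(x := ival s e)\<rparr>)"
  unfolding wp_def by (auto elim!: ISetE) (metis big_step.ISet One_nat_def)

lemma wp_IStore: "wp m (IStore a e) Q s \<longleftrightarrow>
    iok m s a \<and> iok m s e \<and> Q 1 (s\<lparr>imem := (imem s)(ival s a := ival s e)\<rparr>)"
  unfolding wp_def by (auto elim!: IStoreE) (metis big_step.IStore One_nat_def)

lemma wp_RSet: "wp m (RSet x e) Q s \<longleftrightarrow> rok m s e \<and> Q 1 (s\<lparr>rreg := (rreg s)(x := rval s e)\<rparr>)"
  unfolding wp_def by (auto elim!: RSetE) (metis big_step.RSet One_nat_def)

lemma wp_RStore: "wp m (RStore a e) Q s \<longleftrightarrow>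
    iok m s a \<and> rok m s e \<and> Q 1 (s\<lparr>rmem := (rmem s)(ival s a := rval s e)\<rparr>)"
  unfolding wp_def by (auto elim!: RStoreE) (metis big_step.RStore One_nat_def)

lemma wp_Sample: "wp m (Sample x) Q s \<longleftrightarrow>
    Q 1 (s\<lparr>rreg := (rreg s)(x := coins s (used s)), used := Suc (used s)\<rparr>)"
  unfolding wp_def by (auto elim!: SampleE) (metis big_step.Sample One_nat_def)

lemma wp_Seq: "wp m (Seq c c') Q s \<longleftrightarrow> wp m c (\<lambda>t s'. wp m c' (\<lambda>t' s''. Q (t + t') s'') s') s"
  unfolding wp_def by (auto elim!: SeqE) (metis big_step.Seq)+

lemma wp_Cond: "wp m (Cond b c c') Q s \<longleftrightarrow>
    bok m s b \<and> (if bval s b then wp m c (\<lambda>t. Q (Suc t)) s else wp m c' (\<lambda>t. Q (Suc t)) s)"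
  unfolding wp_def by (auto elim!: CondE) (metis big_step.CondTrue big_step.CondFalse)+

lemmas wp_simps = wp_Skip wp_ISet wp_IStore wp_RSet wp_RStore wp_Sample wp_Seq wp_Cond

lemma wp_mono: "wp m c Q s \<Longrightarrow> (\<And>t s'. Q t s' \<Longrightarrow> Q' t s') \<Longrightarrow> wp m c Q' s"
  unfolding wp_def by blast

lemma wp_SeqI:
  assumes "wp m c P s" and "\<And>t s'. P t s' \<Longrightarrow> wp m c' (\<lambda>t' s''. Q (t + t') s'') s'"
  shows "wp m (Seq c c') Q s"
  unfolding wp_Seq using assms by (rule wp_mono)

lemma wp_while_false: "bok m s b \<Longrightarrow> \<not> bval s b \<Longrightarrow> Q 1 s \<Longrightarrow> wp m (While b c) Q s"
  unfolding wp_def by (blast intro: big_step.intros)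

lemma wp_while_true:
  assumes "bok m s b" "bval s b"
    and "wp m c (\<lambda>t s'. wp m (While b c) (\<lambda>t' s''. Q (Suc (t + t')) s'') s') s"
  shows "wp m (While b c) Q s"
  using assms unfolding wp_def by (blast intro: big_step.intros)

text \<open>\<open>k\<close> bounds the number of remaining iterations, which suits loops whose
  exact count depends on the data. An iteration costs its body and one test; the last, failing test
  accounts for the leading 1.\<close>

lemma wp_while:
  assumes inv: "I k s"
    and step: "\<And>k s. I k s \<Longrightarrow>
      bok m s b \<and> (bval s b \<longrightarrow> 0 < k \<and> wp m c (\<lambda>t s'. t \<le> \<tau> \<and> I (k - 1) s') s)"
    and post: "\<And>t k' s'. t \<le> 1 + k * (\<tau> + 1) \<Longrightarrow> I k' s' \<Longrightarrow> \<not> bval s' b \<Longrightarrow> Q t s'"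
  shows "wp m (While b c) Q s"
proof -
  have "wp m (While b c) (\<lambda>t s'. t \<le> 1 + k * (\<tau> + 1) \<and> \<not> bval s' b \<and> (\<exists>k'. I k' s')) s"
    using inv
  proof (induction k arbitrary: s)
    case 0
    then show ?case using step[OF 0] by (intro wp_while_false) auto
  next
    case (Suc k)
    show ?case
    proof (cases "bval s b")
      case True
      with step[OF Suc.prems] have "bok m s b" and
        body: "wp m c (\<lambda>t s'. t \<le> \<tau> \<and> I k s') s" by auto
      show ?thesis
      proof (rule wp_while_true[OF \<open>bok m s b\<close> True], rule wp_mono[OF body])
        fix t s' assume A: "t \<le> \<tau> \<and> I k s'"
        show "wp m (While b c) (\<lambda>t' s''. Suc (t + t') \<le> 1 + Suc k * (\<tau> + 1) \<and>
            \<not> bval s'' b \<and> (\<exists>k'. I k' s'')) s'"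
          by (rule wp_mono[OF Suc.IH]) (use A in auto)
      qed
    next
      case False
      then show ?thesis using step[OF Suc.prems] Suc.prems by (intro wp_while_false) auto
    qed
  qed
  then show ?thesis by (rule wp_mono) (use post in blast)
qed

text \<open>The upward counter is turned into the variant \<open>N - k\<close> of
  \<open>wp_while\<close>. Here the index alone decides the guard, so the loop is known to end with
  \<open>I N\<close>.\<close>

lemma wp_for:
  assumes inv: "I 0 s"
    and step: "\<And>k s. k < N \<Longrightarrow> I k s \<Longrightarrow>
      bok m s b \<and> bval s b \<and> wp m c (\<lambda>t s'. t \<le> \<tau> \<and> I (Suc k) s') s"
    and stop: "\<And>s. I N s \<Longrightarrow> bok m s b \<and> \<not> bval s b"
    and post: "\<And>t s'. t \<le> 1 + N * (\<tau> + 1) \<Longrightarrow> I N s' \<Longrightarrow> Q t s'"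
  shows "wp m (While b c) Q s"
proof (rule wp_while[where I = "\<lambda>k s. k \<le> N \<and> I (N - k) s" and k = N and \<tau> = \<tau>])
  show "N \<le> N \<and> I (N - N) s" using inv by simp
next
  fix k s assume A: "k \<le> N \<and> I (N - k) s"
  show "bok m s b \<and> (bval s b \<longrightarrow> 0 < k \<and> wp m c (\<lambda>t s'. t \<le> \<tau> \<and> k - 1 \<le> N \<and> I (N - (k - 1)) s') s)"
  proof (cases "k = 0")
    case True then show ?thesis using A stop[of s] by simp
  next
    case False
    then have "N - k < N" and "Suc (N - k) = N - (k - 1)" using A by auto
    then show ?thesis using A step[of "N - k" s] False
      by (auto elim!: wp_mono)
  qed
next
  fix t k' s' assume "t \<le> 1 + N * (\<tau> + 1)" "k' \<le> N \<and> I (N - k') s'" "\<not> bval s' b"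
  then have "k' = 0" using step[of "N - k'" s'] by (cases "k' = 0") auto
  then show "Q t s'" using post[of t s'] \<open>t \<le> _\<close> \<open>k' \<le> N \<and> _\<close> by simp
qed

section \<open>The programs\<close>

abbreviation seq (infixr ";;" 60) where "c ;; c' \<equiv> Seq c c'"
text \<open>
  Registers 2 to 13 hold the parameters of the data structure, with the values fixed in the locale
  \<open>sizes\<close> below; all higher registers are scratch. Integer memory consists of the forest roots
  \<open>a * b + j\<close> (root of rank \<open>j\<close> of the cluster with handle \<open>a\<close>, shifted by one so that 0 means absent),
  the right children \<open>H + r * n + x\<close>, the winners \<open>A + i * H + r * n + x\<close> of the tree \<open>(r, x)\<close> in
  direction \<open>i\<close>, and from \<open>P\<close> on the priority queue of a query. Real memory holds the coordinates and,
  at the address of each winner, its projection. A candidate \<open>(i, r, x)\<close> of the queue is encoded as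
  \<open>1 + i * H + r * n + x\<close>, and 0 is the empty slot.
\<close>

abbreviation "vN \<equiv> IReg 2"
abbreviation "vD \<equiv> IReg 3"
abbreviation "vB \<equiv> IReg 4"
abbreviation "vW \<equiv> IReg 5"
abbreviation "vL \<equiv> IReg 6"
abbreviation "vG \<equiv> IReg 7"
abbreviation "vH \<equiv> IReg 8"
abbreviation "vA \<equiv> IReg 9"
abbreviation "vP \<equiv> IReg 10"
abbreviation "vZ \<equiv> IReg 11"
abbreviation "vM \<equiv> IReg 12"
abbreviation "vQ \<equiv> IReg 13"
abbreviation "incr x \<equiv> ISet x (IAdd (IReg x) (IConst 1))"

text \<open>The projection of \<open>x - q\<close> is the difference of two stored values: the one
  at the candidate and the one at the rank 0 slot of \<open>q\<close> in the same direction. A query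
  thus never needs the direction vectors, which are not stored.\<close>

definition key_exp :: "iexp \<Rightarrow> rexp" where
  "key_exp u = RSub (RLoad (IAdd vA (ISub u (IConst 1))))
     (RLoad (IAdd vA (IAdd (IMul (IDiv (ISub u (IConst 1)) vH) vH) (IReg 1))))"

text \<open>The queue is a tournament tree in heap layout: node \<open>k\<close> holds a copy of the
  better of nodes \<open>2 * k\<close> and \<open>2 * k + 1\<close>, and the leaves are
  \<open>Z\<close> to \<open>2 * Z - 1\<close>. The tests against 0 make the empty slot lose against
  every candidate.\<close>

definition pull :: com where
  "pull =
     ISet 16 (ILoad (IAdd vP (IMul (IConst 2) (IReg 15))));;
     ISet 17 (ILoad (IAdd vP (IAdd (IMul (IConst 2) (IReg 15)) (IConst 1))));;
     Cond (BAnd (BNot (IEq (IReg 16) (IConst 0)))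
            (BNot (BAnd (ILess (IConst 0) (IReg 17))
               (RLess (key_exp (IReg 16)) (key_exp (IReg 17))))))
       (IStore (IAdd vP (IReg 15)) (IReg 16))
       (IStore (IAdd vP (IReg 15)) (IReg 17))"

definition sift_up :: com where
  "sift_up = While (ILess (IConst 1) (IReg 15)) (ISet 15 (IDiv (IReg 15) (IConst 2));; pull)"

definition build_tree :: com where
  "build_tree = ISet 15 (ISub vZ (IConst 1));;
     While (ILess (IConst 0) (IReg 15)) (pull;; ISet 15 (ISub (IReg 15) (IConst 1)))"

text \<open>Slot \<open>k\<close> stands for direction \<open>k div b\<close> of the group and rank
  \<open>k mod b\<close>. Because \<open>H = b * n\<close> and roots are shifted by one,
  \<open>(g * (L * b) + k) * n\<close> plus the root is already the code of this candidate, without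
  splitting \<open>k\<close>.\<close>

definition fill_leaves :: com where
  "fill_leaves = ISet 18 (IConst 0);;
     While (ILess (IReg 18) vZ)
       (ISet 19 (ILoad (IAdd (IMul (IReg 0) vB) (IMod (IReg 18) vB)));;
        Cond (BAnd (ILess (IConst 0) (IReg 19)) (ILess (IReg 18) (IMul vL vB)))
          (IStore (IAdd vP (IAdd vZ (IReg 18)))
             (IAdd (IMul (IAdd (IMul (IReg 14) (IMul vL vB)) (IReg 18)) vN) (IReg 19)))
          (IStore (IAdd vP (IAdd vZ (IReg 18))) (IConst 0));;
        incr 18)"

definition distance :: com where
  "distance = RSet 2 (ROfInt (IConst 0));; ISet 24 (IConst 0);;
     While (ILess (IReg 24) vD)
       (RSet 3 (RSub (RLoad (IAdd (IMul (IReg 23) vD) (IReg 24)))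
                     (RLoad (IAdd (IMul (IReg 1) vD) (IReg 24))));;
        RSet 2 (RAdd (RReg 2) (RMul (RReg 3) (RReg 3)));;
        incr 24)"

definition find_leaf :: com where
  "find_leaf = ISet 15 (IConst 1);;
     While (ILess (IReg 15) vZ)
       (Cond (IEq (ILoad (IAdd vP (IMul (IConst 2) (IReg 15)))) (IReg 21))
          (ISet 15 (IMul (IConst 2) (IReg 15)))
          (ISet 15 (IAdd (IMul (IConst 2) (IReg 15)) (IConst 1))))"

text \<open>Going down one rank subtracts \<open>n\<close> from a code. The left child keeps the
  representative; for the right child it is exchanged for the stored one.\<close>

definition expand :: com where
  "expand =
     Cond (IEq (IMod (IDiv (IReg 22) vN) vB) (IConst 0))
       (ISet 26 (IConst 0);; ISet 27 (IConst 0))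
       (ISet 26 (ISub (IReg 21) vN);;
        ISet 27 (IAdd (ISub (IReg 26) (IMod (IReg 22) vN))
                   (ILoad (IAdd vH (ISub (IMod (IReg 22) vH) vN)))))"

text \<open>The first child reuses the leaf of the popped node and the second takes a fresh leaf,
  counted by register 18. Hence a group needs one leaf for each direction and rank and one more for
  each pop, which is the sum \<open>L * b + M = Z\<close>. On an empty queue the pop is
  idle.\<close>

definition pop :: com where
  "pop = ISet 21 (ILoad (IAdd vP (IConst 1)));;
     Cond (IEq (IReg 21) (IConst 0)) Skip
       (ISet 22 (ISub (IReg 21) (IConst 1));;
        ISet 23 (ILoad (IAdd vA (IReg 22)));;
        distance;;
        Cond (RLess (RReg 1) (RReg 2)) (RSet 1 (RReg 2);; ISet 25 (IReg 23)) Skip;;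
        find_leaf;;
        expand;;
        IStore (IAdd vP (IReg 15)) (IReg 26);; sift_up;;
        ISet 15 (IAdd vZ (IReg 18));;
        IStore (IAdd vP (IReg 15)) (IReg 27);; sift_up;;
        incr 18)"

definition query_group :: com where
  "query_group = fill_leaves;; build_tree;; ISet 18 (IMul vL vB);; ISet 20 (IConst 0);;
     While (ILess (IReg 20) vM) (pop;; incr 20)"

text \<open>The initial value -1 lies below every squared distance, so the first winner is always
  accepted. Comparing squares avoids roots.\<close>

definition query_prog :: com where
  "query_prog = ISet 25 (IConst 0);; RSet 1 (RSub (ROfInt (IConst 0)) (ROfInt (IConst 1)));;
     ISet 14 (IConst 0);;
     While (ILess (IReg 14) vG) (query_group;; incr 14);;
     ISet 0 (IReg 25)"

text \<open>The new root keeps the representative of the first tree, so its slots lie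
  \<open>n\<close> beyond those of the old root.\<close>

definition link :: com where
  "link = IStore (IAdd vH (IAdd (IMul (IReg 14) vN) (ISub (IReg 15) (IConst 1)))) (ISub (IReg 16) (IConst 1));;
     ISet 17 (IConst 0);;
     While (ILess (IReg 17) vQ)
       (ISet 18 (IAdd vA (IAdd (IMul (IReg 17) vH) (IAdd (IMul (IReg 14) vN) (ISub (IReg 15) (IConst 1)))));;
        ISet 19 (IAdd vA (IAdd (IMul (IReg 17) vH) (IAdd (IMul (IReg 14) vN) (ISub (IReg 16) (IConst 1)))));;
        Cond (RLess (RLoad (IReg 18)) (RLoad (IReg 19))) (ISet 20 (IReg 19)) (ISet 20 (IReg 18));;
        RStore (IAdd (IReg 18) vN) (RLoad (IReg 20));;
        IStore (IAdd (IReg 18) vN) (ILoad (IReg 20));;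
        incr 17)"

text \<open>Register 15 is the carry. If the carry and the second cluster both have a tree of this
  rank, these two are linked and a tree of the first cluster stays in place as the digit of the sum;
  this is why one link per rank suffices. Register 0 is left alone, so the union inherits the handle
  of the first cluster.\<close>

definition merge_rank :: com where
  "merge_rank =
     ISet 16 (ILoad (IAdd (IMul (IReg 1) vB) (IReg 14)));;
     IStore (IAdd (IMul (IReg 1) vB) (IReg 14)) (IConst 0);;
     Cond (IEq (IReg 15) (IConst 0)) (ISet 15 (IReg 16);; ISet 16 (IConst 0)) Skip;;
     Cond (IEq (IReg 15) (IConst 0)) Skip
       (Cond (IEq (IReg 16) (IConst 0))
          (ISet 16 (ILoad (IAdd (IMul (IReg 0) vB) (IReg 14)));;
           IStore (IAdd (IMul (IReg 0) vB) (IReg 14)) (IConst 0)) Skip;;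
        Cond (IEq (IReg 16) (IConst 0))
          (IStore (IAdd (IMul (IReg 0) vB) (IReg 14)) (IReg 15);; ISet 15 (IConst 0)) link)"

definition merge_prog :: com where
  "merge_prog = ISet 14 (IConst 0);; ISet 15 (IConst 0);;
     While (ILess (IReg 14) vB) (merge_rank;; incr 14)"

text \<open>The first loop finds the least \<open>b\<close> with \<open>n < 2 ^ b\<close>, the
  second doubles \<open>W\<close> until \<open>e * \<alpha>\<^sup>2\<close> reaches
  \<open>b\<close>. There are \<open>3 * b\<close> groups because each fails with probability at
  most 1 / 2, and \<open>2 ^ (3 * b)\<close> exceeds \<open>n ^ 3\<close>.\<close>

definition init_sizes :: com where
  "init_sizes = ISet 2 (IReg 0);; ISet 3 (IReg 1);;
     ISet 4 (IConst 0);; ISet 14 (IConst 1);;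
     While (BNot (ILess vN (IReg 14))) (ISet 14 (IMul (IReg 14) (IConst 2));; incr 4);;
     ISet 5 (IConst 1);; ISet 14 (IConst 0);;
     While (RLess (RMul (ROfInt (IReg 14)) (RMul (RReg 0) (RReg 0))) (ROfInt vB))
       (ISet 5 (IMul vW (IConst 2));; incr 14);;
     ISet 6 (IMul (IConst 64) (IMul vB vW));;
     ISet 7 (IMul (IConst 3) vB);;
     ISet 8 (IMul vB vN);;
     ISet 9 (IAdd (IMul (IConst 2) vH) (IMul vN vD));;
     ISet 13 (IMul vG vL);;
     ISet 10 (IAdd vA (IMul vQ vH));;
     ISet 11 (IMul (IConst 5) (IMul vL vB));;
     ISet 12 (IMul (IConst 4) (IMul vL vB))"

definition init_forest :: com where
  "init_forest = ISet 14 (IConst 0);;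
     While (ILess (IReg 14) vN)
       (IStore (IMul (IReg 14) vB) (IAdd (IReg 14) (IConst 1));; incr 14)"

definition init_winners :: com where
  "init_winners = ISet 16 (IConst 0);;
     While (ILess (IReg 16) vN)
       (IStore (IAdd (IReg 15) (IReg 16)) (IReg 16);; incr 16)"

text \<open>Each Gaussian coordinate is added to the projections of all points as soon as it is
  drawn, so a single register is enough for the direction.\<close>

definition init_coordinate :: com where
  "init_coordinate = Sample 1;; ISet 16 (IConst 0);;
     While (ILess (IReg 16) vN)
       (RStore (IAdd (IReg 15) (IReg 16))
          (RAdd (RLoad (IAdd (IReg 15) (IReg 16)))
            (RMul (RReg 1) (RLoad (IAdd (IMul (IReg 16) vD) (IReg 17)))));;
        incr 16)"

definition init_projections :: com where
  "init_projections = ISet 14 (IConst 0);;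
     While (ILess (IReg 14) vQ)
       (ISet 15 (IAdd vA (IMul (IReg 14) vH));; init_winners;;
        ISet 17 (IConst 0);;
        While (ILess (IReg 17) vD) (init_coordinate;; incr 17);;
        incr 14)"

definition init_prog :: com where
  "init_prog = init_sizes;; init_forest;; init_projections"

definition afn_structure :: data_structure where
  "afn_structure = \<lparr>initialize = init_prog, query = query_prog, merge = merge_prog\<rparr>"

lemma sample_free_afn: "sample_free (query afn_structure)" "sample_free (merge afn_structure)"
  by (simp_all add: afn_structure_def query_prog_def query_group_def fill_leaves_def build_tree_def
      pop_def distance_def find_leaf_def expand_def sift_up_def pull_def merge_prog_def
      merge_rank_def link_def)

text \<open>The summands of \<open>mem\<close> are, in this order, the tables of roots and of right
  children, the coordinates, the \<open>Q * H\<close> winners, the \<open>2 * Z\<close> nodes of the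
  queue, and room for the powers of two that the size loops form.\<close>

locale sizes =
  fixes m n d b W :: nat
  assumes b_pos: "0 < b" and n_lower: "2 ^ (b - 1) \<le> n" and n_upper: "n < 2 ^ b"
    and W_pos: "0 < W" and W_upper: "W \<le> 2 ^ b"
    and mem: "2 * (b * n) + n * d + 192 * b * b * W * (b * n) + 640 * b * b * W + 2 ^ b < m"
begin

definition "L = 64 * b * W"
definition "Q = 3 * b * L"
definition "H = b * n"
definition "A = 2 * H + n * d"
definition "P = A + Q * H"
definition "Z = 5 * L * b"
definition "M = 4 * L * b"

definition Par :: "state \<Rightarrow> bool" where
  "Par s \<longleftrightarrow> ireg s 2 = n \<and> ireg s 3 = d \<and> ireg s 4 = b \<and> ireg s 6 = L \<and> ireg s 7 = 3 * b \<and>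
     ireg s 8 = H \<and> ireg s 9 = A \<and> ireg s 10 = P \<and> ireg s 11 = Z \<and> ireg s 12 = M \<and> ireg s 13 = Q"

lemma n_pos: "0 < n" using n_lower by (meson less_le_trans zero_less_numeral zero_less_power)
lemma L_pos: "0 < L" using b_pos W_pos by (simp add: L_def)
lemma H_pos: "0 < H" using b_pos n_pos by (simp add: H_def)
lemma Q_pos: "0 < Q" using b_pos L_pos by (simp add: Q_def)
lemma Z_pos: "0 < Z" using b_pos L_pos by (simp add: Z_def)

lemma memP: "P + 2 * Z < m"
  using mem unfolding P_def A_def H_def Q_def Z_def L_def by (simp add: algebra_simps)

lemma n_le_H: "n \<le> H" using b_pos by (simp add: H_def)
lemma b_le_H: "b \<le> H" using n_pos by (simp add: H_def)
lemma Lb_le_Z: "L * b \<le> Z" by (simp add: Z_def)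
lemma Lb_M: "L * b + M = Z" by (simp add: Z_def M_def)

lemma bounds: "n < m" "d < m" "b < m" "3 * b < m" "L < m" "H < m" "A < m" "P < m" "Z < m" "M < m" "Q < m" "Q * H < m"
    "L * b < m" "320 < m"
proof -
  have d: "d \<le> n * d" using n_pos by simp
  have Lb: "L \<le> L * b" "L * b \<le> Z" "M \<le> Z" using b_pos by (simp_all add: Z_def M_def)
  have bL: "3 * b \<le> L" unfolding L_def using W_pos by (simp add: mult.commute)
  have QH: "Q \<le> Q * H" using H_pos by simp
  have "1 * 1 * 1 * 1 \<le> b * W * b * 1" using b_pos W_pos by (intro mult_le_mono) auto
  then have Z: "320 \<le> Z" unfolding Z_def L_def by simp
  show "n < m" "d < m" "b < m" "3 * b < m" "L < m" "H < m" "A < m" "P < m" "Z < m" "M < m" "Q < m" "Q * H < m"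
    "L * b < m" "320 < m"
    using memP d Lb bL QH Z n_le_H b_le_H unfolding P_def A_def by linarith+
qed

end

section \<open>The priority queue of a query\<close>

context sizes
begin

definition key :: "(nat \<Rightarrow> real) \<Rightarrow> nat \<Rightarrow> nat \<Rightarrow> real" where
  "key rm q u = rm (A + (u - 1)) - rm (A + ((u - 1) div H * H + q))"

definition best :: "(nat \<Rightarrow> real) \<Rightarrow> nat \<Rightarrow> nat \<Rightarrow> nat \<Rightarrow> nat" where
  "best rm q u v = (if u \<noteq> 0 \<and> \<not> (0 < v \<and> key rm q u < key rm q v) then u else v)"

text \<open>Below \<open>P\<close> lies the data structure and from \<open>P\<close> on the queue,
  so this frame is what makes a query harmless for later operations.\<close>

definition frame :: "nat set \<Rightarrow> state \<Rightarrow> state \<Rightarrow> bool" where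
  "frame R s s' \<longleftrightarrow> (\<forall>x. x \<notin> R \<longrightarrow> ireg s' x = ireg s x) \<and> rmem s' = rmem s \<and> coins s' = coins s \<and>
     used s' = used s \<and> (\<forall>a<P. imem s' a = imem s a)"

lemma frame_refl: "frame R s s" by (simp add: frame_def)

lemma frame_trans: "frame R s s' \<Longrightarrow> frame R' s' s'' \<Longrightarrow> R \<union> R' \<subseteq> R'' \<Longrightarrow> frame R'' s s''"
  unfolding frame_def by (metis UnCI subsetD)

lemma frame_Par: "frame R s s' \<Longrightarrow> R \<inter> {..13} = {} \<Longrightarrow> Par s \<Longrightarrow> Par s'"
proof -
  assume F: "frame R s s'" and "R \<inter> {..13} = {}" and P: "Par s"
  then have "ireg s' x = ireg s x" if "x \<le> 13" for x using that by (auto simp: frame_def disjoint_iff)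
  then show "Par s'" using P by (simp add: Par_def)
qed

text \<open>The bound also holds for slots left over from earlier queries, so that every slot, stale
  or not, decodes to an address inside the memory.\<close>

definition codes :: "state \<Rightarrow> bool" where
  "codes s \<longleftrightarrow> (\<forall>k. 1 \<le> k \<and> k < 2 * Z \<longrightarrow> imem s (P + k) \<le> Q * H)"

definition tourn :: "nat \<Rightarrow> state \<Rightarrow> nat \<Rightarrow> bool" where
  "tourn q s i \<longleftrightarrow>
     imem s (P + i) = best (rmem s) q (imem s (P + 2 * i)) (imem s (P + (2 * i + 1)))"

text \<open>Conditions are evaluated without short circuit, so the key of the empty slot 0 must be
  addressable as well; truncated subtraction sends it to offset 0.\<close>

lemma key_index:
  assumes "u \<le> Q * H" "q < n"
  shows "(u - 1) div H * H + q < Q * H" "(u - 1) div H * H < Q * H" "(u - 1) div H < Q * H" "u - 1 < Q * H"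
proof -
  have "0 < Q * H" using Q_pos H_pos by simp
  then show 1: "u - 1 < Q * H" using assms by linarith
  then have "(u - 1) div H < Q" using H_pos by (simp add: less_mult_imp_div_less)
  then have "Suc ((u - 1) div H) * H \<le> Q * H" by (intro mult_le_mono1) simp
  then show "(u - 1) div H * H + q < Q * H" using assms n_le_H by simp
  then show "(u - 1) div H * H < Q * H" by linarith
  moreover have "(u - 1) div H \<le> (u - 1) div H * H" using H_pos by simp
  ultimately show "(u - 1) div H < Q * H" by linarith
qed

lemma rok_key:
  assumes "Par s" "ireg s 1 = q" "q < n" "ireg s x \<le> Q * H"
  shows "rok m s (key_exp (IReg x))" "rval s (key_exp (IReg x)) = key (rmem s) q (ireg s x)"
proof -
  note key_index[OF assms(4,3)]
  moreover have "Q * H < m" "P = A + Q * H" "A < m" "H \<le> A" "1 < m"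
    using memP Z_pos by (auto simp: P_def A_def)
  ultimately show "rok m s (key_exp (IReg x))"
    using assms memP n_le_H unfolding key_exp_def Par_def
    by (simp add: mult.commute)
  show "rval s (key_exp (IReg x)) = key (rmem s) q (ireg s x)"
    using assms by (simp add: key_exp_def key_def Par_def)
qed

lemma best_le: "best rm q u v \<le> c" if "u \<le> c" "v \<le> c"
  using that by (simp add: best_def)

lemma wp_pull:
  assumes "Par s" "ireg s 15 = k" "ireg s 1 = q" "q < n" "codes s" "0 < k" "k < Z"
    and Q: "\<And>t s'. t \<le> 4 \<Longrightarrow> rreg s' = rreg s \<Longrightarrow> frame {16,17} s s' \<Longrightarrow>
      imem s' = (imem s)(P + k := best (rmem s) q (imem s (P + 2 * k)) (imem s (P + (2 * k + 1)))) \<Longrightarrow>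
      codes s' \<Longrightarrow> R t s'"
  shows "wp m pull R s"
proof -
  let ?u = "imem s (P + 2 * k)" and ?v = "imem s (P + (2 * k + 1))"
  let ?w = "best (rmem s) q ?u ?v"
  let ?s = "s\<lparr>ireg := (ireg s)(16 := ?u, 17 := ?v)\<rparr>"
  let ?f = "?s\<lparr>imem := (imem s)(P + k := ?w)\<rparr>"
  have uv: "?u \<le> Q * H" "?v \<le> Q * H"
    using assms(5)[unfolded codes_def, rule_format, of "2 * k"]
      assms(5)[unfolded codes_def, rule_format, of "2 * k + 1"] assms(6,7) by auto
  have 1: "Par ?s" "ireg ?s 1 = q" using assms by (auto simp: Par_def)
  have le: "Q * H < m" "P < m" "P + 2 * k < m" "P + (2 * k + 1) < m" "1 < m" "2 < m"
      "P + k < m" "2 * k < m" "2 * k + 1 < m" "k < m"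
    using memP assms Z_pos by (auto simp: P_def)
  note rk = rok_key[OF 1 assms(4), of 16] rok_key[OF 1 assms(4), of 17]
  have "R (Suc (Suc (Suc (Suc 0)))) ?f"
    using best_le[OF uv, of "rmem s" q] assms(5,6,7)
    by (intro Q) (auto simp: frame_def codes_def)
  then show ?thesis
    using assms(1-3) le rk uv unfolding pull_def
    by (auto simp: wp_simps Par_def best_def split: if_splits)
qed

lemma wp_sift_up:
  assumes "Par s" "ireg s 15 = k" "ireg s 1 = q" "q < n" "codes s" "0 < k" "k < 2 * Z" "k < 2 ^ j"
    and tourn: "\<And>i. 0 < i \<Longrightarrow> i < Z \<Longrightarrow> i \<noteq> k div 2 \<Longrightarrow> tourn q s i"
    and Q: "\<And>t s'. t \<le> 1 + j * 6 \<Longrightarrow> rreg s' = rreg s \<Longrightarrow> frame {15,16,17} s s' \<Longrightarrow>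
      (\<forall>i\<ge>Z. imem s' (P + i) = imem s (P + i)) \<Longrightarrow>
      codes s' \<Longrightarrow> (\<forall>i. 0 < i \<and> i < Z \<longrightarrow> tourn q s' i) \<Longrightarrow> R t s'"
  shows "wp m sift_up R s"
  unfolding sift_up_def
\<comment> \<open>Only the parent of the current node may disagree with its children. At the root
  this parent would be node 0, which lies outside the tree, so then all nodes are
  consistent.\<close>
proof (rule wp_while[where k = j and \<tau> = 5 and I = "\<lambda>j s'. rreg s' = rreg s \<and> frame {15,16,17} s s' \<and>
      (\<forall>i\<ge>Z. imem s' (P + i) = imem s (P + i)) \<and> codes s' \<and>
      0 < ireg s' 15 \<and> ireg s' 15 < 2 * Z \<and> ireg s' 15 < 2 ^ j \<and>
      (\<forall>i. 0 < i \<and> i < Z \<and> i \<noteq> ireg s' 15 div 2 \<longrightarrow> tourn q s' i)"], goal_cases)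
  case 1
  then show ?case using assms by (auto simp: frame_refl)
next
  case (2 j' s')
  let ?k = "ireg s' 15"
  let ?s = "s'\<lparr>ireg := (ireg s')(15 := ?k div 2)\<rparr>"
  have km: "?k < m" "2 < m" using 2 memP Z_pos by auto
  have j': "0 < j'" if "1 < ?k" using 2 that by (cases j') auto
  have k2: "?k div 2 < 2 ^ (j' - 1)" if "1 < ?k"
    using j'[OF that] 2 by (cases j') auto
  have "wp m pull (\<lambda>t s''. Suc t \<le> 5 \<and> rreg s'' = rreg s \<and> frame {15,16,17} s s'' \<and>
      (\<forall>i\<ge>Z. imem s'' (P + i) = imem s (P + i)) \<and> codes s'' \<and>
      0 < ireg s'' 15 \<and> ireg s'' 15 < 2 * Z \<and> ireg s'' 15 < 2 ^ (j' - 1) \<and>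
      (\<forall>i. 0 < i \<and> i < Z \<and> i \<noteq> ireg s'' 15 div 2 \<longrightarrow> tourn q s'' i)) ?s" if k: "1 < ?k"
  proof (rule wp_pull[where k = "?k div 2" and q = q], goal_cases)
    case 1
    have "Par s'" using 2 frame_Par[of "{15,16,17}" s s'] assms(1) by auto
    then show ?case by (simp add: Par_def)
  next
    case 3 then show ?case using 2 assms by (auto simp: frame_def)
  next
    case 5 then show ?case using 2 by (auto simp: codes_def)
  next
    case 6 then show ?case using k by auto
  next
    case 7 then show ?case using 2 by auto
  next
    case h: (8 t s'')
    have k15: "ireg s'' 15 = ?k div 2" using h by (auto simp: frame_def)
    have rm: "rmem s'' = rmem s'" using h by (auto simp: frame_def)
    have T: "imem s'' (P + i) = imem s' (P + i)" if "i \<noteq> ?k div 2" for i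
      using h that by auto
    have tk: "tourn q s'' (?k div 2)"
    proof -
      have "2 * (?k div 2) \<noteq> ?k div 2" "2 * (?k div 2) + 1 \<noteq> ?k div 2" using k by auto
      then show ?thesis unfolding tourn_def rm using h T by (simp)
    qed
    have ti: "tourn q s'' i" if "0 < i" "i < Z" "i \<noteq> ?k div 2" "i \<noteq> (?k div 2) div 2" for i
    proof -
      have "2 * i \<noteq> ?k div 2" "2 * i + 1 \<noteq> ?k div 2" using that by auto
      then show ?thesis using that 2 T unfolding tourn_def rm by (auto simp del: add_Suc_right)
    qed
    have "frame {15,16,17} s' s''" using h by (auto simp: frame_def)
    then have "frame {15,16,17} s s''" using 2 frame_trans by blast
    then show ?case using h 2 k15 k2 k tk ti by auto
  qed (use 2 assms in auto)
  then show ?case using km j'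
    by (auto simp: wp_simps)
next
  case (3 t k' s')
  then show ?case by (intro Q) auto
qed

lemma wp_build_tree:
  assumes "Par s" "ireg s 1 = q" "q < n" "codes s"
    and Q: "\<And>t s'. t \<le> 2 + Z * 6 \<Longrightarrow> rreg s' = rreg s \<Longrightarrow> frame {15,16,17} s s' \<Longrightarrow>
      (\<forall>i\<ge>Z. imem s' (P + i) = imem s (P + i)) \<Longrightarrow>
      codes s' \<Longrightarrow> (\<forall>i. 0 < i \<and> i < Z \<longrightarrow> tourn q s' i) \<Longrightarrow> R t s'"
  shows "wp m build_tree R s"
proof -
  let ?s0 = "s\<lparr>ireg := (ireg s)(15 := Z - 1)\<rparr>"
  have "wp m (While (ILess (IConst 0) (IReg 15)) (pull;; ISet 15 (ISub (IReg 15) (IConst 1))))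
     (\<lambda>t s'. R (Suc t) s') ?s0"
  proof (rule wp_while[where k = "Z - 1" and \<tau> = 5 and I = "\<lambda>k s'. rreg s' = rreg s \<and> frame {15,16,17} s s' \<and>
      (\<forall>i\<ge>Z. imem s' (P + i) = imem s (P + i)) \<and> codes s' \<and>
      ireg s' 15 = k \<and> k < Z \<and> (\<forall>i. k < i \<and> i < Z \<longrightarrow> tourn q s' i)"], goal_cases)
    case 1
    then show ?case using assms Z_pos by (auto simp: frame_def codes_def)
  next
    case (2 k s')
    have km: "k < m" "1 < m" using 2 memP Z_pos by auto
    have "wp m pull (\<lambda>t s''. wp m (ISet 15 (ISub (IReg 15) (IConst 1)))
         (\<lambda>t' s3. t + t' \<le> 5 \<and> rreg s3 = rreg s \<and> frame {15,16,17} s s3 \<and>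
      (\<forall>i\<ge>Z. imem s3 (P + i) = imem s (P + i)) \<and> codes s3 \<and>
      ireg s3 15 = k - 1 \<and> k - 1 < Z \<and> (\<forall>i. k - 1 < i \<and> i < Z \<longrightarrow> tourn q s3 i)) s'') s'" if k: "0 < k"
    proof (rule wp_pull[where k = k and q = q], goal_cases)
      case 1
      then show ?case using 2 frame_Par[of "{15,16,17}" s s'] assms(1) by auto
    next
      case 3 then show ?case using 2 assms by (auto simp: frame_def)
    next
      case h: (8 t s'')
      have k15: "ireg s'' 15 = k" using h 2 by (auto simp: frame_def)
      have rm: "rmem s'' = rmem s'" using h by (auto simp: frame_def)
      have T: "imem s'' (P + i) = imem s' (P + i)" if "i \<noteq> k" for i
        using h that by auto
      have ti: "tourn q s'' i" if "k - 1 < i" "i < Z" for i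
      proof -
        have "2 * i \<noteq> k" "2 * i + 1 \<noteq> k" using that k by auto
        then show ?thesis using that 2 T h unfolding tourn_def rm
          by (cases "i = k") (auto simp del: add_Suc_right)
      qed
      have "frame {15,16,17} s' s''" using h by (auto simp: frame_def)
      then have "frame {15,16,17} s s''" using 2 frame_trans by blast
      then show ?case using h 2 k15 k ti km by (auto simp: wp_simps frame_def codes_def tourn_def)
    qed (use 2 assms k in auto)
    then show ?case using km 2 by (auto simp: wp_Seq)
  next
    case (3 t k' s')
    have "t \<le> 1 + Z * 6" using 3(1) by (rule order_trans) simp
    then show ?case using 3 by (intro Q) auto
  qed
  moreover have "Z < m" "1 < m" using memP Z_pos by auto
  ultimately show ?thesis using assms unfolding build_tree_def
    by (simp add: wp_simps Par_def)
qed

end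

section \<open>Perfect tournament trees\<close>

context sizes
begin

definition oth :: "(nat \<Rightarrow> nat) \<Rightarrow> nat \<Rightarrow> nat \<Rightarrow> nat" where
  "oth im r x = im (H + (r * n + x))"

text \<open>
  A tree of rank \<open>r + 1\<close> with representative \<open>x\<close> has the left child \<open>(r, x)\<close>, so that only the
  representative of the right child is stored. A new tree never overwrites one that is still in use:
  its address contains a rank above that of the tree which \<open>x\<close> represented before.
\<close>

primrec pts :: "(nat \<Rightarrow> nat) \<Rightarrow> nat \<Rightarrow> nat \<Rightarrow> nat set" where
  "pts im 0 x = {x}"
| "pts im (Suc r) x = pts im r x \<union> pts im r (oth im r x)"

definition node :: "(nat \<Rightarrow> nat \<Rightarrow> real) \<Rightarrow> (nat \<Rightarrow> nat) \<Rightarrow> (nat \<Rightarrow> real) \<Rightarrow> nat \<Rightarrow> nat \<Rightarrow> bool" where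
  "node v im rm r x \<longleftrightarrow> (\<forall>i<Q. im (A + (i * H + (r * n + x))) \<in> pts im r x \<and>
     rm (A + (i * H + (r * n + x))) = v i (im (A + (i * H + (r * n + x)))) \<and>
     (\<forall>w\<in>pts im r x. v i w \<le> rm (A + (i * H + (r * n + x)))))"

primrec tree :: "(nat \<Rightarrow> nat \<Rightarrow> real) \<Rightarrow> (nat \<Rightarrow> nat) \<Rightarrow> (nat \<Rightarrow> real) \<Rightarrow> nat \<Rightarrow> nat \<Rightarrow> bool" where
  "tree v im rm 0 x \<longleftrightarrow> x < n \<and> node v im rm 0 x"
| "tree v im rm (Suc r) x \<longleftrightarrow> tree v im rm r x \<and> tree v im rm r (oth im r x) \<and>
     pts im r x \<inter> pts im r (oth im r x) = {} \<and> node v im rm (Suc r) x"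

lemma tree_node: "tree v im rm r x \<Longrightarrow> node v im rm r x"
  by (cases r) auto

lemma rep_in_pts: "x \<in> pts im r x"
  by (induction r) auto

lemma finite_pts: "finite (pts im r x)"
  by (induction r arbitrary: x) auto

lemma tree_pts: "tree v im rm r x \<Longrightarrow> pts im r x \<subseteq> {..<n}"
  by (induction r arbitrary: x) auto

lemma tree_rep: "tree v im rm r x \<Longrightarrow> x < n"
  using tree_pts rep_in_pts by blast

lemma card_pts: "tree v im rm r x \<Longrightarrow> card (pts im r x) = 2 ^ r"
  by (induction r arbitrary: x) (auto simp: card_Un_disjoint finite_pts)

text \<open>The \<open>2 ^ r\<close> points of the tree are distinct positions below
  \<open>n < 2 ^ b\<close>. Hence \<open>b\<close> root slots per cluster suffice.\<close>

lemma tree_rank: 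
  assumes "tree v im rm r x" shows "r < b"
proof -
  have "2 ^ r \<le> n"
    using card_mono[OF _ tree_pts[OF assms]] card_pts[OF assms] by simp
  then have "(2::nat) ^ r < 2 ^ b" using n_upper by (rule le_less_trans)
  then show ?thesis by simp
qed

text \<open>The footprint of a tree consists of the right children of rank below \<open>r\<close>
  and the winners of rank up to \<open>r\<close>, both at its own points only. Disjoint trees
  therefore do not interfere although they share the same tables.\<close>

lemma tree_cong:
  assumes "tree v im rm r x"
    and "\<And>r' x'. r' < r \<Longrightarrow> x' \<in> pts im r x \<Longrightarrow> im' (H + (r' * n + x')) = im (H + (r' * n + x'))"
    and "\<And>i r' x'. i < Q \<Longrightarrow> r' \<le> r \<Longrightarrow> x' \<in> pts im r x \<Longrightarrow>
      im' (A + (i * H + (r' * n + x'))) = im (A + (i * H + (r' * n + x'))) \<and>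
      rm' (A + (i * H + (r' * n + x'))) = rm (A + (i * H + (r' * n + x')))"
  shows "tree v im' rm' r x \<and> pts im' r x = pts im r x"
  using assms
proof (induction r arbitrary: x)
  case 0
  then show ?case by (auto simp: node_def)
next
  case (Suc r)
  have o: "oth im' r x = oth im r x" using Suc.prems(2)[of r x] rep_in_pts[of x im r] by (auto simp: oth_def)
  have 1: "tree v im' rm' r x \<and> pts im' r x = pts im r x"
    using Suc.prems by (intro Suc.IH) auto
  have 2: "tree v im' rm' r (oth im r x) \<and> pts im' r (oth im r x) = pts im r (oth im r x)"
    using Suc.prems by (intro Suc.IH) auto
  have 3: "pts im' (Suc r) x = pts im (Suc r) x" using 1 2 o by simp
  have "node v im' rm' (Suc r) x"
    unfolding node_def 3
  proof (intro allI impI)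
    fix i assume "i < Q"
    then show "im' (A + (i * H + (Suc r * n + x))) \<in> pts im (Suc r) x \<and>
         rm' (A + (i * H + (Suc r * n + x))) = v i (im' (A + (i * H + (Suc r * n + x)))) \<and>
         (\<forall>w\<in>pts im (Suc r) x. v i w \<le> rm' (A + (i * H + (Suc r * n + x))))"
      using tree_node[OF Suc.prems(1)] Suc.prems(3)[of i "Suc r" x] rep_in_pts[of x im "Suc r"]
      unfolding node_def by (metis order_refl)
  qed
  then show ?case using 1 2 3 o Suc.prems(1) by auto
qed

lemma rank_index: "r < b \<Longrightarrow> x < n \<Longrightarrow> r * n + x < H"
proof -
  assume "r < b" "x < n"
  then have "Suc r * n \<le> H" unfolding H_def by (intro mult_le_mono1) simp
  then show ?thesis using \<open>x < n\<close> by simp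
qed

lemma proj_index: "i < Q \<Longrightarrow> y < H \<Longrightarrow> i * H + y < Q * H"
proof -
  assume "i < Q" "y < H"
  then have "Suc i * H \<le> Q * H" by (intro mult_le_mono1) simp
  then show ?thesis using \<open>y < H\<close> by simp
qed

text \<open>Since \<open>H = b * n\<close>, the code is the mixed radix number
  \<open>(i * b + r) * n + x\<close>.\<close>

lemma code_decode:
  assumes "r < b" "x < n"
  shows "(i * H + (r * n + x)) div H = i" "(i * H + (r * n + x)) mod H = r * n + x"
    "(i * H + (r * n + x)) mod n = x" "(i * H + (r * n + x)) div n mod b = r"
proof -
  show "(i * H + (r * n + x)) div H = i" "(i * H + (r * n + x)) mod H = r * n + x"
    using rank_index[OF assms] by auto
  have e: "i * H + (r * n + x) = x + (i * b + r) * n" by (simp add: H_def algebra_simps)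
  show "(i * H + (r * n + x)) mod n = x" unfolding e using assms by (simp only: mod_mult_self1 mod_less)
  have "(x + (i * b + r) * n) div n = i * b + r" using assms n_pos by (simp only: div_mult_self1 div_less)
  then show "(i * H + (r * n + x)) div n mod b = r" unfolding e using assms by simp
qed

text \<open>The constants come from \<open>2 * Z = 640 * b * b * W\<close>: 640 is below
  \<open>2 ^ 10\<close>, and each of the three factors is at most \<open>2 ^ b\<close>.\<close>

definition depth :: nat where "depth = 10 + 3 * b"

lemma two_Z_le: "2 * Z \<le> 2 ^ depth"
proof -
  have b: "b \<le> 2 ^ b" by (simp add: less_imp_le)
  have "2 * Z = 640 * (b * b * W)" by (simp add: Z_def L_def)
  also have "\<dots> \<le> 1024 * (2 ^ b * 2 ^ b * 2 ^ b)"
    using b W_upper by (intro mult_le_mono) auto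
  also have "\<dots> = 2 ^ depth"
  proof -
    have "depth = 10 + (b + b + b)" by (simp add: depth_def)
    then show ?thesis by (simp only: power_add) simp
  qed
  finally show ?thesis .
qed

section \<open>Roots of a cluster and the elementary loops of a query\<close>

definition root :: "(nat \<Rightarrow> nat) \<Rightarrow> nat \<Rightarrow> nat \<Rightarrow> nat" where
  "root im a j = im (a * b + j)"

lemma root_index: "a < n \<Longrightarrow> j < b \<Longrightarrow> a * b + j < H"
proof -
  assume "a < n" "j < b"
  then have "Suc a * b \<le> n * b" by (intro mult_le_mono1) simp
  then show ?thesis using \<open>j < b\<close> by (simp add: H_def mult.commute)
qed

lemma H_le_P: "H \<le> P" by (simp add: P_def A_def)

definition leaf :: "(nat \<Rightarrow> nat) \<Rightarrow> nat \<Rightarrow> nat \<Rightarrow> nat \<Rightarrow> nat" where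
  "leaf im a g s = (if 0 < root im a (s mod b) \<and> s < L * b
     then (g * (L * b) + s) * n + root im a (s mod b) else 0)"

lemma leaf_le:
  assumes "g < 3 * b" "\<And>j. j < b \<Longrightarrow> root im a j \<le> n"
  shows "leaf im a g s \<le> Q * H" and "0 < leaf im a g s \<Longrightarrow> (g * (L * b) + s) * n < Q * H"
    and "0 < leaf im a g s \<Longrightarrow> g * (L * b) + s < Q * H"
proof -
  have Qb: "3 * b * (L * b) * n = Q * H" by (simp add: Q_def H_def)
  have 1: "g * (L * b) + L * b \<le> 3 * b * (L * b)"
    using assms(1) mult_le_mono1[of "Suc g" "3 * b" "L * b"] by simp
  have *: "(g * (L * b) + s) * n + n \<le> Q * H" if "s < L * b"
  proof -
    have "Suc (g * (L * b) + s) * n \<le> 3 * b * (L * b) * n" using 1 that by (intro mult_le_mono1) linarith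
    then show ?thesis using Qb by simp
  qed
  have r: "root im a (s mod b) \<le> n" using assms(2) b_pos by simp
  show "leaf im a g s \<le> Q * H" using * r by (auto simp: leaf_def)
  show 2: "0 < leaf im a g s \<Longrightarrow> (g * (L * b) + s) * n < Q * H"
    using * n_pos by (auto simp: leaf_def split: if_splits)
  have "g * (L * b) + s \<le> (g * (L * b) + s) * n" using n_pos by simp
  then show "0 < leaf im a g s \<Longrightarrow> g * (L * b) + s < Q * H" using 2 by linarith
qed

lemma wp_fill_leaves:
  assumes "Par s" "ireg s 0 = a" "a < n" "ireg s 14 = g" "g < 3 * b" "codes s"
    and roots: "\<And>j. j < b \<Longrightarrow> root (imem s) a j \<le> n"
    and Q: "\<And>t s'. t \<le> 2 + Z * 5 \<Longrightarrow> rreg s' = rreg s \<Longrightarrow> frame {18,19} s s' \<Longrightarrow>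
      (\<forall>i<Z. imem s' (P + (Z + i)) = leaf (imem s) a g i) \<Longrightarrow> codes s' \<Longrightarrow> R t s'"
  shows "wp m fill_leaves R s"
proof -
  let ?s0 = "s\<lparr>ireg := (ireg s)(18 := 0)\<rparr>"
  define I where "I = (\<lambda>k s'. rreg s' = rreg s \<and> frame {18,19} s s' \<and> ireg s' 18 = k \<and>
      (\<forall>i<k. imem s' (P + (Z + i)) = leaf (imem s) a g i) \<and> codes s')"
  have "wp m (While (ILess (IReg 18) vZ)
       (ISet 19 (ILoad (IAdd (IMul (IReg 0) vB) (IMod (IReg 18) vB)));;
        Cond (BAnd (ILess (IConst 0) (IReg 19)) (ILess (IReg 18) (IMul vL vB)))
          (IStore (IAdd vP (IAdd vZ (IReg 18)))
             (IAdd (IMul (IAdd (IMul (IReg 14) (IMul vL vB)) (IReg 18)) vN) (IReg 19)))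
          (IStore (IAdd vP (IAdd vZ (IReg 18))) (IConst 0));;
        incr 18)) (\<lambda>t s'. R (Suc t) s') ?s0"
  proof (rule wp_for[where N = Z and \<tau> = 4 and I = I], goal_cases)
    case 1
    show ?case using assms by (auto simp: I_def frame_def codes_def)
  next
    case (2 k s')
    have P': "Par s'" using 2 assms(1) frame_Par[of "{18,19}" s s'] by (auto simp: I_def)
    have regs: "ireg s' 0 = a" "ireg s' 14 = g" "ireg s' 18 = k"
      using 2 assms by (auto simp: I_def frame_def)
    let ?j = "k mod b"
    have jb: "?j < b" using b_pos by simp
    have idx: "a * b + ?j < H" using root_index[OF assms(3) jb] .
    then have rt: "imem s' (a * b + ?j) = root (imem s) a ?j"
      using 2 H_le_P by (auto simp: I_def frame_def root_def)
    note ll = leaf_le[OF assms(5) roots, of k]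
    have le: "a * b < m" "a * b + ?j < m" "a < m" "b < m" "k < m" "Z < m" "L * b < m" "L < m" "P < m"
      "P + (Z + k) < m" "Z + k < m" "g < m" "n < m" "Q * H < m" "Suc k < m" "1 < m" "n \<le> P"
    proof -
      have "3 * b \<le> L" unfolding L_def using W_pos by (simp add: mult.commute)
      moreover have "L \<le> Z" unfolding Z_def using b_pos by simp
      moreover have "L * b \<le> Z" "a * b < H" "n \<le> H" "b \<le> H" using idx Lb_le_Z n_le_H b_le_H by auto
      ultimately show "a * b < m" "a * b + ?j < m" "a < m" "b < m" "k < m" "Z < m" "L * b < m" "L < m" "P < m"
        "P + (Z + k) < m" "Z + k < m" "g < m" "n < m" "Q * H < m" "Suc k < m" "1 < m" "n \<le> P"
        using memP H_le_P idx assms(3,5) 2(1) Z_pos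
        by (simp_all add: P_def) 
    qed
    have gLb: "g * (L * b) < m" "g * (L * b) + k < m" "(g * (L * b) + k) * n < m"
       "(g * (L * b) + k) * n + root (imem s) a ?j < m"
      if "0 < root (imem s) a ?j" "k < L * b"
    proof -
      have "leaf (imem s) a g k = (g * (L * b) + k) * n + root (imem s) a ?j"
        using that by (simp add: leaf_def)
      then show "g * (L * b) < m" "g * (L * b) + k < m" "(g * (L * b) + k) * n < m"
       "(g * (L * b) + k) * n + root (imem s) a ?j < m"
        using ll le(14) that by linarith+
    qed
    let ?f = "s'\<lparr>imem := (imem s')(P + (Z + k) := leaf (imem s) a g k),
        ireg := (ireg s')(19 := root (imem s) a ?j, 18 := Suc k)\<rparr>"
    have "I (Suc k) ?f"
      using 2 ll(1) by (auto simp: I_def frame_def codes_def less_Suc_eq)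
    moreover have "root (imem s) a ?j \<le> n" using roots jb by simp
    ultimately show ?case
      using P' regs rt le gLb 2(1) unfolding Par_def
      by (cases "root (imem s) a ?j = 0"; cases "k < L * b"; simp add: wp_simps leaf_def fun_upd_twist)
  next
    case (3 s')
    have "Par s'" using 3 assms(1) frame_Par[of "{18,19}" s s'] by (auto simp: I_def)
    then show ?case using 3 memP by (auto simp: I_def Par_def)
  next
    case (4 t s')
    then show ?case by (intro Q) (auto simp: I_def)
  qed
  moreover have "0 < m" using memP by simp
  ultimately show ?thesis unfolding fill_leaves_def by (simp add: wp_simps)
qed

definition dist2 :: "(nat \<Rightarrow> real) \<Rightarrow> nat \<Rightarrow> nat \<Rightarrow> real" where
  "dist2 rm w q = (\<Sum>j<d. (rm (w * d + j) - rm (q * d + j))\<^sup>2)"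

lemma coord_index: "w < n \<Longrightarrow> j < d \<Longrightarrow> w * d + j < n * d"
proof -
  assume "w < n" "j < d"
  then have "Suc w * d \<le> n * d" by (intro mult_le_mono1) simp
  then show ?thesis using \<open>j < d\<close> by simp
qed

lemma wp_distance:
  assumes "Par s" "ireg s 1 = q" "q < n" "ireg s 23 = w" "w < n"
    and Q: "\<And>t s'. t \<le> 3 + d * 4 \<Longrightarrow> imem s' = imem s \<Longrightarrow> frame {24} s s' \<Longrightarrow>
      rreg s' 1 = rreg s 1 \<Longrightarrow> rreg s' 2 = dist2 (rmem s) w q \<Longrightarrow> R t s'"
  shows "wp m distance R s"
proof -
  let ?s0 = "s\<lparr>rreg := (rreg s)(2 := 0), ireg := (ireg s)(24 := 0)\<rparr>"
  define I where "I = (\<lambda>k s'. imem s' = imem s \<and> frame {24} s s' \<and> ireg s' 24 = k \<and> rreg s' 1 = rreg s 1 \<and>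
      rreg s' 2 = (\<Sum>j<k. (rmem s (w * d + j) - rmem s (q * d + j))\<^sup>2))"
  have "wp m (While (ILess (IReg 24) vD)
       (RSet 3 (RSub (RLoad (IAdd (IMul (IReg 23) vD) (IReg 24)))
                     (RLoad (IAdd (IMul (IReg 1) vD) (IReg 24))));;
        RSet 2 (RAdd (RReg 2) (RMul (RReg 3) (RReg 3)));;
        incr 24)) (\<lambda>t s'. R (Suc (Suc t)) s') ?s0"
  proof (rule wp_for[where N = d and \<tau> = 3 and I = I], goal_cases)
    case 1
    show ?case using assms by (auto simp: I_def frame_def)
  next
    case (2 k s')
    have P': "Par s'" using 2 assms(1) frame_Par[of "{24}" s s'] by (auto simp: I_def)
    have regs: "ireg s' 1 = q" "ireg s' 23 = w" "ireg s' 24 = k" "rmem s' = rmem s"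
      using 2 assms by (auto simp: I_def frame_def)
    have nd: "n * d + n < m" using memP n_le_H by (simp add: P_def A_def)
    have i: "w * d + k < n * d" "q * d + k < n * d" using coord_index assms 2 by auto
    have "d \<le> n * d" using n_pos by simp
    then have "d < m" "w * d < m" "q * d < m" "k < m" "Suc k < m" "w * d + k < m" "q * d + k < m"
      "w < m" "q < m" "1 < m"
      using nd i assms(3,5) 2(1) by linarith+
    then show ?case
      using P' regs nd i assms(3,5) 2 unfolding Par_def
      by (simp add: wp_simps I_def frame_def power2_eq_square)
  next
    case (3 s')
    have "Par s'" using 3 assms(1) frame_Par[of "{24}" s s'] by (auto simp: I_def)
    then show ?case using 3 bounds by (simp add: I_def Par_def)
  next
    case (4 t s')
    then show ?case by (intro Q) (auto simp: I_def dist2_def)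
  qed
  moreover have "0 < m" using memP by simp
  ultimately show ?thesis unfolding distance_def by (simp add: wp_simps)
qed

lemma best_cases: "best rm q u v = u \<or> best rm q u v = v"
  by (simp add: best_def)

text \<open>Every inner node is a copy of one of its children, so the copies of the root value form
  a path down to a leaf. If the left child does not hold the value, the right one does.\<close>

lemma wp_find_leaf:
  assumes "Par s" "ireg s 21 = u" "u \<noteq> 0" "imem s (P + 1) = u" "codes s"
    and tourn: "\<And>i. 0 < i \<Longrightarrow> i < Z \<Longrightarrow> tourn q s i"
    and Q: "\<And>t s'. t \<le> 2 + depth * 3 \<Longrightarrow> imem s' = imem s \<Longrightarrow> frame {15} s s' \<Longrightarrow>
      rreg s' = rreg s \<Longrightarrow> Z \<le> ireg s' 15 \<Longrightarrow> ireg s' 15 < 2 * Z \<Longrightarrow> imem s (P + ireg s' 15) = u \<Longrightarrow> R t s'"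
  shows "wp m find_leaf R s"
proof -
  let ?s0 = "s\<lparr>ireg := (ireg s)(15 := 1)\<rparr>"
  define I where "I = (\<lambda>k s'. imem s' = imem s \<and> frame {15} s s' \<and> rreg s' = rreg s \<and>
      k \<le> depth \<and> 2 ^ (depth - k) \<le> ireg s' 15 \<and> ireg s' 15 < 2 * Z \<and> imem s (P + ireg s' 15) = u)"
  have "wp m (While (ILess (IReg 15) vZ)
       (Cond (IEq (ILoad (IAdd vP (IMul (IConst 2) (IReg 15)))) (IReg 21))
          (ISet 15 (IMul (IConst 2) (IReg 15)))
          (ISet 15 (IAdd (IMul (IConst 2) (IReg 15)) (IConst 1))))) (\<lambda>t s'. R (Suc t) s') ?s0"
  proof (rule wp_while[where k = depth and \<tau> = 2 and I = I], goal_cases)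
    case 1
    show ?case using assms Z_pos by (auto simp: I_def frame_def)
  next
    case (2 k s')
    have P': "Par s'" using 2 assms(1) frame_Par[of "{15}" s s'] by (auto simp: I_def)
    let ?k = "ireg s' 15"
    have regs: "ireg s' 21 = u" "imem s' = imem s"
      using 2 assms by (auto simp: I_def frame_def)
    have k0: "0 < ?k" using 2 by (auto simp: I_def intro: less_le_trans[of 0 "2 ^ (depth - k)"])
    \<comment> \<open>The node index at least doubles with each step, and a node below
      \<open>Z\<close> is smaller than \<open>2 ^ depth\<close>, so some of the \<open>depth\<close>
      steps must be left.\<close>
    have kp: "0 < k \<and> 2 ^ (depth - (k - 1)) \<le> 2 * ?k" if "?k < Z"
    proof -
      have "2 ^ (depth - k) \<le> ?k" using 2 by (simp add: I_def)
      also have "\<dots> < 2 ^ depth" using that two_Z_le by linarith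
      finally have "(2::nat) ^ (depth - k) < 2 ^ depth" .
      then have "depth - k < depth" by simp
      then have "0 < k" by auto
      moreover from this have "depth - (k - 1) = Suc (depth - k)" using 2 by (auto simp: I_def)
      moreover have "2 ^ (depth - k) \<le> ?k" using 2 by (auto simp: I_def)
      ultimately show ?thesis by (auto simp del: One_nat_def)
    qed
    have ch: "imem s (P + 2 * ?k) = u \<or> imem s (P + (2 * ?k + 1)) = u" if "?k < Z"
    proof -
      have "imem s (P + ?k) = u" using 2 by (simp add: I_def)
      then show ?thesis using tourn[OF k0 that] best_cases unfolding tourn_def by metis
    qed
    have cd: "imem s (P + 2 * ?k) \<le> Q * H" if "?k < Z"
      using assms(5)[unfolded codes_def, rule_format, of "2 * ?k"] that k0 by auto
    have u: "u \<le> Q * H" using assms(5)[unfolded codes_def, rule_format, of 1] assms(4) Z_pos by auto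
    have le: "Z < m" "?k < m" "P < m" "2 < m" "Q * H < m" using memP 2 bounds by (auto simp: I_def)
    have le': "2 * ?k < m" "2 * ?k + 1 < m" "P + 2 * ?k < m" if "?k < Z" using memP that by auto
    show ?case
      using P' regs 2 kp ch cd le le' u unfolding Par_def
      by (auto simp: wp_simps I_def frame_def)
  next
    case (3 t k' s')
    have "Par s'" using 3 assms(1) frame_Par[of "{15}" s s'] by (auto simp: I_def)
    then show ?case using 3 by (intro Q) (auto simp: I_def Par_def)
  qed
  moreover have "1 < m" using memP Z_pos by simp
  ultimately show ?thesis unfolding find_leaf_def by (simp add: wp_simps)
qed

end

section \<open>Queries\<close>

context sizes
begin

definition item :: "(nat \<Rightarrow> nat \<Rightarrow> real) \<Rightarrow> (nat \<Rightarrow> nat) \<Rightarrow> (nat \<Rightarrow> real) \<Rightarrow> nat set \<Rightarrow> nat \<Rightarrow> nat \<Rightarrow> bool" where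
  "item v im rm C g u \<longleftrightarrow> (\<exists>i r x. u = Suc (i * H + (r * n + x)) \<and> g * L \<le> i \<and> i < g * L + L \<and> i < Q \<and>
     tree v im rm r x \<and> pts im r x \<subseteq> C)"

definition child1 :: "nat \<Rightarrow> nat" where
  "child1 u = (if (u - 1) div n mod b = 0 then 0 else u - n)"

definition child2 :: "(nat \<Rightarrow> nat) \<Rightarrow> nat \<Rightarrow> nat" where
  "child2 im u = (if (u - 1) div n mod b = 0 then 0
     else u - n - (u - 1) mod n + im (H + ((u - 1) mod H - n)))"

lemma child_leaf:
  assumes "x < n" shows "child1 (Suc (i * H + (0 * n + x))) = 0" "child2 im (Suc (i * H + (0 * n + x))) = 0"
  using code_decode[of 0 x i] b_pos assms by (simp_all add: child1_def child2_def)

lemma child_node: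
  assumes "x < n" "Suc r < b"
  shows "child1 (Suc (i * H + (Suc r * n + x))) = Suc (i * H + (r * n + x))"
    "child2 im (Suc (i * H + (Suc r * n + x))) = Suc (i * H + (r * n + oth im r x))"
  using code_decode[OF assms(2,1), of i] by (simp_all add: child1_def child2_def oth_def)

lemma item_children:
  assumes "item v im rm C g u"
  shows "child1 u = 0 \<or> item v im rm C g (child1 u)" "child2 im u = 0 \<or> item v im rm C g (child2 im u)"
proof -
  obtain i r x where u: "u = Suc (i * H + (r * n + x))" and
    i: "g * L \<le> i" "i < g * L + L" "i < Q" and t: "tree v im rm r x" "pts im r x \<subseteq> C"
    using assms unfolding item_def by blast
  have x: "x < n" and r: "r < b" using tree_rep tree_rank t by auto
  show "child1 u = 0 \<or> item v im rm C g (child1 u)"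
  proof (cases r)
    case 0 then show ?thesis using child_leaf x u by simp
  next
    case (Suc r')
    then show ?thesis using child_node(1)[of x r' i] x r u i t unfolding item_def by auto
  qed
  show "child2 im u = 0 \<or> item v im rm C g (child2 im u)"
  proof (cases r)
    case 0 then show ?thesis using child_leaf x u by simp
  next
    case (Suc r')
    then show ?thesis using child_node(2)[where x = x and r = r' and i = i and im = im] x r u i t unfolding item_def
      by (intro disjI2 exI[of _ i] exI[of _ r'] exI[of _ "oth im r' x"]) auto
  qed
qed

lemma item_code: "item v im rm C g u \<Longrightarrow> u \<le> Q * H"
  unfolding item_def using proj_index rank_index tree_rank tree_rep by (metis Suc_leI)

lemma item_winner:
  assumes "item v im rm C g u" "C \<subseteq> {..<n}"
  shows "im (A + (u - 1)) \<in> C" "im (A + (u - 1)) < n"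
proof -
  obtain i r x where u: "u = Suc (i * H + (r * n + x))" "i < Q" "tree v im rm r x" "pts im r x \<subseteq> C"
    using assms unfolding item_def by blast
  then show "im (A + (u - 1)) \<in> C" using tree_node[OF u(3)] by (auto simp: node_def)
  then show "im (A + (u - 1)) < n" using assms by auto
qed

text \<open>All right children and winners lie below \<open>P\<close>, so the queue can be rewritten
  freely.\<close>

lemma tree_frame:
  assumes "\<And>a. a < P \<Longrightarrow> im' a = im a" "tree v im rm r x"
  shows "tree v im' rm r x" "pts im' r x = pts im r x"
proof -
  have r: "r < b" using assms(2) tree_rank by blast
  have x': "x' < n" if "x' \<in> pts im r x" for x' using that tree_pts[OF assms(2)] by auto
  have "tree v im' rm r x \<and> pts im' r x = pts im r x"
  proof (rule tree_cong[OF assms(2)], goal_cases)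
    case (1 r' x')
    then have "r' * n + x' < H" using r x' by (intro rank_index) auto
    then show ?case by (intro assms) (simp add: P_def A_def)
  next
    case (2 i r' x')
    then have "i * H + (r' * n + x') < Q * H" using r x' by (intro proj_index rank_index) auto
    then show ?case using assms(1) by (auto simp add: P_def)
  qed
  then show "tree v im' rm r x" "pts im' r x = pts im r x" by auto
qed

lemma item_frame:
  assumes "\<And>a. a < P \<Longrightarrow> im' a = im a" "item v im rm C g u"
  shows "item v im' rm C g u"
proof -
  obtain i r x where u: "u = Suc (i * H + (r * n + x))" "g * L \<le> i" "i < g * L + L" "i < Q"
    and t: "tree v im rm r x" "pts im r x \<subseteq> C"
    using assms(2) unfolding item_def by blast
  have "tree v im' rm r x" "pts im' r x \<subseteq> C"
    using tree_frame[OF assms(1) t(1)] t(2) by auto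
  then show ?thesis using u unfolding item_def by blast
qed

lemma child2_frame:
  assumes "\<And>a. a < P \<Longrightarrow> im' a = im a"
  shows "child2 im' u = child2 im u"
proof -
  have "H + ((u - 1) mod H - n) < 2 * H" using H_pos by (simp add: less_imp_diff_less)
  then have "H + ((u - 1) mod H - n) < P" by (simp add: P_def A_def)
  then show ?thesis using assms by (simp add: child2_def)
qed

lemma wp_expand:
  assumes "Par s" "ireg s 21 = u" "ireg s 22 = u - 1" "item v (imem s) (rmem s) C g u"
    and Q: "\<And>t s'. t \<le> 3 \<Longrightarrow> imem s' = imem s \<Longrightarrow> frame {26,27} s s' \<Longrightarrow> rreg s' = rreg s \<Longrightarrow>
      ireg s' 26 = child1 u \<Longrightarrow> ireg s' 27 = child2 (imem s) u \<Longrightarrow> R t s'"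
  shows "wp m expand R s"
proof -
  have u: "u \<le> Q * H" using item_code assms(4) by blast
  have c2: "child2 (imem s) u \<le> Q * H" using item_children(2)[OF assms(4)] item_code by auto
  have h: "H + ((u - 1) mod H - n) < m"
  proof -
    have "H + ((u - 1) mod H - n) < 2 * H" using H_pos by (simp add: less_imp_diff_less)
    then show ?thesis using bounds(7) by (simp add: A_def)
  qed
  have ml: "(u - 1) mod H < m" "(u - 1) mod n < m" "u < m" "u - 1 < m" "u - n < m"
    using u bounds by (auto intro: le_less_trans[OF mod_less_eq_dividend])
  have o: "imem s (H + ((u - 1) mod H - n)) < m"  if "(u - 1) div n mod b \<noteq> 0"
    using c2 that bounds by (auto simp: child2_def)
  let ?f0 = "s\<lparr>ireg := (ireg s)(26 := child1 u, 27 := child2 (imem s) u)\<rparr>"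
  have "R 3 ?f0" by (intro Q) (auto simp: frame_def)
  moreover have "child2 (imem s) u < m" using c2 bounds by simp
  ultimately show ?thesis
    using assms(1-3) bounds ml h o unfolding expand_def
    by (cases "(u - 1) div n mod b = 0")
      (simp_all add: wp_simps Par_def child1_def child2_def numeral_3_eq_3)
qed

lemma wp_IStore_Seq:
  assumes "iok m s a" "iok m s e" "wp m c (\<lambda>t. R (Suc t)) (s\<lparr>imem := (imem s)(ival s a := ival s e)\<rparr>)"
  shows "wp m (IStore a e;; c) R s"
  using assms by (simp add: wp_Seq wp_IStore)

text \<open>From a nonempty node to its parent the key does not decrease and the node stays
  nonempty. So the root dominates all leaves, and an empty root means an empty queue.\<close>

lemma tourn_top:
  assumes "\<And>i. 0 < i \<Longrightarrow> i < Z \<Longrightarrow> tourn q s i" "0 < k" "k < 2 * Z" "imem s (P + k) \<noteq> 0"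
  shows "imem s (P + 1) \<noteq> 0 \<and> key (rmem s) q (imem s (P + k)) \<le> key (rmem s) q (imem s (P + 1))"
  using assms(2-)
proof (induction k rule: less_induct)
  case (less k)
  show ?case
  proof (cases "k = 1")
    case False
    let ?j = "k div 2"
    have j: "0 < ?j" "?j < Z" "?j < k" using less.prems False by auto
    have t: "imem s (P + ?j) = best (rmem s) q (imem s (P + 2 * ?j)) (imem s (P + (2 * ?j + 1)))"
      using assms(1)[OF j(1,2)] by (simp add: tourn_def)
    have "k = 2 * ?j \<or> k = 2 * ?j + 1" by auto
    then have "imem s (P + k) = imem s (P + 2 * ?j) \<or> imem s (P + k) = imem s (P + (2 * ?j + 1))"
      by metis
    then have "imem s (P + ?j) \<noteq> 0 \<and> key (rmem s) q (imem s (P + k)) \<le> key (rmem s) q (imem s (P + ?j))"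
      using less.prems(3) unfolding t best_def by (auto split: if_splits)
    then show ?thesis using less.IH[of ?j] j by auto
  qed (use less.prems in auto)
qed

definition popinv :: "(nat \<Rightarrow> nat \<Rightarrow> real) \<Rightarrow> nat set \<Rightarrow> nat \<Rightarrow> nat \<Rightarrow> state \<Rightarrow> bool" where
  "popinv v C g q s \<longleftrightarrow> Par s \<and> ireg s 1 = q \<and> codes s \<and> (\<forall>i. 0 < i \<and> i < Z \<longrightarrow> tourn q s i) \<and>
     (\<forall>k<Z. imem s (P + (Z + k)) = 0 \<or> item v (imem s) (rmem s) C g (imem s (P + (Z + k)))) \<and>
     (\<forall>k. ireg s 18 \<le> k \<and> k < Z \<longrightarrow> imem s (P + (Z + k)) = 0)"

definition scratch :: "nat set" where "scratch = {15,16,17,18,21,22,23,24,25,26,27}"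

lemma wp_pop:
  assumes inv: "popinv v C g q s" and q: "q < n" and C: "C \<subseteq> {..<n}" and sl: "ireg s 18 = sl" "sl < Z"
    and Q0: "\<And>t s'. t \<le> 25 + 4 * d + 15 * depth \<Longrightarrow> imem s (P + 1) = 0 \<Longrightarrow> frame scratch s s' \<Longrightarrow>
      imem s' = imem s \<Longrightarrow> rreg s' = rreg s \<Longrightarrow> ireg s' 25 = ireg s 25 \<Longrightarrow> ireg s' 18 = sl \<Longrightarrow> popinv v C g q s' \<Longrightarrow> R t s'"
    and Q1: "\<And>t s' k u w. t \<le> 25 + 4 * d + 15 * depth \<Longrightarrow> frame scratch s s' \<Longrightarrow> popinv v C g q s' \<Longrightarrow>
      u = imem s (P + 1) \<Longrightarrow> u \<noteq> 0 \<Longrightarrow> k < sl \<Longrightarrow> imem s (P + (Z + k)) = u \<Longrightarrow> 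
      (\<forall>i<Z. imem s' (P + (Z + i)) =
         (if i = k then child1 u else if i = sl then child2 (imem s) u else imem s (P + (Z + i)))) \<Longrightarrow>
      ireg s' 18 = Suc sl \<Longrightarrow> w = imem s (A + (u - 1)) \<Longrightarrow>
      rreg s' 1 = max (rreg s 1) (dist2 (rmem s) w q) \<Longrightarrow>
      ireg s' 25 = (if rreg s 1 < dist2 (rmem s) w q then w else ireg s 25) \<Longrightarrow> R t s'"
  shows "wp m pop R s"
proof -
  have Par: "Par s" and r1: "ireg s 1 = q" and cd: "codes s" and
    to: "\<And>i. 0 < i \<Longrightarrow> i < Z \<Longrightarrow> tourn q s i" and
    it: "\<And>k. k < Z \<Longrightarrow> imem s (P + (Z + k)) = 0 \<or> item v (imem s) (rmem s) C g (imem s (P + (Z + k)))" and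
    z: "\<And>k. sl \<le> k \<Longrightarrow> k < Z \<Longrightarrow> imem s (P + (Z + k)) = 0"
    using inv sl unfolding popinv_def by auto
  define u where "u = imem s (P + 1)"
  have uc: "u \<le> Q * H" using cd Z_pos unfolding u_def codes_def by (auto simp del: One_nat_def)
  have P1: "P + 1 < m" using memP Z_pos by simp
  show ?thesis
  proof (cases "u = 0")
    case True
    let ?f = "s\<lparr>ireg := (ireg s)(21 := 0)\<rparr>"
    have "R 3 ?f" using inv True by (intro Q0)
      (auto simp: u_def frame_def scratch_def sl popinv_def Par_def codes_def tourn_def)
    then show ?thesis using True Par P1 bounds unfolding pop_def u_def
      by (simp add: wp_simps Par_def numeral_3_eq_3)
  next
    case False
    let ?T = "25 + 4 * d + 15 * depth"
    define w where "w = imem s (A + (u - 1))"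
    define D where "D = dist2 (rmem s) w q"
    let ?s1 = "s\<lparr>ireg := (ireg s)(21 := u, 22 := u - 1, 23 := w)\<rparr>"
    \<comment> \<open>That some leaf holds \<open>u\<close> is read off from a run of
      \<open>find_leaf\<close> on a hypothetical state. It is needed before the program reaches its
      own search, because it shows that \<open>u\<close> is a valid candidate and that its winner is
      a point whose distance may be computed.\<close>
    obtain k0 where k0: "Z \<le> k0" "k0 < 2 * Z" "imem s (P + k0) = u"
    proof -
      have "wp m find_leaf (\<lambda>t s'. Z \<le> ireg s' 15 \<and> ireg s' 15 < 2 * Z \<and> imem s (P + ireg s' 15) = u) ?s1"
        by (rule wp_find_leaf[where u = u and q = q])
          (use Par False to cd in \<open>auto simp: Par_def u_def codes_def tourn_def\<close>)
      then show thesis using that unfolding wp_def by auto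
    qed
    have item: "item v (imem s) (rmem s) C g u"
      using it[of "k0 - Z"] k0 False by auto
    have w: "w < n" using item_winner[OF item C] by (simp add: w_def)
    have u1: "A + (u - 1) < m" "u < m"
      using key_index(4)[OF uc q] bounds uc by (auto simp: P_def)
    note ch = item_children[OF item]
    have c1: "child1 u \<le> Q * H" and c2: "child2 (imem s) u \<le> Q * H" using ch item_code by auto
    define rest where "rest = (distance;;
        Cond (RLess (RReg 1) (RReg 2)) (RSet 1 (RReg 2);; ISet 25 (IReg 23)) Skip;;
        find_leaf;;
        expand;;
        IStore (IAdd vP (IReg 15)) (IReg 26);; sift_up;;
        ISet 15 (IAdd vZ (IReg 18));;
        IStore (IAdd vP (IReg 15)) (IReg 27);; sift_up;;
        incr 18)"
    have *: "wp m rest (\<lambda>t s'. R (Suc (Suc (Suc (Suc t)))) s') ?s1"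
      unfolding rest_def
    proof (rule wp_SeqI[where P = "\<lambda>t s'. t \<le> 3 + d * 4 \<and> imem s' = imem s \<and> frame {24} ?s1 s' \<and>
          rreg s' 1 = rreg s 1 \<and> rreg s' 2 = D"], goal_cases)
      case 1
      show ?case using Par r1 w q
        by (intro wp_distance[where q = q and w = w]) (auto simp: Par_def D_def)
    next
      case (2 t2 s2)
      note h2 = 2
      show ?case
      proof (rule wp_SeqI[where P = "\<lambda>t s'. t \<le> 3 \<and> imem s' = imem s \<and> frame {24,25} ?s1 s' \<and>
          rreg s' 1 = max (rreg s 1) D \<and> ireg s' 25 = (if rreg s 1 < D then w else ireg s 25)"], goal_cases)
        case 1
        show ?case using 2 w bounds by (auto simp: wp_simps frame_def)
      next
        case (2 t3 s3)
        note h3 = 2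
        have P3: "Par s3" using frame_Par[of "{24,25}" ?s1 s3] 2 Par by (simp add: Par_def)
        have fr3: "frame scratch s s3" using 2 by (auto simp: frame_def scratch_def)
        show ?case
        proof (rule wp_SeqI[where P = "\<lambda>t s'. t \<le> 2 + depth * 3 \<and> imem s' = imem s3 \<and> frame {15} s3 s' \<and>
            rreg s' = rreg s3 \<and> Z \<le> ireg s' 15 \<and> ireg s' 15 < 2 * Z \<and> imem s (P + ireg s' 15) = u"], goal_cases)
          case 1
          show ?case using 2 P3 False to cd
            by (intro wp_find_leaf[where q = q and u = u])
              (auto simp: frame_def u_def codes_def tourn_def)
        next
          case (2 t4 s4)
          note h4 = 2
          define k where "k = ireg s4 15"
          have k: "Z \<le> k" "k < 2 * Z" "imem s (P + k) = u" using 2 by (auto simp: k_def)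
          \<comment> \<open>The leaves from \<open>sl\<close> on are empty, so the leaf of the
            popped node differs from the fresh one.\<close>
          have ksl: "k - Z < sl" 
          proof (rule ccontr)
            assume "\<not> k - Z < sl"
            moreover have "k - Z < Z" using k by linarith
            ultimately show False using z[of "k - Z"] k False by auto
          qed
          have im4: "imem s4 = imem s" and rm4: "rmem s4 = rmem s"
            using 2 h3 by (auto simp: frame_def)
          have P4: "Par s4" using frame_Par[of "{15}" s3 s4] 2 P3 by simp
          have r4: "ireg s4 21 = u" "ireg s4 22 = u - 1" "ireg s4 18 = sl" "ireg s4 1 = q"
            using 2 h3 sl r1 by (auto simp: frame_def)
          have fr4: "frame scratch s s4" using fr3 2 by (auto simp: frame_def scratch_def)
          show ?case
          proof (rule wp_SeqI[where P = "\<lambda>t s'. t \<le> 3 \<and> imem s' = imem s4 \<and> frame {26,27} s4 s' \<and>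
              rreg s' = rreg s4 \<and> ireg s' 26 = child1 u \<and> ireg s' 27 = child2 (imem s) u"], goal_cases)
            case 1
            show ?case using item im4 rm4 P4 r4 by (intro wp_expand[where u = u]) auto
          next
            case (2 t5 s5)
            note h5 = 2
            let ?s5 = "s5\<lparr>imem := (imem s)(P + k := child1 u)\<rparr>"
            have P5: "Par s5" using frame_Par[of "{26,27}" s4 s5] 2 P4 by simp
            have r5: "ireg s5 15 = k" "ireg s5 18 = sl" "ireg s5 1 = q" "rmem s5 = rmem s" "imem s5 = imem s"
              using 2 r4 im4 rm4 by (auto simp: frame_def k_def)
            have fr5: "frame scratch s s5" using fr4 2 by (auto simp: frame_def scratch_def)
            have **: "wp m (sift_up;;
                ISet 15 (IAdd vZ (IReg 18));;
                IStore (IAdd vP (IReg 15)) (IReg 27);; sift_up;; incr 18)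
              (\<lambda>t s'. R (Suc (Suc (Suc (Suc (t2 + (t3 + (t4 + (t5 + (Suc t)))))))) ) s') ?s5"
            proof (rule wp_SeqI[where P = "\<lambda>t s'. t \<le> 1 + depth * 6 \<and> rreg s' = rreg ?s5 \<and> frame {15,16,17} ?s5 s' \<and>
                (\<forall>i\<ge>Z. imem s' (P + i) = imem ?s5 (P + i)) \<and>
                codes s' \<and> (\<forall>i. 0 < i \<and> i < Z \<longrightarrow> tourn q s' i)"], goal_cases)
              case 1
              show ?case
              proof (rule wp_sift_up[where k = k and j = depth and q = q], goal_cases)
                case 1 then show ?case using P5 by (simp add: Par_def)
              next
                case 5
                then show ?case using cd c1 by (auto simp: codes_def)
              next
                case 8 then show ?case using two_Z_le k by linarith
              next
                case (9 i)
                then have "2 * i \<noteq> k" "2 * i + 1 \<noteq> k" "i \<noteq> k" using k by auto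
                then show ?case using to[of i] 9 r5 unfolding tourn_def by simp
              qed (use r5 q k Z_pos in auto)
            next
              case (2 t6 s6)
              note h6 = 2
              have P6: "Par s6" using frame_Par[of "{15,16,17}" ?s5 s6] 2 P5 by (simp add: Par_def)
              have r6: "ireg s6 18 = sl" "ireg s6 1 = q" "rmem s6 = rmem s" "ireg s6 27 = child2 (imem s) u"
                using 2 r5 h5 by (auto simp: frame_def)
              let ?s7 = "s6\<lparr>ireg := (ireg s6)(15 := Z + sl), imem := (imem s6)(P + (Z + sl) := child2 (imem s) u)\<rparr>"
              have ***: "wp m (sift_up;; incr 18) (\<lambda>t s'. 
                 R (Suc (Suc (Suc (Suc (t2 + (t3 + (t4 + (t5 + (Suc (t6 + (Suc (Suc t)))))))))))) s') ?s7"
              proof (rule wp_SeqI[where P = "\<lambda>t s'. t \<le> 1 + depth * 6 \<and> rreg s' = rreg ?s7 \<and> frame {15,16,17} ?s7 s' \<and>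
                  (\<forall>i\<ge>Z. imem s' (P + i) = imem ?s7 (P + i)) \<and>
                  codes s' \<and> (\<forall>i. 0 < i \<and> i < Z \<longrightarrow> tourn q s' i)"], goal_cases)
                case 1
                show ?case
                proof (rule wp_sift_up[where k = "Z + sl" and j = depth and q = q], goal_cases)
                  case 1 then show ?case using P6 by (simp add: Par_def)
                next
                  case 5
                  then show ?case using 2 c2 by (auto simp: codes_def)
                next
                  case 8 then show ?case using two_Z_le sl(2) by linarith
                next
                  case (9 i)
                  then have "2 * i \<noteq> Z + sl" "2 * i + 1 \<noteq> Z + sl" "i \<noteq> Z + sl" using k by auto
                  then show ?case using 2 9 unfolding tourn_def by simp
                qed (use r6 q sl in auto)
              next
                case (2 t8 s8)
                note h8 = 2
                have t8: "t8 \<le> 1 + depth * 6" using 2 by auto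
                have P8: "Par s8" using frame_Par[of "{15,16,17}" ?s7 s8] 2 P6 by (simp add: Par_def)
                have r8: "ireg s8 18 = sl" "ireg s8 1 = q" "rmem s8 = rmem s"
                  using 2 r6 by (auto simp: frame_def)
                have slm: "Suc sl < m" using sl bounds by auto
                let ?f = "s8\<lparr>ireg := (ireg s8)(18 := Suc sl)\<rparr>"
                have imT: "imem s8 (P + (Z + i)) = (if i = k - Z then child1 u else if i = sl then child2 (imem s) u
                     else imem s (P + (Z + i)))" if "i < Z" for i
                proof -
                  have "imem s8 (P + (Z + i)) = imem ?s7 (P + (Z + i))" using 2 by simp
                  also have "\<dots> = (if i = sl then child2 (imem s) u else imem s6 (P + (Z + i)))" by auto
                  also have "imem s6 (P + (Z + i)) = imem ?s5 (P + (Z + i))"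
                    using h6 by simp
                  also have "\<dots> = (if i = k - Z then child1 u else imem s (P + (Z + i)))" using k by auto
                  finally show ?thesis using ksl by auto
                qed
                have f67: "frame scratch s s6"
                proof -
                  have "frame scratch s ?s5" using fr5 k by (auto simp: frame_def)
                  moreover have "frame {15,16,17} ?s5 s6" using h6 by simp
                  ultimately show ?thesis by (rule frame_trans) (auto simp: scratch_def)
                qed
                have fr8: "frame scratch s ?f"
                proof -
                  have "frame scratch s ?s7" using f67 by (auto simp: frame_def scratch_def)
                  moreover have "frame {15,16,17} ?s7 s8" using 2 by simp
                  ultimately have "frame scratch s s8" by (rule frame_trans) (auto simp: scratch_def)
                  then show ?thesis by (auto simp: frame_def scratch_def)
                qed
                have imP: "imem s8 a = imem s a" if "a < P" for a using fr8 that by (simp add: frame_def)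
                have it8: "imem s8 (P + (Z + i)) = 0 \<or> item v (imem s8) (rmem s) C g (imem s8 (P + (Z + i)))"
                  if "i < Z" for i
                proof -
                  have "imem s8 (P + (Z + i)) = 0 \<or> item v (imem s) (rmem s) C g (imem s8 (P + (Z + i)))"
                    unfolding imT[OF that] using ch it[OF that] by auto
                  then show ?thesis using item_frame[of "imem s8" "imem s"] imP by blast
                qed
                have zz: "imem s8 (P + (Z + i)) = 0" if "Suc sl \<le> i" "i < Z" for i
                  unfolding imT[OF that(2)] using that ksl z[of i] by auto
                have pi: "popinv v C g q ?f"
                  unfolding popinv_def using P8 r8 2 it8 zz
                  by (auto simp: Par_def codes_def tourn_def)
                have rr: "rreg s8 1 = max (rreg s 1) D" 
                  using 2 h6 h5 h4 h3 by auto
                have r25: "ireg s8 25 = (if rreg s 1 < D then w else ireg s 25)" 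
                  using 2 h6 h5 h4 h3
                  by (simp add: frame_def)
                have Rf: "R t ?f" if "t \<le> ?T" for t
                  by (rule Q1[where k = "k - Z" and u = u and w = w])
                    (use that fr8 pi False ksl k imT rr r25 in \<open>auto simp: u_def w_def D_def\<close>)
                have "t2 + (t3 + (t4 + (t5 + (t6 + t8)))) + 8 \<le> ?T"
                  using t8 h2 h3 h4 h5 h6 by linarith
                then have "Suc (Suc (Suc (Suc (Suc (Suc (Suc (Suc (t2 + (t3 + (t4 + (t5 + (t6 + t8)))))))))))) \<le> ?T"
                  by simp
                from Rf[OF this] show ?case using slm r8 bounds by (simp add: wp_simps)
              qed
              have le: "Z < m" "sl < m" "Z + sl < m" "P + (Z + sl) < m" "P < m" "child2 (imem s) u < m"
                using memP sl bounds c2 by auto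
              show ?case using *** le P6 r6 by (simp add: wp_simps Par_def)
            qed
            have le: "k < m" "P + k < m" "P < m" "child1 u < m" using memP k bounds c1 by auto
            have "imem s5 = imem s" "ireg s5 10 = P" "ireg s5 26 = child1 u" using r5 P5 2 by (auto simp: Par_def)
            with ** le r5(1) show ?case
              by (intro wp_IStore_Seq) (simp_all only: iok.simps ival.simps add_Suc_right)
          qed
        qed
      qed
    qed
    show ?thesis unfolding pop_def rest_def[symmetric]
      using * False Par P1 w unfolding u_def w_def
      by (simp add: wp_simps Par_def) (use bounds u1 in \<open>auto simp: u_def\<close>)
  qed
qed

section \<open>The potential argument for the number of pops\<close>

definition heavy :: "(nat \<Rightarrow> nat \<Rightarrow> real) \<Rightarrow> nat set \<Rightarrow> nat \<Rightarrow> real \<Rightarrow> nat \<Rightarrow> nat set" where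
  "heavy v B q \<Delta> i = {w \<in> B. \<Delta> \<le> v i w - v i q}"

text \<open>
  The potential of a candidate. A pop whose winner is a near point above the threshold decreases the
  total potential, because the two children split the points of the tree and have smaller rank.
\<close>

definition phi :: "(nat \<Rightarrow> nat \<Rightarrow> real) \<Rightarrow> (nat \<Rightarrow> nat) \<Rightarrow> nat set \<Rightarrow> nat \<Rightarrow> real \<Rightarrow> nat \<Rightarrow> nat" where
  "phi v im B q \<Delta> u = (if u = 0 then 0 else Suc ((u - 1) div n mod b) *
     card (pts im ((u - 1) div n mod b) ((u - 1) mod n) \<inter> heavy v B q \<Delta> ((u - 1) div H)))"

lemma phi_code:
  "r < b \<Longrightarrow> x < n \<Longrightarrow> phi v im B q \<Delta> (Suc (i * H + (r * n + x))) = Suc r * card (pts im r x \<inter> heavy v B q \<Delta> i)"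
  using code_decode[of r x i] by (simp add: phi_def)

text \<open>The rank 0 slots of all points matter, also of those outside the cluster, since the key
  reads the projection of \<open>q\<close> there. Links write winners only to ranks above 0 and so
  preserve this.\<close>

definition base :: "(nat \<Rightarrow> nat \<Rightarrow> real) \<Rightarrow> (nat \<Rightarrow> real) \<Rightarrow> bool" where
  "base v rm \<longleftrightarrow> (\<forall>i<Q. \<forall>x<n. rm (A + (i * H + x)) = v i x)"

lemma item_key:
  assumes "base v rm" "q < n" "u = Suc (i * H + (r * n + x))" "i < Q" "tree v im rm r x"
  shows "key rm q u = v i (im (A + (u - 1))) - v i q" "im (A + (u - 1)) \<in> pts im r x"
    "\<And>w. w \<in> pts im r x \<Longrightarrow> v i w - v i q \<le> key rm q u"
proof -
  have xr: "x < n" "r < b" using assms tree_rep tree_rank by auto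
  have "(u - 1) div H = i" using code_decode[OF xr(2,1), of i] assms(3) by simp
  then have k: "key rm q u = rm (A + (u - 1)) - v i q"
    using assms by (simp add: key_def base_def)
  have nd: "node v im rm r x" using tree_node assms(5) by blast
  show "key rm q u = v i (im (A + (u - 1))) - v i q" "im (A + (u - 1)) \<in> pts im r x"
    using nd assms(3,4) unfolding k by (auto simp: node_def)
  show "\<And>w. w \<in> pts im r x \<Longrightarrow> v i w - v i q \<le> key rm q u"
    using nd assms(3,4) unfolding k by (auto simp: node_def)
qed

text \<open>The winner is itself a near point above the threshold, so the tree contains at least one
  such point. The two children split these points and carry a rank factor smaller by one, so the
  potential drops by their number. A tree of rank 0 has no children and loses its whole
  potential.\<close>

lemma phi_pop:
  assumes "base v rm" "q < n" "item v im rm C g u" "\<Delta> \<le> key rm q u" "im (A + (u - 1)) \<in> B"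
  shows "phi v im B q \<Delta> (child1 u) + phi v im B q \<Delta> (child2 im u) + 1 \<le> phi v im B q \<Delta> u"
proof -
  obtain i r x where u: "u = Suc (i * H + (r * n + x))" and
    i: "i < Q" and t: "tree v im rm r x"
    using assms(3) unfolding item_def by blast
  have x: "x < n" and r: "r < b" using tree_rep tree_rank t by auto
  note kk = item_key[OF assms(1,2) u i t]
  have "im (A + (u - 1)) \<in> pts im r x \<inter> heavy v B q \<Delta> i"
    using kk(1,2) assms(4,5) by (auto simp: heavy_def)
  then have pos: "1 \<le> card (pts im r x \<inter> heavy v B q \<Delta> i)"
    using finite_pts by (metis One_nat_def Suc_leI card_gt_0_iff empty_iff finite_Int)
  show ?thesis
  proof (cases r)
    case 0
    then show ?thesis using child_leaf[OF x, where i = i] u pos phi_code[OF r x, of v im B q \<Delta> i]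
      by (simp add: phi_def)
  next
    case (Suc r')
    let ?y = "oth im r' x"
    let ?c1 = "card (pts im r' x \<inter> heavy v B q \<Delta> i)" and ?c2 = "card (pts im r' ?y \<inter> heavy v B q \<Delta> i)"
    have y: "?y < n" using t Suc tree_rep by auto
    have dis: "pts im r' x \<inter> pts im r' ?y = {}" using t Suc by auto
    have c: "card (pts im r x \<inter> heavy v B q \<Delta> i) = ?c1 + ?c2"
      unfolding Suc pts.simps Int_Un_distrib2 using dis finite_pts
      by (intro card_Un_disjoint) auto
    have r': "r' < b" "Suc r' < b" using r Suc by auto
    have "phi v im B q \<Delta> u = Suc (Suc r') * (?c1 + ?c2)" using u phi_code[OF r x] c Suc by simp
    moreover have "phi v im B q \<Delta> (child1 u) = Suc r' * ?c1"
      unfolding u Suc child_node[OF x r'(2)] using phi_code[OF r'(1) x] .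
    moreover have "phi v im B q \<Delta> (child2 im u) = Suc r' * ?c2"
      unfolding u Suc child_node[OF x r'(2)] using phi_code[OF r'(1) y] .
    ultimately show ?thesis using pos c by (simp add: algebra_simps)
  qed
qed

text \<open>This is the bookkeeping of a pop: one leaf is overwritten, and one leaf of potential
  zero is filled.\<close>

lemma sum_two_updates:
  fixes f :: "nat \<Rightarrow> nat"
  assumes "k < (N::nat)" "l < N" "k \<noteq> l" "f (t l) = 0"
    and "\<And>i. i < N \<Longrightarrow> t' i = (if i = k then c1 else if i = l then c2 else t i)"
  shows "(\<Sum>i<N. f (t' i)) + f (t k) = (\<Sum>i<N. f (t i)) + f c1 + f c2"
proof -
  have *: "(\<Sum>i<N. g i) = g k + (g l + (\<Sum>i\<in>{..<N} - {k} - {l}. g i))" for g :: "nat \<Rightarrow> nat"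
    using assms(1-3) sum.remove[of "{..<N}" k g] sum.remove[of "{..<N} - {k}" l g] by simp
  have "(\<Sum>i\<in>{..<N} - {k} - {l}. f (t' i)) = (\<Sum>i\<in>{..<N} - {k} - {l}. f (t i))"
    by (intro sum.cong) (auto simp: assms(5))
  then show ?thesis unfolding *[of "\<lambda>i. f (t' i)"] *[of "\<lambda>i. f (t i)"] using assms by simp
qed

definition forest :: "(nat \<Rightarrow> nat \<Rightarrow> real) \<Rightarrow> (nat \<Rightarrow> nat) \<Rightarrow> (nat \<Rightarrow> real) \<Rightarrow> nat \<Rightarrow> nat set \<Rightarrow> bool" where
  "forest v im rm a C \<longleftrightarrow>
     (\<forall>j<b. root im a j \<noteq> 0 \<longrightarrow> tree v im rm j (root im a j - 1)) \<and>
     (\<forall>j<b. \<forall>j'<b. j \<noteq> j' \<longrightarrow> root im a j \<noteq> 0 \<longrightarrow> root im a j' \<noteq> 0 \<longrightarrow>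
        pts im j (root im a j - 1) \<inter> pts im j' (root im a j' - 1) = {}) \<and>
     C = (\<Union>j\<in>{j. j < b \<and> root im a j \<noteq> 0}. pts im j (root im a j - 1))"

lemma forest_sub: "forest v im rm a C \<Longrightarrow> C \<subseteq> {..<n}"
  unfolding forest_def using tree_pts by blast

lemma forest_root: "forest v im rm a C \<Longrightarrow> j < b \<Longrightarrow> root im a j \<le> n"
  unfolding forest_def using tree_rep[of v im rm j "root im a j - 1"] by (cases "root im a j = 0") auto

lemma leaf_code:
  assumes "s < L * b" "root im a (s mod b) \<noteq> 0"
  shows "leaf im a g s = Suc ((g * L + s div b) * H + (s mod b * n + (root im a (s mod b) - 1)))"
proof -
  have "g * (L * b) + s = (g * L + s div b) * b + s mod b"
    by (simp add: algebra_simps)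
  then have "(g * (L * b) + s) * n = (g * L + s div b) * H + s mod b * n"
    by (simp only: H_def add_mult_distrib mult.assoc)
  then show ?thesis using assms by (simp add: leaf_def)
qed

lemma group_index: "g < 3 * b \<Longrightarrow> g * L + L \<le> Q"
  unfolding Q_def using mult_le_mono1[of "Suc g" "3 * b" L] by simp

lemma leaf_item:
  assumes "forest v im rm a C" "g < 3 * b"
  shows "leaf im a g s = 0 \<or> item v im rm C g (leaf im a g s)"
proof (cases "s < L * b \<and> root im a (s mod b) \<noteq> 0")
  case True
  have j: "s mod b < b" using b_pos by simp
  have "s div b < L" using True by (simp add: less_mult_imp_div_less)
  moreover have "pts im (s mod b) (root im a (s mod b) - 1) \<subseteq> C"
    using assms(1) True j unfolding forest_def by auto
  moreover have "tree v im rm (s mod b) (root im a (s mod b) - 1)"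
    using assms(1) True j unfolding forest_def by auto
  ultimately have "item v im rm C g (leaf im a g s)"
    using leaf_code[of s im a g] True group_index[OF assms(2)] unfolding item_def
    by (intro exI[of _ "g * L + s div b"] exI[of _ "s mod b"] exI[of _ "root im a (s mod b) - 1"]) auto
  then show ?thesis ..
qed (auto simp: leaf_def)

lemma leaf_containing:
  assumes "forest v im rm a C" "p \<in> C" "g * L \<le> i" "i < g * L + L"
  obtains s r x where "s < Z" "leaf im a g s = Suc (i * H + (r * n + x))" "p \<in> pts im r x" "tree v im rm r x"
proof -
  obtain j where j: "j < b" "root im a j \<noteq> 0" "p \<in> pts im j (root im a j - 1)"
    using assms(1,2) unfolding forest_def by auto
  let ?s = "(i - g * L) * b + j"
  have "Suc (i - g * L) * b \<le> L * b" using assms(3,4) by (intro mult_le_mono1) auto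
  then have s: "?s < L * b" using j by simp
  have sd: "?s div b = i - g * L" "?s mod b = j" using j by auto
  have "tree v im rm j (root im a j - 1)" using assms(1) j unfolding forest_def by auto
  moreover have "leaf im a g ?s = Suc (i * H + (j * n + (root im a j - 1)))"
    using leaf_code[of ?s im a g] s sd j assms(3) by simp
  ultimately show thesis using that[of ?s j "root im a j - 1"] s Lb_le_Z j by simp
qed

text \<open>The trees of a forest are disjoint, so a pair of a direction and a near point above the
  threshold lies in one initial candidate only, and there it has weight at most
  \<open>b\<close>.\<close>

lemma leaf_potential:
  assumes "forest v im rm a C"
  shows "(\<Sum>s<Z. phi v im B q \<Delta> (leaf im a g s))
    \<le> b * card (SIGMA i:{g * L..<g * L + L}. heavy v (C \<inter> B) q \<Delta> i)" (is "_ \<le> b * card ?S")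
proof -
  define J where "J = {s. s < L * b \<and> root im a (s mod b) \<noteq> 0}"
  define U where "U s = {g * L + s div b} \<times>
    (pts im (s mod b) (root im a (s mod b) - 1) \<inter> heavy v B q \<Delta> (g * L + s div b))" for s
  have JZ: "J \<subseteq> {..<Z}" using Lb_le_Z by (auto simp: J_def)
  then have finJ: "finite J" using finite_subset by blast
  have C: "finite C" using forest_sub[OF assms] finite_subset by blast
  have "(\<Sum>s<Z. phi v im B q \<Delta> (leaf im a g s)) = (\<Sum>s\<in>J. phi v im B q \<Delta> (leaf im a g s))"
    using JZ by (intro sum.mono_neutral_right) (auto simp: J_def leaf_def phi_def)
  also have "\<dots> \<le> (\<Sum>s\<in>J. b * card (U s))"
  proof (rule sum_mono)
    fix s assume s: "s \<in> J"
    have j: "s mod b < b" using b_pos by simp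
    have t: "tree v im rm (s mod b) (root im a (s mod b) - 1)"
      using assms s j unfolding forest_def J_def by auto
    have "phi v im B q \<Delta> (leaf im a g s) = Suc (s mod b) *
      card (pts im (s mod b) (root im a (s mod b) - 1) \<inter> heavy v B q \<Delta> (g * L + s div b))"
      using leaf_code[of s im a g] phi_code[OF j tree_rep[OF t]] s by (simp add: J_def)
    also have "\<dots> = Suc (s mod b) * card (U s)" by (simp add: U_def card_cartesian_product_singleton)
    also have "\<dots> \<le> b * card (U s)" using j by (intro mult_le_mono1) simp
    finally show "phi v im B q \<Delta> (leaf im a g s) \<le> b * card (U s)" .
  qed
  also have "\<dots> = b * card (\<Union>s\<in>J. U s)"
  proof -
    \<comment> \<open>Two slots differ in their direction or, for equal directions, in their rank,
      and then their trees are disjoint.\<close>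
    have "U s \<inter> U s' = {}" if "s \<in> J" "s' \<in> J" "s \<noteq> s'" for s s'
    proof (cases "s div b = s' div b")
      case True
      then have ne: "s mod b \<noteq> s' mod b" using that(3) by (metis div_mult_mod_eq)
      have "pts im (s mod b) (root im a (s mod b) - 1) \<inter> pts im (s' mod b) (root im a (s' mod b) - 1) = {}"
        using assms ne that b_pos unfolding forest_def J_def by auto
      then show ?thesis unfolding U_def by auto
    qed (auto simp: U_def)
    then show ?thesis
      by (subst card_UN_disjoint) (use finJ finite_pts in \<open>auto simp: sum_distrib_left U_def\<close>)
  qed
  also have "\<dots> \<le> b * card ?S"
  proof (intro mult_le_mono2 card_mono)
    show "finite ?S" using C by (auto simp: heavy_def)
    show "(\<Union>s\<in>J. U s) \<subseteq> ?S"
    proof (rule UN_least)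
      fix s assume s: "s \<in> J"
      have j: "s mod b < b" using b_pos by simp
      have "pts im (s mod b) (root im a (s mod b) - 1) \<subseteq> C"
        using assms s j unfolding forest_def J_def by auto
      moreover have "s div b < L" using s by (simp add: J_def less_mult_imp_div_less)
      ultimately show "U s \<subseteq> ?S" by (auto simp: U_def heavy_def)
    qed
  qed
  finally show ?thesis .
qed

text \<open>
  After \<open>p\<close> pops, either a point outside \<open>B\<close> has been found or the far point \<open>y\<close> is still covered by
  a candidate, which forces every pop so far to have consumed potential.
\<close>

definition progress :: "(nat \<Rightarrow> nat \<Rightarrow> real) \<Rightarrow> (nat \<Rightarrow> nat) \<Rightarrow> (nat \<Rightarrow> real) \<Rightarrow> nat set \<Rightarrow> nat \<Rightarrow> nat \<Rightarrow>
    nat \<Rightarrow> (nat \<Rightarrow> nat) \<Rightarrow> real \<Rightarrow> bool" where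
  "progress v im rm C g q p T \<delta> \<longleftrightarrow> (\<forall>B \<Delta> i y. g * L \<le> i \<longrightarrow> i < g * L + L \<longrightarrow> y \<in> C - B \<longrightarrow> \<Delta> \<le> v i y - v i q \<longrightarrow>
     (\<exists>w\<in>C - B. dist2 rm w q \<le> \<delta>) \<or>
     (\<exists>k<Z. \<exists>r x. T k = Suc (i * H + (r * n + x)) \<and> y \<in> pts im r x \<and> tree v im rm r x) \<and>
     (\<Sum>k<Z. phi v im B q \<Delta> (T k)) + p \<le> b * card (SIGMA i:{g * L..<g * L + L}. heavy v (C \<inter> B) q \<Delta> i))"

text \<open>No candidate of an empty queue covers \<open>y\<close>, so only the first alternative
  can hold, and that one does not mention \<open>p\<close>.\<close>

lemma progress_empty:
  assumes "progress v im rm C g q p T \<delta>" "\<And>k. k < Z \<Longrightarrow> T k = 0"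
  shows "progress v im rm C g q p' T \<delta>"
  using assms unfolding progress_def by (metis nat.distinct(1))

text \<open>While \<open>y\<close> is covered, the key of the covering candidate and hence the top
  key is at least \<open>\<Delta>\<close>. A winner outside \<open>B\<close> is a point as sought;
  any other winner makes the pop consume potential. If the popped tree covers \<open>y\<close>, it
  does not have rank 0, as its winner would be \<open>y\<close>, which is outside \<open>B\<close>;
  so \<open>y\<close> passes to one of the children.\<close>

lemma progress_step:
  assumes pr: "progress v im rm C g q p T \<delta>" and base: "base v rm" and q: "q < n" and g: "g < 3 * b"
    and C: "C \<subseteq> {..<n}"
    and item: "item v im rm C g u" and k: "k < Z" "T k = u" and l: "l < Z" "l \<noteq> k" "T l = 0"
    and top: "\<And>i. i < Z \<Longrightarrow> T i \<noteq> 0 \<Longrightarrow> key rm q (T i) \<le> key rm q u"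
    and T': "\<And>i. i < Z \<Longrightarrow> T' i = (if i = k then child1 u else if i = l then child2 im u else T i)"
    and \<delta>': "\<delta> \<le> \<delta>'" "dist2 rm (im (A + (u - 1))) q \<le> \<delta>'"
  shows "progress v im rm C g q (Suc p) T' \<delta>'"
  unfolding progress_def
proof (intro allI impI)
  fix B \<Delta> i y
  assume i: "g * L \<le> i" "i < g * L + L" and y: "y \<in> C - B" and \<Delta>: "\<Delta> \<le> v i y - v i q"
  let ?S = "SIGMA i:{g * L..<g * L + L}. heavy v (C \<inter> B) q \<Delta> i"
  let ?w = "im (A + (u - 1))"
  have iQ: "i < Q" using i group_index[OF g] by simp
  from pr i y \<Delta> consider (good) w where "w \<in> C - B" "dist2 rm w q \<le> \<delta>" |
    (cont) k' r x where "k' < Z" "T k' = Suc (i * H + (r * n + x))" "y \<in> pts im r x" "tree v im rm r x"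
      "(\<Sum>k<Z. phi v im B q \<Delta> (T k)) + p \<le> b * card ?S"
    unfolding progress_def by blast
  then show "(\<exists>w\<in>C - B. dist2 rm w q \<le> \<delta>') \<or>
     (\<exists>k<Z. \<exists>r x. T' k = Suc (i * H + (r * n + x)) \<and> y \<in> pts im r x \<and> tree v im rm r x) \<and>
     (\<Sum>k<Z. phi v im B q \<Delta> (T' k)) + Suc p \<le> b * card ?S"
  proof cases
    case good
    then show ?thesis using \<delta>'(1) order_trans by blast
  next
    case cont
    have wC: "?w \<in> C" using item_winner[OF item C] by blast
    show ?thesis
    proof (cases "?w \<in> B")
      case False
      then show ?thesis using wC \<delta>' by blast
    next
      case True
      have "\<Delta> \<le> key rm q (T k')"
        using item_key(3)[OF base q cont(2) iQ cont(4,3)] \<Delta> by simp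
      also have "\<dots> \<le> key rm q u" by (rule top[OF cont(1)]) (simp add: cont(2))
      finally have ph: "phi v im B q \<Delta> (child1 u) + phi v im B q \<Delta> (child2 im u) + 1 \<le> phi v im B q \<Delta> u"
        using phi_pop[OF base q item] True by simp
      have "(\<Sum>i<Z. phi v im B q \<Delta> (T' i)) + phi v im B q \<Delta> (T k) =
          (\<Sum>i<Z. phi v im B q \<Delta> (T i)) + phi v im B q \<Delta> (child1 u) + phi v im B q \<Delta> (child2 im u)"
        by (rule sum_two_updates[where l = l]) (use k l T' in \<open>auto simp: phi_def\<close>)
      then have "(\<Sum>k<Z. phi v im B q \<Delta> (T' k)) + Suc p \<le> b * card ?S"
        using ph cont(5) unfolding k(2) by linarith
      moreover have "\<exists>k<Z. \<exists>r x. T' k = Suc (i * H + (r * n + x)) \<and> y \<in> pts im r x \<and> tree v im rm r x"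
      proof (cases "k' = k")
        case False
        then show ?thesis using cont l T'[of k'] by (intro exI[of _ k']) auto
      next
        case True
        then have u: "u = Suc (i * H + (r * n + x))" using cont k by simp
        have xr: "x < n" "r < b" using cont tree_rep tree_rank by auto
        have "r \<noteq> 0"
        proof
          assume "r = 0"
          then have "y = x" "?w = x"
            using cont(3) item_key(2)[OF base q u iQ cont(4)] by auto
          then show False using \<open>?w \<in> B\<close> y by simp
        qed
        then obtain r' where r': "r = Suc r'" by (cases r) auto
        have c: "child1 u = Suc (i * H + (r' * n + x))" "child2 im u = Suc (i * H + (r' * n + oth im r' x))"
          using child_node[where x = x and r = r' and i = i] xr u r' by auto
        from cont(3) r' have "y \<in> pts im r' x \<or> y \<in> pts im r' (oth im r' x)" by simp
        then show ?thesis
        proof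
          assume "y \<in> pts im r' x"
          then show ?thesis using c k T'[of k] cont(4) r' by (intro exI[of _ k]) auto
        next
          assume yy: "y \<in> pts im r' (oth im r' x)"
          have "T' l = child2 im u" using T'[of l] l by simp
          then show ?thesis using yy c l cont(4) r'
            by (intro exI[of _ l] conjI exI[of _ r'] exI[of _ "oth im r' x"]) auto
        qed
      qed
      ultimately show ?thesis by blast
    qed
  qed
qed

lemma progress_leaves:
  assumes "forest v im rm a C" "g < 3 * b"
  shows "progress v im rm C g q 0 (leaf im a g) \<delta>"
  unfolding progress_def
proof (intro allI impI)
  fix B \<Delta> i y
  assume i: "g * L \<le> i" "i < g * L + L" and y: "y \<in> C - B"
  obtain s r x where "s < Z" "leaf im a g s = Suc (i * H + (r * n + x))" "y \<in> pts im r x" "tree v im rm r x"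
    using leaf_containing[OF assms(1) _ i, of y] y by blast
  then show "(\<exists>w\<in>C - B. dist2 rm w q \<le> \<delta>) \<or>
     (\<exists>k<Z. \<exists>r x. leaf im a g k = Suc (i * H + (r * n + x)) \<and> y \<in> pts im r x \<and> tree v im rm r x) \<and>
     (\<Sum>k<Z. phi v im B q \<Delta> (leaf im a g k)) + 0 \<le> b * card (SIGMA i:{g * L..<g * L + L}. heavy v (C \<inter> B) q \<Delta> i)"
    using leaf_potential[OF assms(1), of B q \<Delta> g] by auto
qed

text \<open>For the threshold of the analysis at most \<open>L\<close> such pairs are expected, so
  the bound \<open>4 * L\<close> is violated with probability at most 1 / 4.\<close>

definition good_group :: "(nat \<Rightarrow> nat \<Rightarrow> real) \<Rightarrow> nat set \<Rightarrow> nat \<Rightarrow> nat set \<Rightarrow> real \<Rightarrow> nat \<Rightarrow> nat \<Rightarrow> bool" where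
  "good_group v C q B \<Delta> y g \<longleftrightarrow> (\<exists>i. g * L \<le> i \<and> i < g * L + L \<and> \<Delta> \<le> v i y - v i q) \<and>
     card (SIGMA i:{g * L..<g * L + L}. heavy v (C \<inter> B) q \<Delta> i) < 4 * L"

text \<open>If \<open>y\<close> were still covered after \<open>M\<close> pops, then
  \<open>M\<close> would be at most \<open>b\<close> times the number of pairs, which is less than
  \<open>4 * L * b = M\<close>.\<close>

lemma progress_end:
  assumes "progress v im rm C g q M T \<delta>" "good_group v C q B \<Delta> y g" "y \<in> C - B"
  shows "\<exists>w\<in>C - B. dist2 rm w q \<le> \<delta>"
proof -
  let ?S = "SIGMA i:{g * L..<g * L + L}. heavy v (C \<inter> B) q \<Delta> i"
  have "card ?S < 4 * L" using assms(2) by (simp add: good_group_def)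
  then have "b * card ?S < M" using b_pos by (simp add: M_def)
  then show ?thesis using assms unfolding progress_def good_group_def by fastforce
qed

definition res :: "(nat \<Rightarrow> real) \<Rightarrow> nat set \<Rightarrow> nat \<Rightarrow> state \<Rightarrow> bool" where
  "res rm C q s \<longleftrightarrow> ireg s 25 \<in> C \<and> rreg s 1 = dist2 rm (ireg s 25) q"

lemma dist2_nonneg: "0 \<le> dist2 rm w q" by (simp add: dist2_def sum_nonneg)

definition group_time :: nat where
  "group_time = 7 + 11 * Z + M * (28 + 4 * d + 15 * depth)"

lemma wp_query_group:
  assumes Par: "Par s" and regs: "ireg s 0 = a" "ireg s 1 = q" "ireg s 14 = g" and a: "a < n" and q: "q < n"
    and g: "g < 3 * b" and cd: "codes s" and F: "forest v (imem s) (rmem s) a C" and ne: "C \<noteq> {}"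
    and base: "base v (rmem s)" and init: "rreg s 1 = -1 \<or> res (rmem s) C q s"
    and R: "\<And>t s'. t \<le> group_time \<Longrightarrow> frame {15..27} s s' \<Longrightarrow> codes s' \<Longrightarrow>
      res (rmem s) C q s' \<Longrightarrow> rreg s 1 \<le> rreg s' 1 \<Longrightarrow>
      (\<And>B \<Delta> y. good_group v C q B \<Delta> y g \<Longrightarrow> y \<in> C - B \<Longrightarrow> \<exists>w\<in>C - B. dist2 (rmem s) w q \<le> rreg s' 1) \<Longrightarrow> R t s'"
  shows "wp m query_group R s"
  unfolding query_group_def
proof (rule wp_SeqI[where P = "\<lambda>t s'. t \<le> 2 + Z * 5 \<and> rreg s' = rreg s \<and> frame {18,19} s s' \<and>
      (\<forall>i<Z. imem s' (P + (Z + i)) = leaf (imem s) a g i) \<and> codes s'"], goal_cases)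
  case 1
  show ?case using assms forest_root[OF F] by (intro wp_fill_leaves[where a = a and g = g]) auto
next
  case (2 t1 s1)
  note h1 = 2
  have P1: "Par s1" using frame_Par[of "{18,19}" s s1] h1 Par by simp
  have im1: "imem s1 x = imem s x" if "x < P" for x using h1 that by (simp add: frame_def)
  show ?case
  proof (rule wp_SeqI[where P = "\<lambda>t s'. t \<le> 2 + Z * 6 \<and> rreg s' = rreg s1 \<and> frame {15,16,17} s1 s' \<and>
      (\<forall>i\<ge>Z. imem s' (P + i) = imem s1 (P + i)) \<and> codes s' \<and> (\<forall>i. 0 < i \<and> i < Z \<longrightarrow> tourn q s' i)"], goal_cases)
    case 1
    show ?case using h1 P1 q regs by (intro wp_build_tree[where q = q]) (auto simp: frame_def)
  next
    case (2 t2 s2)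
    note h2 = 2
    have P2: "Par s2" using frame_Par[of "{15,16,17}" s1 s2] h2 P1 by simp
    have fr2: "frame {15..27} s s2" using frame_trans[of _ s s1 _ s2 "{15..27}"] h1 h2 by force
    have lf2: "imem s2 (P + (Z + i)) = leaf (imem s) a g i" if "i < Z" for i
      using h2 h1 that by simp
    \<comment> \<open>The answer may still be undefined before the first pop. The clause for
      \<open>p = 0\<close> records that the queue is nonempty at that moment, which follows from
      \<open>C \<noteq> {}\<close>; hence the first pop finds a point, and \<open>res\<close> holds
      from then on.\<close>
    define I where "I = (\<lambda>p s'. frame {15..27} s s' \<and> popinv v C g q s' \<and> ireg s' 20 = p \<and>
      ireg s' 18 \<le> L * b + p \<and> rreg s 1 \<le> rreg s' 1 \<and>
      (p = 0 \<longrightarrow> (\<exists>k<Z. imem s' (P + (Z + k)) \<noteq> 0) \<and> (rreg s' 1 = -1 \<or> res (rmem s) C q s')) \<and>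
      (0 < p \<longrightarrow> res (rmem s) C q s') \<and>
      progress v (imem s) (rmem s) C g q p (\<lambda>k. imem s' (P + (Z + k))) (rreg s' 1))"
    let ?s3 = "s2\<lparr>ireg := (ireg s2)(18 := L * b, 20 := 0)\<rparr>"
    have I0: "I 0 ?s3"
    proof -
      have f: "frame {15..27} s ?s3" using fr2 by (auto simp: frame_def)
      have it: "leaf (imem s) a g k = 0 \<or> item v (imem s2) (rmem s2) C g (leaf (imem s) a g k)" for k
        using leaf_item[OF F g, of k] item_frame[of "imem s2" "imem s" v "rmem s" C g] fr2 
        by (auto simp: frame_def)
      have "popinv v C g q ?s3"
        unfolding popinv_def using P2 h2 h1 lf2 it regs(2)
        by (auto simp: Par_def frame_def codes_def tourn_def leaf_def)
      moreover have "\<exists>k<Z. imem s2 (P + (Z + k)) \<noteq> 0"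
      proof -
        obtain y where "y \<in> C" using ne by blast
        then obtain k r x where "k < Z" "leaf (imem s) a g k = Suc (g * L * H + (r * n + x))"
          using leaf_containing[OF F, of y g "g * L"] L_pos by (metis less_add_same_cancel1 order_refl)
        then show ?thesis using lf2 by (metis nat.distinct(1))
      qed
      moreover have "progress v (imem s) (rmem s) C g q 0 (\<lambda>k. imem ?s3 (P + (Z + k))) (rreg ?s3 1)"
      proof -
        have "progress v (imem s) (rmem s) C g q 0 (leaf (imem s) a g) (rreg ?s3 1)"
          by (rule progress_leaves[OF F g])
        then show ?thesis unfolding progress_def using lf2 by (simp cong: conj_cong)
      qed
      moreover have "rreg s2 = rreg s" using h1 h2 by simp
      moreover have "ireg s2 25 = ireg s 25" using h1 h2 by (simp add: frame_def)
      ultimately show ?thesis using f init unfolding I_def by (simp add: res_def)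
    qed
    have "wp m (While (ILess (IReg 20) vM) (pop;; incr 20))
      (\<lambda>t s'. R (t1 + (t2 + Suc (Suc t))) s') ?s3"
    proof (rule wp_for[where N = M and \<tau> = "26 + 4 * d + 15 * depth" and I = I], goal_cases)
      case 1
      show ?case by (rule I0)
    next
      case (2 p s')
      have Ip: "I p s'" and pM: "p < M" using 2 by auto
      have fr: "frame {15..27} s s'" and pin: "popinv v C g q s'" and r20: "ireg s' 20 = p" and
        r18: "ireg s' 18 \<le> L * b + p" and mono: "rreg s 1 \<le> rreg s' 1" and
        p0: "p = 0 \<Longrightarrow> (\<exists>k<Z. imem s' (P + (Z + k)) \<noteq> 0) \<and> (rreg s' 1 = -1 \<or> res (rmem s) C q s')" and
        pp: "0 < p \<Longrightarrow> res (rmem s) C q s'" and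
        pr: "progress v (imem s) (rmem s) C g q p (\<lambda>k. imem s' (P + (Z + k))) (rreg s' 1)"
        using Ip unfolding I_def by auto
      have sl: "ireg s' 18 < Z" using r18 pM Lb_M by linarith
      have rm: "rmem s' = rmem s" using fr by (simp add: frame_def)
      have imP: "imem s' x = imem s x" if "x < P" for x using fr that by (simp add: frame_def)
      have P': "Par s'" using frame_Par[OF fr] Par by auto
      have to: "\<And>i. 0 < i \<Longrightarrow> i < Z \<Longrightarrow> tourn q s' i" using pin by (simp add: popinv_def)
      have pm: "Suc p < m" "p < m" using pM bounds by auto
      have step: "wp m (incr 20) (\<lambda>t' s3. t + t' \<le> 26 + 4 * d + 15 * depth \<and> I (Suc p) s3) s''"
        if t: "t \<le> 25 + 4 * d + 15 * depth" and f: "frame scratch s' s''" and pin': "popinv v C g q s''" and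
          r18': "ireg s'' 18 \<le> L * b + Suc p" and mono': "rreg s' 1 \<le> rreg s'' 1" and
          res': "res (rmem s) C q s''" and
          pr': "progress v (imem s) (rmem s) C g q (Suc p) (\<lambda>k. imem s'' (P + (Z + k))) (rreg s'' 1)" for t s''
      proof -
        have f': "frame {15..27} s s''" using frame_trans[OF fr f, of "{15..27}"] by (auto simp: scratch_def)
        have r20': "ireg s'' 20 = p" using f r20 by (auto simp: frame_def scratch_def)
        let ?f = "s''\<lparr>ireg := (ireg s'')(20 := Suc p)\<rparr>"
        have "frame {15..27} s ?f" using f' by (auto simp: frame_def)
        moreover have "popinv v C g q ?f" using pin' by (auto simp: popinv_def Par_def codes_def tourn_def)
        ultimately have "I (Suc p) ?f" unfolding I_def
          using r18' mono mono' res' pr' by (simp add: res_def)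
        then show ?thesis using r20' pm t bounds by (simp add: wp_simps)
      qed
      have "wp m pop (\<lambda>t s''. wp m (incr 20) (\<lambda>t' s3. t + t' \<le> 26 + 4 * d + 15 * depth \<and> I (Suc p) s3) s'') s'"
      proof (rule wp_pop[OF pin q forest_sub[OF F] refl sl], goal_cases)
        case h: (1 t s'')
        have zero: "imem s' (P + (Z + k)) = 0" if "k < Z" for k
          using tourn_top[OF to, of "Z + k"] that h(2) Z_pos by (cases "imem s' (P + (Z + k)) = 0") auto
        then have "0 < p" using p0 by (cases p) auto
        then show ?case using h pp r18 pr zero progress_empty[OF pr, of "Suc p"] by (intro step) (auto simp: res_def)
      next
        case h: (2 t s'' k u w)
        have "k < Z" using h sl by simp
        have item': "item v (imem s') (rmem s') C g u"
          using pin h \<open>k < Z\<close> unfolding popinv_def by (metis)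
        have item: "item v (imem s) (rmem s) C g u"
          using item_frame[OF _ item', of "imem s"] imP rm by simp
        have u1: "A + (u - 1) < P"
          using key_index(4)[OF item_code[OF item] q] by (simp add: P_def)
        have w: "w = imem s (A + (u - 1))" using h imP[OF u1] by simp
        have wC: "w \<in> C" using item_winner[OF item forest_sub[OF F]] w by simp
        have ch2: "child2 (imem s') u = child2 (imem s) u" using child2_frame imP by blast
        have mono': "rreg s' 1 \<le> rreg s'' 1" using h by simp
        show ?case
        proof (rule step)
          show "res (rmem s) C q s''"
          proof (cases "rreg s' 1 < dist2 (rmem s) w q")
            case True
            then show ?thesis using h wC rm by (simp add: res_def)
          next
            case False
            then have "rreg s' 1 \<noteq> -1" using dist2_nonneg[of "rmem s" w q] by auto
            then have "res (rmem s) C q s'" using p0 pp by (cases p) auto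
            then show ?thesis using False h rm by (simp add: res_def)
          qed
          show "progress v (imem s) (rmem s) C g q (Suc p) (\<lambda>k. imem s'' (P + (Z + k))) (rreg s'' 1)"
          proof (rule progress_step[OF pr base q g forest_sub[OF F] item \<open>k < Z\<close> _ sl])
            show "imem s' (P + (Z + k)) = u" using h by simp
            show "ireg s' 18 \<noteq> k" using h by simp
            show "imem s' (P + (Z + ireg s' 18)) = 0" using pin sl by (simp add: popinv_def)
            show "key (rmem s) q (imem s' (P + (Z + i))) \<le> key (rmem s) q u"
              if "i < Z" "imem s' (P + (Z + i)) \<noteq> 0" for i
              using tourn_top[OF to, of "Z + i"] that h rm Z_pos by simp
            show "imem s'' (P + (Z + i)) = (if i = k then child1 u else
                if i = ireg s' 18 then child2 (imem s) u else imem s' (P + (Z + i)))" if "i < Z" for i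
              using h that ch2 by simp
            show "rreg s' 1 \<le> rreg s'' 1" by fact
            show "dist2 (rmem s) (imem s (A + (u - 1))) q \<le> rreg s'' 1"
              using h rm w by simp
          qed
        qed (use h r18 mono' in auto)
      qed
      then show ?case using P' r20 pm pM bounds by (simp add: wp_Seq Par_def)
    next
      case (3 s')
      have "Par s'" using frame_Par[of "{15..27}" s s'] 3 Par by (auto simp: I_def)
      then show ?case using 3 bounds by (simp add: I_def Par_def)
    next
      case (4 t s')
      have M0: "0 < M" using L_pos b_pos by (simp add: M_def)
      show ?case
      proof (rule R)
        show "t1 + (t2 + Suc (Suc t)) \<le> group_time"
          using 4(1) h1 h2 unfolding group_time_def by (simp add: algebra_simps)
        show "codes s'" using 4 by (simp add: I_def popinv_def)
        show "\<exists>w\<in>C - B. dist2 (rmem s) w q \<le> rreg s' 1" if "good_group v C q B \<Delta> y g" "y \<in> C - B" for B \<Delta> y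
          using progress_end[OF _ that] 4(2) unfolding I_def by blast
      qed (use 4 M0 in \<open>auto simp: I_def\<close>)
    qed
    then show ?case using P2 bounds by (simp add: wp_simps Par_def)
  qed
qed

definition query_time :: nat where "query_time = 5 + 3 * b * (group_time + 2)"

lemma forest_frame:
  assumes "\<And>x. x < P \<Longrightarrow> im' x = im x" "forest v im rm a C" "a < n"
  shows "forest v im' rm a C"
proof -
  have r: "root im' a j = root im a j" if "j < b" for j
    using root_index[OF assms(3) that] H_le_P assms(1) by (simp add: root_def)
  have t: "tree v im' rm j (root im a j - 1) \<and> pts im' j (root im a j - 1) = pts im j (root im a j - 1)"
    if "j < b" "root im a j \<noteq> 0" for j
    using assms(2) that tree_frame[where im' = im' and im = im and v = v and rm = rm and r = j and x = "root im a j - 1", OF assms(1)] unfolding forest_def by blast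
  have "C = (\<Union>j\<in>{j. j < b \<and> root im a j \<noteq> 0}. pts im j (root im a j - 1))"
    using assms(2) by (simp add: forest_def)
  also have "\<dots> = (\<Union>j\<in>{j. j < b \<and> root im' a j \<noteq> 0}. pts im' j (root im' a j - 1))"
    using r t by (intro SUP_cong) auto
  finally show ?thesis using r t assms(2) unfolding forest_def by simp
qed

text \<open>Each group can only increase the best distance, so a single good group among the
  \<open>3 * b\<close> is enough, although the program cannot tell which one it is.\<close>

lemma wp_query_prog:
  assumes Par: "Par s" and regs: "ireg s 0 = a" "ireg s 1 = q" and a: "a < n" and q: "q < n"
    and cd: "codes s" and F: "forest v (imem s) (rmem s) a C" and ne: "C \<noteq> {}"
    and base: "base v (rmem s)"
    and R: "\<And>t s'. t \<le> query_time \<Longrightarrow> frame (insert 0 {14..27}) s s' \<Longrightarrow> codes s' \<Longrightarrow> ireg s' 0 \<in> C \<Longrightarrow>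
      (\<And>g B \<Delta> y. g < 3 * b \<Longrightarrow> good_group v C q B \<Delta> y g \<Longrightarrow> y \<in> C - B \<Longrightarrow>
         \<exists>w\<in>C - B. dist2 (rmem s) w q \<le> dist2 (rmem s) (ireg s' 0) q) \<Longrightarrow> R t s'"
  shows "wp m query_prog R s"
proof -
  define I where "I = (\<lambda>g s'. frame {14..27} s s' \<and> codes s' \<and> ireg s' 14 = g \<and>
     (rreg s' 1 = -1 \<and> g = 0 \<or> res (rmem s) C q s') \<and>
     (\<forall>g'<g. \<forall>B \<Delta> y. good_group v C q B \<Delta> y g' \<longrightarrow> y \<in> C - B \<longrightarrow> (\<exists>w\<in>C - B. dist2 (rmem s) w q \<le> rreg s' 1)))"
  let ?s0 = "s\<lparr>rreg := (rreg s)(1 := -1), ireg := (ireg s)(25 := 0, 14 := 0)\<rparr>"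
  have "wp m (While (ILess (IReg 14) vG) (query_group;; incr 14);; ISet 0 (IReg 25))
     (\<lambda>t s'. R (Suc (Suc (Suc t))) s') ?s0"
  proof (rule wp_SeqI[where P = "\<lambda>t s'. t \<le> 1 + 3 * b * (group_time + 2) \<and> I (3 * b) s'"], goal_cases)
    case 1
    show ?case
    proof (rule wp_for[where N = "3 * b" and \<tau> = "group_time + 1" and I = I], goal_cases)
      case 1
      show ?case using cd by (auto simp: I_def frame_def codes_def)
    next
      case (2 g s')
      have fr: "frame {14..27} s s'" and cd': "codes s'" and r14: "ireg s' 14 = g"
        and rs: "rreg s' 1 = -1 \<or> res (rmem s) C q s'"
        and gd: "\<And>g' B \<Delta> y. g' < g \<Longrightarrow> good_group v C q B \<Delta> y g' \<Longrightarrow> y \<in> C - B \<Longrightarrow>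
          \<exists>w\<in>C - B. dist2 (rmem s) w q \<le> rreg s' 1"
        using 2 unfolding I_def by auto
      have P': "Par s'" using frame_Par[OF fr] Par by auto
      have rm: "rmem s' = rmem s" using fr by (simp add: frame_def)
      have g: "g < 3 * b" using 2 by simp
      have gm: "Suc g < m" using g bounds by simp
      have F': "forest v (imem s') (rmem s') a C"
        using forest_frame[OF _ F a, of "imem s'"] fr by (simp add: frame_def)
      have "wp m query_group (\<lambda>t s''. wp m (incr 14) (\<lambda>t' s3. t + t' \<le> group_time + 1 \<and> I (Suc g) s3) s'') s'"
      proof (rule wp_query_group[where a = a and q = q and g = g and v = v and C = C], goal_cases)
        case (13 t s'')
        let ?f = "s''\<lparr>ireg := (ireg s'')(14 := Suc g)\<rparr>"
        have r: "ireg s'' 14 = g" using 13 r14 by (simp add: frame_def)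
        have "frame {14..27} s s''" using frame_trans[OF fr 13(2), of "{14..27}"] by auto
        then have f: "frame {14..27} s ?f" by (auto simp: frame_def)
        have "\<exists>w\<in>C - B. dist2 (rmem s) w q \<le> rreg s'' 1"
          if "g' < Suc g" "good_group v C q B \<Delta> y g'" "y \<in> C - B" for g' B \<Delta> y
        proof (cases "g' = g")
          case True
          then show ?thesis using 13(6) that rm by simp
        next
          case False
          then show ?thesis using gd[of g' B \<Delta> y] that 13(5) by force
        qed
        then have "I (Suc g) ?f" unfolding I_def using f 13(3,4) rm by (simp add: res_def codes_def)
        then show ?case using 13(1) r gm bounds by (simp add: wp_simps)
      qed (use P' fr regs r14 a q g cd' F' ne base rs rm in \<open>auto simp: frame_def\<close>)
      then show ?case using P' r14 g bounds gm by (simp add: wp_Seq Par_def)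
    next
      case (3 s')
      have "Par s'" using frame_Par[of "{14..27}" s s'] 3 Par by (auto simp: I_def)
      then show ?case using 3 bounds by (simp add: I_def Par_def)
    next
      case (4 t s')
      then show ?case by simp
    qed
  next
    case (2 t s')
    have r: "res (rmem s) C q s'" using 2 b_pos by (auto simp: I_def)
    then have c: "ireg s' 25 \<in> C" by (simp add: res_def)
    then have "ireg s' 25 < m" using forest_sub[OF F] bounds by auto
    moreover have "R (Suc (Suc (Suc (Suc t)))) (s'\<lparr>ireg := (ireg s')(0 := ireg s' 25)\<rparr>)"
    proof (rule R, goal_cases)
      case (5 g B \<Delta> y)
      then show ?case using 2 r unfolding I_def res_def by auto
    qed (use 2 c in \<open>auto simp: I_def query_time_def frame_def codes_def\<close>)
    ultimately show ?case by (simp add: wp_simps)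
  qed
  then show ?thesis unfolding query_prog_def using bounds by (simp add: wp_simps)
qed

end

section \<open>Merging\<close>

context sizes
begin

text \<open>
  \<open>f a j\<close> is the root of rank \<open>j\<close> of handle \<open>a\<close>, as in memory; the unused handle \<open>n\<close> serves for the
  carry of a merge.
\<close>

definition fam :: "(nat \<Rightarrow> nat \<Rightarrow> real) \<Rightarrow> (nat \<Rightarrow> nat) \<Rightarrow> (nat \<Rightarrow> real) \<Rightarrow> (nat \<Rightarrow> nat \<Rightarrow> nat) \<Rightarrow> bool" where
  "fam v im rm f \<longleftrightarrow> (\<forall>a j. f a j \<noteq> 0 \<longrightarrow> tree v im rm j (f a j - 1)) \<and>
     (\<forall>a j a' j'. (a, j) \<noteq> (a', j') \<longrightarrow> f a j \<noteq> 0 \<longrightarrow> f a' j' \<noteq> 0 \<longrightarrow>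
        pts im j (f a j - 1) \<inter> pts im j' (f a' j' - 1) = {})"

definition cont :: "(nat \<Rightarrow> nat) \<Rightarrow> (nat \<Rightarrow> nat \<Rightarrow> nat) \<Rightarrow> nat \<Rightarrow> nat set" where
  "cont im f a = (\<Union>j\<in>{j. f a j \<noteq> 0}. pts im j (f a j - 1))"

definition upd :: "(nat \<Rightarrow> nat \<Rightarrow> nat) \<Rightarrow> nat \<Rightarrow> nat \<Rightarrow> nat \<Rightarrow> nat \<Rightarrow> nat \<Rightarrow> nat" where
  "upd f a j x = (\<lambda>a' j'. if a' = a \<and> j' = j then x else f a' j')"

lemma fam_tree: "fam v im rm f \<Longrightarrow> f a j \<noteq> 0 \<Longrightarrow> tree v im rm j (f a j - 1)"
  by (simp add: fam_def)

lemma fam_disjoint: "fam v im rm f \<Longrightarrow> (a, j) \<noteq> (a', j') \<Longrightarrow> f a j \<noteq> 0 \<Longrightarrow> f a' j' \<noteq> 0 \<Longrightarrow>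
        pts im j (f a j - 1) \<inter> pts im j' (f a' j' - 1) = {}"
  unfolding fam_def by blast

lemma cont_upd_add: "f a j = 0 \<Longrightarrow> cont im (upd f a j (Suc x)) a = cont im f a \<union> pts im j x"
  by (auto simp: cont_def upd_def split: if_splits) (metis neq0_conv)

lemma cont_upd_remove:
  assumes "f a j = Suc x" shows "cont im (upd f a j 0) a \<union> pts im j x = cont im f a"
proof -
  have "{k. f a k \<noteq> 0} = insert j {k. upd f a j 0 a k \<noteq> 0}" using assms by (auto simp: upd_def)
  then have "cont im f a = pts im j x \<union> (\<Union>k\<in>{k. upd f a j 0 a k \<noteq> 0}. pts im k (f a k - 1))"
    using assms by (simp add: cont_def)
  also have "(\<Union>k\<in>{k. upd f a j 0 a k \<noteq> 0}. pts im k (f a k - 1)) = cont im (upd f a j 0) a"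
    unfolding cont_def by (intro SUP_cong) (auto simp: upd_def)
  finally show ?thesis by auto
qed

lemma cont_upd_other: "a' \<noteq> a \<Longrightarrow> cont im (upd f a j x) a' = cont im f a'"
  by (auto simp: cont_def upd_def)

lemma fam_remove: "fam v im rm f \<Longrightarrow> fam v im rm (upd f a j 0)"
  unfolding fam_def upd_def by auto

lemma fam_move:
  assumes "fam v im rm f" "f t j = 0" "s \<noteq> t"
  shows "fam v im rm (upd (upd f s j 0) t j (f s j))"
    and "cont im (upd (upd f s j 0) t j (f s j)) s \<union> cont im (upd (upd f s j 0) t j (f s j)) t = cont im f s \<union> cont im f t"
proof -
  let ?f = "upd (upd f s j 0) t j (f s j)"
  show "fam v im rm ?f"
    unfolding fam_def
  proof (intro conjI allI impI)
    fix a k assume "?f a k \<noteq> 0"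
    then show "tree v im rm k (?f a k - 1)" using assms(1) by (auto simp: upd_def fam_def split: if_splits)
  next
    fix a k a' k' assume ne: "(a, k) \<noteq> (a', k')" and nz: "?f a k \<noteq> 0" "?f a' k' \<noteq> 0"
    let ?a = "if a = t \<and> k = j then s else a" and ?a' = "if a' = t \<and> k' = j then s else a'"
    have e: "?f a k = f ?a k" "?f a' k' = f ?a' k'" using nz assms(3) by (auto simp: upd_def split: if_splits)
    moreover have "(?a, k) \<noteq> (?a', k')" using ne nz assms(3) by (auto simp: upd_def split: if_splits)
    ultimately show "pts im k (?f a k - 1) \<inter> pts im k' (?f a' k' - 1) = {}"
      using fam_disjoint[OF assms(1), of ?a k ?a' k'] nz by simp
  qed
  show "cont im ?f s \<union> cont im ?f t = cont im f s \<union> cont im f t"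
  proof (cases "f s j")
    case 0
    then have "?f = f" using assms(2) by (auto simp: upd_def fun_eq_iff)
    then show ?thesis by simp
  next
    case (Suc x)
    have "cont im ?f t = cont im (upd f s j 0) t \<union> pts im j x"
      unfolding Suc using assms by (intro cont_upd_add) (simp add: upd_def)
    moreover have "cont im ?f s = cont im (upd f s j 0) s" using assms(3) by (intro cont_upd_other)
    moreover have "cont im (upd f s j 0) t = cont im f t" using assms(3) by (intro cont_upd_other) simp
    ultimately show ?thesis using cont_upd_remove[where im = im and f = f and a = s and j = j, OF Suc] by auto
  qed
qed

section \<open>Linking two trees of equal rank\<close>

definition linked :: "nat \<Rightarrow> nat \<Rightarrow> nat \<Rightarrow> (nat \<Rightarrow> nat) \<Rightarrow> (nat \<Rightarrow> real) \<Rightarrow> (nat \<Rightarrow> nat) \<Rightarrow> (nat \<Rightarrow> real) \<Rightarrow> bool" where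
  "linked j x y im rm im' rm' \<longleftrightarrow> im' (H + (j * n + x)) = y \<and>
     (\<forall>i<Q. let z = (if rm (A + (i * H + (j * n + x))) < rm (A + (i * H + (j * n + y))) then y else x) in
        im' (A + (i * H + (Suc j * n + x))) = im (A + (i * H + (j * n + z))) \<and>
        rm' (A + (i * H + (Suc j * n + x))) = rm (A + (i * H + (j * n + z)))) \<and>
     (\<forall>k. k \<noteq> H + (j * n + x) \<and> (\<forall>i<Q. k \<noteq> A + (i * H + (Suc j * n + x))) \<longrightarrow> im' k = im k) \<and>
     (\<forall>k. (\<forall>i<Q. k \<noteq> A + (i * H + (Suc j * n + x))) \<longrightarrow> rm' k = rm k)"

lemma rank_index_eq:
  assumes "r < b" "x < n" "r' < b" "x' < n"
  shows "i * H + (r * n + x) = i' * H + (r' * n + x') \<longleftrightarrow> i = i' \<and> r = r' \<and> x = x'"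
  using code_decode[OF assms(1,2), of i] code_decode[OF assms(3,4), of i'] by metis

text \<open>A link writes the right child of \<open>x\<close> at rank \<open>j\<close> and the
  winners of \<open>x\<close> at rank \<open>j + 1\<close>. A tree without \<open>x\<close> reads
  neither, and a tree of rank at most \<open>j\<close> reads only right children of rank below
  \<open>j\<close> and winners of rank up to \<open>j\<close>.\<close>

lemma linked_frame:
  assumes lk: "linked j x y im rm im' rm'" and j: "Suc j < b" "x < n" and t: "tree v im rm r z"
    and or: "x \<notin> pts im r z \<or> r \<le> j"
  shows "tree v im' rm' r z" "pts im' r z = pts im r z"
proof -
  have r: "r < b" using tree_rank t by blast
  have "tree v im' rm' r z \<and> pts im' r z = pts im r z"
  proof (rule tree_cong[OF t], goal_cases)
    case (1 r' x')
    have x': "x' < n" using tree_pts[OF t] 1 by auto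
    have rH: "r' * n + x' < H" using rank_index[of r' x'] 1 r x' by simp
    then have "H + (r' * n + x') \<noteq> A + k" for k by (simp add: A_def)
    moreover have "H + (r' * n + x') \<noteq> H + (j * n + x)"
      using rank_index_eq[of r' x' j x 0 0] 1 r x' j or by auto
    ultimately show ?case using lk unfolding linked_def by metis
  next
    case (2 i r' x')
    have x': "x' < n" using tree_pts[OF t] 2 by auto
    have "\<forall>i'<Q. A + (i * H + (r' * n + x')) \<noteq> A + (i' * H + (Suc j * n + x))"
      using rank_index_eq[of r' x' "Suc j" x i] 2 r x' j or by auto
    moreover have "A + (i * H + (r' * n + x')) \<noteq> H + (j * n + x)"
      using rank_index[of j x] j by (simp add: A_def)
    ultimately show ?case using lk unfolding linked_def by metis
  qed
  then show "tree v im' rm' r z" "pts im' r z = pts im r z" by auto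
qed

text \<open>The union has \<open>2 ^ (j + 1)\<close> points, which is at most
  \<open>n < 2 ^ b\<close>. So a link always finds room in the tables, and a carry never leaves the
  last rank.\<close>

lemma link_rank:
  assumes tx: "tree v im rm j x" and ty: "tree v im rm j y" and dis: "pts im j x \<inter> pts im j y = {}"
  shows "Suc j < b"
proof -
  have "card (pts im j x \<union> pts im j y) = 2 ^ j + 2 ^ j"
    using card_pts[OF tx] card_pts[OF ty] dis finite_pts by (simp add: card_Un_disjoint)
  moreover have "card (pts im j x \<union> pts im j y) \<le> card {..<n}"
    using tree_pts[OF tx] tree_pts[OF ty] by (intro card_mono) auto
  ultimately have "2 ^ Suc j \<le> n" by simp
  then have "(2::nat) ^ Suc j < 2 ^ b" using n_upper by (rule le_less_trans)
  then show ?thesis using power_strict_increasing_iff[of "2::nat" "Suc j" b] by simp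
qed

lemma linked_tree:
  assumes lk: "linked j x y im rm im' rm'" and tx: "tree v im rm j x" and ty: "tree v im rm j y"
    and dis: "pts im j x \<inter> pts im j y = {}"
  shows "Suc j < b" "tree v im' rm' (Suc j) x" "pts im' (Suc j) x = pts im j x \<union> pts im j y"
proof -
  show sj: "Suc j < b" by (rule link_rank[OF tx ty dis])
  have x: "x < n" using tree_rep tx by blast
  note fx = linked_frame[OF lk sj x tx, simplified] and fy = linked_frame[OF lk sj x ty, simplified]
  have o: "oth im' j x = y" using lk by (simp add: linked_def oth_def)
  show p: "pts im' (Suc j) x = pts im j x \<union> pts im j y" using fx fy o by simp
  have "node v im' rm' (Suc j) x"
    unfolding node_def p
  proof (intro allI impI)
    fix i assume i: "i < Q"
    define z where "z = (if rm (A + (i * H + (j * n + x))) < rm (A + (i * H + (j * n + y))) then y else x)"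
    have l: "im' (A + (i * H + (Suc j * n + x))) = im (A + (i * H + (j * n + z)))"
        "rm' (A + (i * H + (Suc j * n + x))) = rm (A + (i * H + (j * n + z)))"
      using lk i unfolding linked_def z_def by (auto simp: Let_def simp del: mult_Suc)
    have nx: "node v im rm j x" and ny: "node v im rm j y" using tree_node tx ty by auto
    have "rm (A + (i * H + (j * n + x))) \<le> rm (A + (i * H + (j * n + z)))"
      "rm (A + (i * H + (j * n + y))) \<le> rm (A + (i * H + (j * n + z)))" by (auto simp: z_def)
    then have "\<forall>w\<in>pts im j x \<union> pts im j y. v i w \<le> rm (A + (i * H + (j * n + z)))"
      using nx ny i unfolding node_def by (meson UnE order_trans)
    moreover have "im (A + (i * H + (j * n + z))) \<in> pts im j x \<union> pts im j y"
      "rm (A + (i * H + (j * n + z))) = v i (im (A + (i * H + (j * n + z))))"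
      using nx ny i by (auto simp: z_def node_def)
    ultimately show "im' (A + (i * H + (Suc j * n + x))) \<in> pts im j x \<union> pts im j y \<and>
         rm' (A + (i * H + (Suc j * n + x))) = v i (im' (A + (i * H + (Suc j * n + x)))) \<and>
         (\<forall>w\<in>pts im j x \<union> pts im j y. v i w \<le> rm' (A + (i * H + (Suc j * n + x))))"
      unfolding l by blast
  qed
  then show "tree v im' rm' (Suc j) x" using fx fy o dis by simp
qed

text \<open>All other trees are disjoint from the tree of \<open>x\<close>; thus they do not contain
  \<open>x\<close> and keep their slots. The contents are compared over a set \<open>U\<close> of
  handles because the link moves points from \<open>s\<close> and \<open>t\<close> to
  \<open>u\<close>.\<close>

lemma fam_link:
  assumes fm: "fam v im rm f" and s: "f s j = Suc x" and t: "f t j = Suc y" and st: "s \<noteq> t"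
    and u: "f u (Suc j) = 0" and lk: "linked j x y im rm im' rm'"
  defines "f' \<equiv> upd (upd (upd f s j 0) t j 0) u (Suc j) (Suc x)"
  shows "fam v im' rm' f'" "Suc j < b"
    and "\<And>U. s \<in> U \<Longrightarrow> t \<in> U \<Longrightarrow> u \<in> U \<Longrightarrow> (\<Union>a\<in>U. cont im' f' a) = (\<Union>a\<in>U. cont im f a)"
    and "\<And>a. a \<notin> {s, t, u} \<Longrightarrow> cont im' f' a = cont im f a"
proof -
  have tx: "tree v im rm j x" and ty: "tree v im rm j y" using fam_tree[OF fm, of s j] fam_tree[OF fm, of t j] s t by simp_all
  have dis: "pts im j x \<inter> pts im j y = {}" using fam_disjoint[OF fm, of s j t j] s t st by simp
  note lt = linked_tree[OF lk tx ty dis]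
  show "Suc j < b" by (rule lt)
  have x: "x < n" using tree_rep tx by blast
  define f1 where "f1 = upd (upd f s j 0) t j 0"
  have fm1: "fam v im rm f1" unfolding f1_def using fm fam_remove by blast
  have old: "tree v im' rm' k (f1 a k - 1)" "pts im' k (f1 a k - 1) = pts im k (f1 a k - 1)"
     "pts im k (f1 a k - 1) \<inter> (pts im j x \<union> pts im j y) = {}" if "f1 a k \<noteq> 0" for a k
  proof -
    have f: "f1 a k = f a k" "(a, k) \<noteq> (s, j)" "(a, k) \<noteq> (t, j)" "f a k \<noteq> 0"
      using that by (auto simp: f1_def upd_def split: if_splits)
    show d: "pts im k (f1 a k - 1) \<inter> (pts im j x \<union> pts im j y) = {}"
      using fam_disjoint[OF fm f(2)] fam_disjoint[OF fm f(3)] f s t by auto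
    have "x \<notin> pts im k (f1 a k - 1)" using d rep_in_pts[of x im j] by auto
    then show "tree v im' rm' k (f1 a k - 1)" "pts im' k (f1 a k - 1) = pts im k (f1 a k - 1)"
      using linked_frame[OF lk lt(1) x fam_tree[OF fm1 that]] by auto
  qed
  have f1u: "f1 u (Suc j) = 0" using u by (simp add: f1_def upd_def)
  have f'1: "f' a k = (if a = u \<and> k = Suc j then Suc x else f1 a k)" for a k
    by (simp add: f'_def f1_def upd_def)
  show "fam v im' rm' f'"
    unfolding fam_def
  proof (intro conjI allI impI)
    fix a k assume "f' a k \<noteq> 0"
    then show "tree v im' rm' k (f' a k - 1)" using lt old by (auto simp: f'1)
  next
    fix a k a' k' assume ne: "(a, k) \<noteq> (a', k')" and nz: "f' a k \<noteq> 0" "f' a' k' \<noteq> 0"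
    show "pts im' k (f' a k - 1) \<inter> pts im' k' (f' a' k' - 1) = {}"
    proof (cases "(a, k) = (u, Suc j)")
      case True
      then have "f1 a' k' \<noteq> 0" "f' a' k' = f1 a' k'" using nz ne by (auto simp: f'1)
      then show ?thesis using old[of a' k'] lt(3) True by (auto simp: f'1)
    next
      case False
      then have a: "f1 a k \<noteq> 0" "f' a k = f1 a k" using nz by (auto simp: f'1)
      show ?thesis
      proof (cases "(a', k') = (u, Suc j)")
        case True
        then show ?thesis using old[of a k] lt(3) a by (auto simp: f'1)
      next
        case False
        then have a': "f1 a' k' \<noteq> 0" "f' a' k' = f1 a' k'" using nz by (auto simp: f'1)
        show ?thesis using old(2)[OF a(1)] old(2)[OF a'(1)] fam_disjoint[OF fm1 ne a(1) a'(1)] a a' by simp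
      qed
    qed
  qed
  have c1: "cont im' f1 a = cont im f1 a" for a
    using old by (auto simp: cont_def)
  have cu: "cont im' f' u = cont im' f1 u \<union> pts im' (Suc j) x"
    using cont_upd_add[of f1 u "Suc j" im' x] f1u by (simp add: f'_def f1_def)
  have co: "cont im' f' a = cont im' f1 a" if "a \<noteq> u" for a
    using cont_upd_other[OF that] by (simp add: f'_def f1_def)
  have cs: "cont im f1 s \<union> pts im j x = cont im f s"
  proof -
    have "cont im f1 s = cont im (upd f s j 0) s" unfolding f1_def using st by (intro cont_upd_other)
    then show ?thesis using cont_upd_remove[where im = im and f = f and a = s and j = j, OF s] by simp
  qed
  have ct: "cont im f1 t \<union> pts im j y = cont im f t"
  proof -
    have "upd f s j 0 t j = Suc y" using t st by (simp add: upd_def)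
    from cont_upd_remove[where im = im and f = "upd f s j 0" and a = t and j = j, OF this]
    have "cont im f1 t \<union> pts im j y = cont im (upd f s j 0) t" by (simp add: f1_def)
    then show ?thesis using cont_upd_other[of t s] st by simp
  qed
  have cc: "cont im f1 a = cont im f a" if "a \<notin> {s, t}" for a
    unfolding f1_def using that by (simp add: cont_upd_other)
  show "(\<Union>a\<in>U. cont im' f' a) = (\<Union>a\<in>U. cont im f a)" if U: "s \<in> U" "t \<in> U" "u \<in> U" for U
  proof -
    have "(\<Union>a\<in>U. cont im' f' a) = (\<Union>a\<in>U. cont im f1 a) \<union> (pts im j x \<union> pts im j y)"
    proof -
      have "cont im' f' a = cont im f1 a \<union> (if a = u then pts im j x \<union> pts im j y else {})" for a
        using cu co c1 lt(3) by auto
      then show ?thesis using U by (auto split: if_splits)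
    qed
    also have "\<dots> = (\<Union>a\<in>U. cont im f a)"
    proof -
      have "cont im f a = cont im f1 a \<union> (if a = s then pts im j x else {}) \<union> (if a = t then pts im j y else {})" for a
        using cs ct cc[of a] st by auto
      then show ?thesis using U by (auto split: if_splits)
    qed
    finally show ?thesis .
  qed
  show "cont im' f' a = cont im f a" if "a \<notin> {s, t, u}" for a
    using that co c1 cc by simp
qed

text \<open>Below \<open>H\<close> only roots of forests are stored, and a tree reads none of
  them.\<close>

lemma tree_low:
  assumes "\<And>k. H \<le> k \<Longrightarrow> im' k = im k" "tree v im rm r x"
  shows "tree v im' rm r x \<and> pts im' r x = pts im r x"
proof (rule tree_cong[OF assms(2)], goal_cases)
  case 1 show ?case by (rule assms(1)) simp
next
  case 2
  have "H \<le> A" by (simp add: A_def)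
  then show ?case by (simp add: assms(1) trans_le_add1)
qed

lemma fam_low:
  assumes "\<And>k. H \<le> k \<Longrightarrow> im' k = im k" "fam v im rm f"
  shows "fam v im' rm f" "cont im' f a = cont im f a"
proof -
  have t: "tree v im' rm j (f a j - 1) \<and> pts im' j (f a j - 1) = pts im j (f a j - 1)" if "f a j \<noteq> 0" for a j
    by (rule tree_low[OF assms(1) fam_tree[OF assms(2) that]])
  show "fam v im' rm f"
    unfolding fam_def using t fam_disjoint[OF assms(2)] by auto
  show "cont im' f a = cont im f a" using t by (auto simp: cont_def)
qed

lemma root_index_eq:
  assumes "j < b" "j' < b" shows "a * b + j = a' * b + j' \<longleftrightarrow> a = a' \<and> j = j'"
proof
  assume e: "a * b + j = a' * b + j'"
  have "(a * b + j) div b = a" "(a' * b + j') div b = a'" "(a * b + j) mod b = j" "(a' * b + j') mod b = j'"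
    using assms by auto
  then show "a = a' \<and> j = j'" using e by metis
qed simp

lemma root_upd:
  assumes "j < b" "j' < b"
  shows "root (im(a * b + j := z)) a' j' = (if a' = a \<and> j' = j then z else root im a' j')"
  using root_index_eq[OF assms(2,1), of a' a] by (simp add: root_def)

lemma wp_link:
  assumes Par: "Par s" and regs: "ireg s 14 = j" "ireg s 15 = Suc x" "ireg s 16 = Suc y"
    and j: "Suc j < b" and x: "x < n" and y: "y < n"
    and win: "\<And>i. i < Q \<Longrightarrow> imem s (A + (i * H + (j * n + x))) < n"
      "\<And>i. i < Q \<Longrightarrow> imem s (A + (i * H + (j * n + y))) < n"
    and R: "\<And>t s'. t \<le> 3 + Q * 8 \<Longrightarrow> linked j x y (imem s) (rmem s) (imem s') (rmem s') \<Longrightarrow>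
      (\<forall>k. k \<notin> {17..20} \<longrightarrow> ireg s' k = ireg s k) \<Longrightarrow> R t s'"
  shows "wp m link R s"
proof -
  define z where "z i = (if rmem s (A + (i * H + (j * n + x))) < rmem s (A + (i * H + (j * n + y))) then y else x)" for i
  define I where "I = (\<lambda>k (s'::state). (\<forall>k. k \<notin> {17..20} \<longrightarrow> ireg s' k = ireg s k) \<and> ireg s' 17 = k \<and>
     imem s' (H + (j * n + x)) = y \<and>
     (\<forall>i<k. imem s' (A + (i * H + (Suc j * n + x))) = imem s (A + (i * H + (j * n + z i))) \<and>
        rmem s' (A + (i * H + (Suc j * n + x))) = rmem s (A + (i * H + (j * n + z i)))) \<and>
     (\<forall>l. l \<noteq> H + (j * n + x) \<and> (\<forall>i<k. l \<noteq> A + (i * H + (Suc j * n + x))) \<longrightarrow> imem s' l = imem s l) \<and>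
     (\<forall>l. (\<forall>i<k. l \<noteq> A + (i * H + (Suc j * n + x))) \<longrightarrow> rmem s' l = rmem s l))"
  let ?s0 = "s\<lparr>imem := (imem s)(H + (j * n + x) := y), ireg := (ireg s)(17 := 0)\<rparr>"
  have jx: "j * n + x < H" "j * n + y < H" "Suc j * n + x < H" using rank_index[of j] rank_index[OF j x] j x y by auto
  have "wp m (While (ILess (IReg 17) vQ)
       (ISet 18 (IAdd vA (IAdd (IMul (IReg 17) vH) (IAdd (IMul (IReg 14) vN) (ISub (IReg 15) (IConst 1)))));;
        ISet 19 (IAdd vA (IAdd (IMul (IReg 17) vH) (IAdd (IMul (IReg 14) vN) (ISub (IReg 16) (IConst 1)))));;
        Cond (RLess (RLoad (IReg 18)) (RLoad (IReg 19))) (ISet 20 (IReg 19)) (ISet 20 (IReg 18));;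
        RStore (IAdd (IReg 18) vN) (RLoad (IReg 20));;
        IStore (IAdd (IReg 18) vN) (ILoad (IReg 20));;
        incr 17)) (\<lambda>t s'. R (Suc (Suc t)) s') ?s0"
  proof (rule wp_for[where N = Q and \<tau> = 7 and I = I], goal_cases)
    case 1
    show ?case by (auto simp: I_def)
  next
    case (2 k s')
    have kQ: "k < Q" using 2 by simp
    have r: "ireg s' 14 = j" "ireg s' 15 = Suc x" "ireg s' 16 = Suc y" "ireg s' 17 = k" "Par s'"
      using 2 regs Par unfolding I_def Par_def by auto
    \<comment> \<open>The loop reads rank \<open>j\<close> and writes rank \<open>j + 1\<close>, so
      its sources still have their initial values.\<close>
    have ad: "A + (k * H + (j * n + w)) \<noteq> H + (j * n + x) \<and> (\<forall>i. A + (k * H + (j * n + w)) \<noteq> A + (i * H + (Suc j * n + x)))"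
      if "w < n" for w
    proof
      show "A + (k * H + (j * n + w)) \<noteq> H + (j * n + x)" using jx by (simp add: A_def)
      show "\<forall>i. A + (k * H + (j * n + w)) \<noteq> A + (i * H + (Suc j * n + x))"
        using rank_index_eq[of j w "Suc j" x k] j x that by simp
    qed
    have src: "imem s' (A + (k * H + (j * n + w))) = imem s (A + (k * H + (j * n + w)))"
       "rmem s' (A + (k * H + (j * n + w))) = rmem s (A + (k * H + (j * n + w)))" if "w < n" for w
      using 2 ad[OF that] unfolding I_def by blast+
    have kH: "k * H + (j * n + x) < Q * H" "k * H + (j * n + y) < Q * H" "k * H + (Suc j * n + x) < Q * H"
      using proj_index kQ jx by auto
    let ?X = "A + (k * H + (j * n + x))" and ?Y = "A + (k * H + (j * n + y))" and ?D = "A + (k * H + (j * n + x)) + n"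
    have De: "?D = A + (k * H + (Suc j * n + x))" by simp
    have le: "k * H < m" "j * n < m" "j * n + x < m" "j * n + y < m" "k * H + (j * n + x) < m" "k * H + (j * n + y) < m"
      "?X < m" "?Y < m" "?D < m" "A < m" "k < m" "Suc k < m" "H < m" "j < m" "n < m" "Suc x < m" "Suc y < m" "Q < m" "1 < m"
    proof -
      have "A + Q * H < m" using bounds by (simp add: P_def)
      then show "k * H < m" "j * n < m" "j * n + x < m" "j * n + y < m" "k * H + (j * n + x) < m" "k * H + (j * n + y) < m"
      "?X < m" "?Y < m" "?D < m" "A < m" "k < m" "Suc k < m" "H < m" "j < m" "n < m" "Suc x < m" "Suc y < m" "Q < m" "1 < m"
        using kH kQ bounds j x y De by linarith+
    qed
    have zk: "z k < n" using x y by (simp add: z_def)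
    define w where "w = imem s (A + (k * H + (j * n + z k)))"
    define val where "val = rmem s (A + (k * H + (j * n + z k)))"
    have wm: "w < m" using win[OF kQ] le(15) by (auto simp: w_def z_def)
    have fin: "I (Suc k) s''" if "\<forall>l. l \<notin> {17..20} \<longrightarrow> ireg s'' l = ireg s' l" "ireg s'' 17 = Suc k"
      "imem s'' = (imem s')(?D := w)" "rmem s'' = (rmem s')(?D := val)" for s''
    proof -
      have dne: "?D \<noteq> H + (j * n + x)" using jx by (simp add: A_def)
      have dd: "A + (i * H + (Suc j * n + x)) = ?D \<longleftrightarrow> i = k" for i
        unfolding De using H_pos by simp
      show ?thesis
        unfolding I_def that
      proof (intro conjI allI impI)
        fix l :: nat assume "l \<notin> {17..20}"
        then show "ireg s'' l = ireg s l" using that(1) 2 unfolding I_def by auto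
      next
        show "((imem s')(?D := w)) (H + (j * n + x)) = y" using dne 2 unfolding I_def by simp
      next
        fix i assume "i < Suc k"
        then show "((imem s')(?D := w)) (A + (i * H + (Suc j * n + x))) = imem s (A + (i * H + (j * n + z i)))"
          using dd[of i] 2 w_def unfolding I_def by (cases "i = k") (simp_all del: mult_Suc)
      next
        fix i assume "i < Suc k"
        then show "((rmem s')(?D := val)) (A + (i * H + (Suc j * n + x))) = rmem s (A + (i * H + (j * n + z i)))"
          using dd[of i] 2 val_def unfolding I_def by (cases "i = k") (simp_all del: mult_Suc)
      next
        fix l assume l: "l \<noteq> H + (j * n + x) \<and> (\<forall>i<Suc k. l \<noteq> A + (i * H + (Suc j * n + x)))"
        then have "l \<noteq> ?D" unfolding De by blast
        then show "((imem s')(?D := w)) l = imem s l" using 2 l unfolding I_def by simp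
      next
        fix l assume l: "\<forall>i<Suc k. l \<noteq> A + (i * H + (Suc j * n + x))"
        then have "l \<noteq> ?D" unfolding De by blast
        then show "((rmem s')(?D := val)) l = rmem s l" using 2 l unfolding I_def by simp
      qed simp
    qed
    have ne: "?X \<noteq> ?D" using n_pos by simp
    have body: "wp m (ISet 18 (IAdd vA (IAdd (IMul (IReg 17) vH) (IAdd (IMul (IReg 14) vN) (ISub (IReg 15) (IConst 1)))));;
        ISet 19 (IAdd vA (IAdd (IMul (IReg 17) vH) (IAdd (IMul (IReg 14) vN) (ISub (IReg 16) (IConst 1)))));;
        Cond (RLess (RLoad (IReg 18)) (RLoad (IReg 19))) (ISet 20 (IReg 19)) (ISet 20 (IReg 18));;
        RStore (IAdd (IReg 18) vN) (RLoad (IReg 20));;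
        IStore (IAdd (IReg 18) vN) (ILoad (IReg 20));;
        incr 17) (\<lambda>t s''. t \<le> 7 \<and> I (Suc k) s'') s'"
    proof (cases "rmem s ?X < rmem s ?Y")
      case True
      then have zy: "z k = y" by (simp add: z_def)
      have "imem s' ?Y = w" "rmem s' ?Y = val" "rmem s' ?X < rmem s' ?Y" using src x y zy True by (auto simp: w_def val_def)
      then show ?thesis using r le wm unfolding Par_def
        by (simp add: wp_simps) (intro fin; simp)
    next
      case False
      then have zy: "z k = x" by (simp add: z_def)
      have "imem s' ?X = w" "rmem s' ?X = val" "\<not> rmem s' ?X < rmem s' ?Y" using src x y zy False by (auto simp: w_def val_def)
      then show ?thesis using r le wm unfolding Par_def
        by (simp add: wp_simps) (intro fin; simp)
    qed
    then show ?case using r le kQ by (simp add: Par_def)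
  next
    case (3 s')
    have "Par s'" using 3 Par by (auto simp: I_def Par_def)
    then show ?case using 3 bounds by (simp add: I_def Par_def)
  next
    case (4 t s')
    show ?case
    proof (rule R)
      show "linked j x y (imem s) (rmem s) (imem s') (rmem s')"
        using 4(2) unfolding I_def linked_def Let_def z_def by (auto simp del: mult_Suc split: if_splits)
    qed (use 4 in \<open>auto simp: I_def\<close>)
  qed
  moreover have "H + (j * n + x) < m" "j * n < m" "j < m" "Suc x < m" "Suc y < m"
    using jx bounds j x y A_def by auto
  ultimately show ?thesis unfolding link_def using Par regs bounds by (simp add: wp_simps Par_def)
qed

text \<open>Trees travel between the two clusters and the carry, so only the union of the three
  contents is preserved until the end. The second cluster is emptied rank by rank, and the carry
  sits at the current rank under handle \<open>n\<close>. The last two clauses protect the codes of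
  the queue and the coordinates.\<close>

definition merge_inv :: "(nat \<Rightarrow> nat \<Rightarrow> real) \<Rightarrow> state \<Rightarrow> (nat \<Rightarrow> nat \<Rightarrow> nat) \<Rightarrow> nat \<Rightarrow> nat \<Rightarrow> nat \<Rightarrow>
    (nat \<Rightarrow> nat \<Rightarrow> nat) \<Rightarrow> state \<Rightarrow> bool" where
  "merge_inv v s0 f0 a c j f s \<longleftrightarrow> Par s \<and> ireg s 0 = a \<and> ireg s 1 = c \<and> fam v (imem s) (rmem s) f \<and>
     (\<forall>a'<n. \<forall>j'<b. root (imem s) a' j' = f a' j') \<and> f n j = ireg s 15 \<and> (\<forall>j'. j' \<noteq> j \<longrightarrow> f n j' = 0) \<and>
     (\<forall>j'<j. f c j' = 0) \<and>
     (\<Union>x\<in>{a, c, n}. cont (imem s) f x) = (\<Union>x\<in>{a, c, n}. cont (imem s0) f0 x) \<and>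
     (\<forall>a'. a' \<notin> {a, c, n} \<longrightarrow> cont (imem s) f a' = cont (imem s0) f0 a') \<and>
     base v (rmem s) \<and> (\<forall>k\<ge>P. imem s k = imem s0 k) \<and> (\<forall>k<A. rmem s k = rmem s0 k)"

lemma linked_base:
  assumes "linked j x y im rm im' rm'" "base v rm" "Suc j < b" "x < n"
  shows "base v rm'"
  unfolding base_def
proof (intro allI impI)
  fix i x' assume "i < Q" "x' < n"
  have "\<forall>i'<Q. A + (i * H + x') \<noteq> A + (i' * H + (Suc j * n + x))"
    using rank_index_eq[of 0 x' "Suc j" x i] assms(3,4) \<open>x' < n\<close> by simp
  then have "rm' (A + (i * H + x')) = rm (A + (i * H + x'))"
    using assms(1) unfolding linked_def by blast
  then show "rm' (A + (i * H + x')) = v i x'" using assms(2) \<open>i < Q\<close> \<open>x' < n\<close> by (simp add: base_def)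
qed

text \<open>This treats all ranks with a link at once. The tree of \<open>p\<close> keeps its
  representative, that of \<open>r\<close> becomes the right child, and the result is the carry of
  the next rank.\<close>

lemma wp_merge_link:
  assumes I: "merge_inv v s0 f0 a c j f s" and j: "j < b" and ac: "a < n" "c < n" "a \<noteq> c"
    and Par: "Par s1" and r1: "ireg s1 0 = a" "ireg s1 1 = c" "ireg s1 14 = j" "ireg s1 15 = Suc x" "ireg s1 16 = Suc y"
    and hi: "\<And>k. H \<le> k \<Longrightarrow> imem s1 k = imem s k" and rm: "rmem s1 = rmem s"
    and p: "f p j = Suc x" and r: "f r j = Suc y" and pr: "p \<noteq> r" "p \<in> {a, c, n}" "r \<in> {a, c, n}"
    and fn: "p = n \<or> f n j = 0" and rn: "r \<noteq> n" and fc: "p = c \<or> r = c \<or> f c j = 0"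
    and roots: "\<And>a' j'. a' < n \<Longrightarrow> j' < b \<Longrightarrow> root (imem s1) a' j' = upd (upd f p j 0) r j 0 a' j'"
    and R: "\<And>t s' f'. t \<le> 3 + Q * 8 \<Longrightarrow> merge_inv v s0 f0 a c (Suc j) f' s' \<Longrightarrow> ireg s' 14 = j \<Longrightarrow> R t s'"
  shows "wp m link R s1"
proof -
  have fm: "fam v (imem s) (rmem s) f" using I by (simp add: merge_inv_def)
  have fm1: "fam v (imem s1) (rmem s1) f" unfolding rm by (rule fam_low[OF hi fm])
  have c1: "cont (imem s1) f z = cont (imem s) f z" for z by (rule fam_low[OF hi fm])
  have tx: "tree v (imem s1) (rmem s1) j x" and ty: "tree v (imem s1) (rmem s1) j y"
    using fam_tree[OF fm1, of p j] fam_tree[OF fm1, of r j] p r by simp_all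
  have xy: "x < n" "y < n" using tree_rep tx ty by auto
  have dis: "pts (imem s1) j x \<inter> pts (imem s1) j y = {}"
    using fam_disjoint[OF fm1, of p j r j] p r pr by simp
  have nx: "imem s1 (A + (i * H + (j * n + x))) < n" "imem s1 (A + (i * H + (j * n + y))) < n" if "i < Q" for i
    using tree_node[OF tx] tree_node[OF ty] tree_pts[OF tx] tree_pts[OF ty] that unfolding node_def by blast+
  have fn1: "f n (Suc j) = 0" using I by (simp add: merge_inv_def)
  have Sj: "Suc j < b" by (rule link_rank[OF tx ty dis])
  show ?thesis
  proof (rule wp_link[OF Par r1(3,4,5) Sj xy nx])
    fix t and s' :: state assume t: "t \<le> 3 + Q * 8" and lk: "linked j x y (imem s1) (rmem s1) (imem s') (rmem s')"
      and fr: "\<forall>k. k \<notin> {17..20} \<longrightarrow> ireg s' k = ireg s1 k"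
    define f' where "f' = upd (upd (upd f p j 0) r j 0) n (Suc j) (Suc x)"
    note fl = fam_link[OF fm1 p r pr(1) fn1 lk, folded f'_def]
    have jH: "j * n + x < H" "Suc j * n + x < H" using rank_index[of j x] rank_index[of "Suc j" x] j Sj xy by auto
    have low: "imem s' k = imem s1 k" if "k < H" for k
    proof -
      have "k \<noteq> H + (j * n + x)" "\<forall>i<Q. k \<noteq> A + (i * H + (Suc j * n + x))" using that by (auto simp: A_def)
      then show ?thesis using lk unfolding linked_def by blast
    qed
    have high: "imem s' k = imem s1 k" if "P \<le> k" for k
    proof -
      have "k \<noteq> H + (j * n + x)" using that jH by (auto simp: P_def A_def)
      moreover have "k \<noteq> A + (i * H + (Suc j * n + x))" if "i < Q" for i
        using proj_index[OF that jH(2)] \<open>P \<le> k\<close> by (simp add: P_def)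
      ultimately show ?thesis using lk unfolding linked_def by blast
    qed
    have lowr: "rmem s' k = rmem s1 k" if "k < A" for k
    proof -
      have "\<forall>i<Q. k \<noteq> A + (i * H + (Suc j * n + x))" using that by auto
      then show ?thesis using lk unfolding linked_def by blast
    qed
    have "merge_inv v s0 f0 a c (Suc j) f' s'"
      unfolding merge_inv_def
    proof (intro conjI allI impI)
      show "Par s'" using Par fr by (simp add: Par_def)
      show "ireg s' 0 = a" "ireg s' 1 = c" using r1 fr by auto
      show "fam v (imem s') (rmem s') f'" by (rule fl)
      show "root (imem s') a' j' = f' a' j'" if "a' < n" "j' < b" for a' j'
        using roots[OF that] low[OF root_index[OF that]] that by (simp add: root_def f'_def upd_def)
      show "f' n (Suc j) = ireg s' 15" using r1 fr by (simp add: f'_def upd_def)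
      show "f' n j' = 0" if "j' \<noteq> Suc j" for j'
        using that fn rn I by (cases "j' = j") (auto simp: f'_def upd_def merge_inv_def)
      show "f' c j' = 0" if "j' < Suc j" for j'
        using that fc I ac by (cases "j' = j") (auto simp: f'_def upd_def merge_inv_def)
      have "(\<Union>x\<in>{a, c, n}. cont (imem s') f' x) = (\<Union>x\<in>{a, c, n}. cont (imem s1) f x)"
        using pr by (intro fl(3)) auto
      then show "(\<Union>x\<in>{a, c, n}. cont (imem s') f' x) = (\<Union>x\<in>{a, c, n}. cont (imem s0) f0 x)"
        using I c1 by (simp add: merge_inv_def)
      show "cont (imem s') f' a' = cont (imem s0) f0 a'" if "a' \<notin> {a, c, n}" for a'
        using fl(4)[of a'] that pr c1 I by (auto simp: merge_inv_def)
      show "base v (rmem s')" using linked_base[OF lk _ Sj xy(1)] I rm by (simp add: merge_inv_def)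
      show "imem s' k = imem s0 k" if "P \<le> k" for k
      proof -
        have "H \<le> k" using that H_le_P by simp
        then show ?thesis using high[OF that] hi I that by (simp add: merge_inv_def)
      qed
      show "rmem s' k = rmem s0 k" if "k < A" for k
        using lowr[OF that] rm I that by (simp add: merge_inv_def)
    qed
    then show "R t s'" using R[OF t] fr r1 by simp
  qed
qed

text \<open>This treats the ranks where the first cluster has no tree and at most one of the carry
  and the second cluster has one: that tree becomes the digit of the sum, and no carry
  remains.\<close>

lemma merge_move:
  assumes I: "merge_inv v s0 f0 a c j f s" and ac: "a < n" "c < n" "a \<noteq> c"
    and regs: "\<forall>k. k \<notin> {15, 16} \<longrightarrow> ireg s' k = ireg s k" "ireg s' 15 = 0"
    and hi: "\<And>k. H \<le> k \<Longrightarrow> imem s' k = imem s k" and rm: "rmem s' = rmem s"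
    and p: "p \<in> {c, n}" "f a j = 0" and oth: "f (if p = c then n else c) j = 0"
    and roots: "\<And>a' j'. a' < n \<Longrightarrow> j' < b \<Longrightarrow> root (imem s') a' j' = upd (upd f p j 0) a j (f p j) a' j'"
  shows "\<exists>f'. merge_inv v s0 f0 a c (Suc j) f' s'"
proof -
  define f' where "f' = upd (upd f p j 0) a j (f p j)"
  have fm: "fam v (imem s) (rmem s) f" using I by (simp add: merge_inv_def)
  have pa: "p \<noteq> a" using p ac by auto
  note mv = fam_move[OF fm p(2) pa, folded f'_def]
  have fm': "fam v (imem s') (rmem s') f'" unfolding rm by (rule fam_low[OF hi mv(1)])
  have c': "cont (imem s') f' z = cont (imem s) f' z" for z by (rule fam_low[OF hi mv(1)])
  have ot: "cont (imem s) f' z = cont (imem s) f z" if "z \<noteq> p" "z \<noteq> a" for z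
    using that by (simp add: f'_def cont_upd_other)
  have "merge_inv v s0 f0 a c (Suc j) f' s'"
    unfolding merge_inv_def
  proof (intro conjI allI impI)
    show "Par s'" using I regs by (simp add: merge_inv_def Par_def)
    show "ireg s' 0 = a" "ireg s' 1 = c" using I regs by (auto simp: merge_inv_def)
    show "fam v (imem s') (rmem s') f'" by fact
    show "root (imem s') a' j' = f' a' j'" if "a' < n" "j' < b" for a' j'
      using roots[OF that] by (simp add: f'_def)
    show "f' n (Suc j) = ireg s' 15" using I regs ac by (simp add: f'_def upd_def merge_inv_def)
    show "f' n j' = 0" if "j' \<noteq> Suc j" for j'
      using that p oth I ac by (cases "j' = j") (auto simp: f'_def upd_def merge_inv_def split: if_splits)
    show "f' c j' = 0" if "j' < Suc j" for j'
      using that p oth I ac by (cases "j' = j") (auto simp: f'_def upd_def merge_inv_def split: if_splits)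
    have "(\<Union>x\<in>{a, c, n}. cont (imem s') f' x) = (\<Union>x\<in>{a, c, n}. cont (imem s) f x)"
      using mv(2) c' ot p ac by auto
    then show "(\<Union>x\<in>{a, c, n}. cont (imem s') f' x) = (\<Union>x\<in>{a, c, n}. cont (imem s0) f0 x)"
      using I by (simp add: merge_inv_def)
    show "cont (imem s') f' a' = cont (imem s0) f0 a'" if "a' \<notin> {a, c, n}" for a'
    proof -
      have "cont (imem s') f' a' = cont (imem s) f a'" using ot[of a'] c' that p by auto
      then show ?thesis using I that by (auto simp: merge_inv_def)
    qed
    show "base v (rmem s')" using I rm by (simp add: merge_inv_def)
    show "imem s' k = imem s0 k" if "P \<le> k" for k
    proof -
      have "H \<le> k" using that H_le_P by simp
      then show ?thesis using hi I that by (simp add: merge_inv_def)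
    qed
    show "rmem s' k = rmem s0 k" if "k < A" for k
      using rm I that by (simp add: merge_inv_def)
  qed
  then show ?thesis by blast
qed

lemma wp_merge_rank:
  assumes I: "merge_inv v s0 f0 a c j f s" and r14: "ireg s 14 = j" and j: "j < b" and ac: "a < n" "c < n" "a \<noteq> c"
    and R: "\<And>t s' f'. t \<le> 14 + Q * 8 \<Longrightarrow> merge_inv v s0 f0 a c (Suc j) f' s' \<Longrightarrow> ireg s' 14 = j \<Longrightarrow> R t s'"
  shows "wp m merge_rank R s"
proof -
  have Par: "Par s" and r0: "ireg s 0 = a" and r1: "ireg s 1 = c" and fm: "fam v (imem s) (rmem s) f"
    and rt: "\<And>a' j'. a' < n \<Longrightarrow> j' < b \<Longrightarrow> root (imem s) a' j' = f a' j'" and r15: "ireg s 15 = f n j"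
    using I by (auto simp: merge_inv_def)
  have ia: "imem s (a * b + j) = f a j" and ic: "imem s (c * b + j) = f c j"
    using rt[OF ac(1) j] rt[OF ac(2) j] by (auto simp: root_def)
  have xa: "a * b + j < H" "c * b + j < H" using root_index ac j by auto
  have ne: "a * b + j \<noteq> c * b + j" using root_index_eq[OF j j, of a c] ac by auto
  have fle: "f z j \<le> n" for z
    using fam_tree[OF fm, of z j] tree_rep[of v "imem s" "rmem s" j "f z j - 1"] by (cases "f z j = 0") auto
  have le: "a * b < m" "c * b < m" "a * b + j < m" "c * b + j < m" "j < m" "a < m" "c < m" "b < m"
    "f a j < m" "f c j < m" "f n j < m" "0 < m"
    using xa bounds ac j fle[of a] fle[of c] fle[of n] by linarith+
  have rup: "root ((imem s)(z * b + j := w)) a' j' = (if a' = z \<and> j' = j then w else f a' j')"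
    "root ((imem s)(z * b + j := w, z' * b + j := w')) a' j' = (if a' = z' \<and> j' = j then w' else if a' = z \<and> j' = j then w else f a' j')"
    "root ((imem s)(z * b + j := w, z' * b + j := w', z'' * b + j := w'')) a' j' =
      (if a' = z'' \<and> j' = j then w'' else if a' = z' \<and> j' = j then w' else if a' = z \<and> j' = j then w else f a' j')"
    if "a' < n" "j' < b" for z w a' j' z' w' z'' w''
    using root_upd[OF j that(2)] rt[OF that] by auto
  note W = wp_merge_link[OF I j ac] and V = merge_move[OF I ac]
  note P0 = Par[unfolded Par_def]
  \<comment> \<open>The cases run through the carry, the digit of the second cluster and the digit
    of the first. In the first and the fourth case the digit of the first cluster stays as it
    is.\<close>
  consider (1) "f n j = 0" "f c j = 0" | (2) "f n j = 0" "f c j \<noteq> 0" "f a j = 0"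
    | (3) "f n j = 0" "f c j \<noteq> 0" "f a j \<noteq> 0" | (4) "f n j \<noteq> 0" "f c j \<noteq> 0"
    | (5) "f n j \<noteq> 0" "f c j = 0" "f a j = 0" | (6) "f n j \<noteq> 0" "f c j = 0" "f a j \<noteq> 0" by blast
  then show ?thesis
  proof cases
    case 1
    let ?f = "s\<lparr>imem := (imem s)(c * b + j := 0), ireg := (ireg s)(16 := 0, 15 := 0)\<rparr>"
    have "merge_inv v s0 f0 a c (Suc j) f ?f"
    proof -
      have e: "(imem s)(c * b + j := 0) = imem s" using ic 1 by (simp add: fun_upd_idem)
      have z: "f n j' = 0" for j' using I 1 by (cases "j' = j") (auto simp: merge_inv_def)
      show ?thesis using I 1 e z unfolding merge_inv_def Par_def
        by (simp add: less_Suc_eq)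
    qed
    from R[OF _ this] show ?thesis unfolding merge_rank_def
      using 1 P0 r0 r1 r14 r15 ia ic le ne by (simp add: wp_simps fun_upd_twist)
  next
    case 2
    have "R t s'" if "t \<le> 14 + Q * 8" "\<forall>k. k \<notin> {15, 16} \<longrightarrow> ireg s' k = ireg s k" "ireg s' 15 = 0" "rmem s' = rmem s"
      "imem s' = (imem s)(c * b + j := 0, a * b + j := f c j)" for t and s' :: state
    proof -
      have "\<exists>f'. merge_inv v s0 f0 a c (Suc j) f' s'"
        by (rule V[where p = c]) (use that 2 xa rup ac in \<open>auto simp: upd_def\<close>)
      then show ?thesis using R[of t _ s'] that r14 by auto
    qed
    then show ?thesis unfolding merge_rank_def
      using 2 P0 r0 r1 r14 r15 ia ic le ne by (simp add: wp_simps)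
  next
    case 3
    then obtain x y where xy: "f c j = Suc x" "f a j = Suc y" by (meson not0_implies_Suc)
    let ?s1 = "s\<lparr>ireg := (ireg s)(15 := Suc x, 16 := Suc y), imem := (imem s)(c * b + j := 0, a * b + j := 0)\<rparr>"
    \<comment> \<open>The slack of 11 absorbs the steps before the link, whose number differs
      between the cases; together with \<open>3 + Q * 8\<close> for the link it gives
      \<open>14 + Q * 8\<close>.\<close>
    have K: "wp m link (\<lambda>t s'. \<forall>u \<le> 11 + t. R u s') ?s1"
      by (rule W[where p = c and r = a and x = x and y = y])
        (use 3 Par P0 r0 r1 r14 xy xa rup ac R in \<open>auto simp: upd_def Par_def\<close>)
    show ?thesis unfolding merge_rank_def
      using xy 3 P0 r0 r1 r14 r15 ia ic le ne by (simp add: wp_simps) (rule wp_mono[OF K], simp)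
  next
    case 4
    then obtain x y where xy: "f n j = Suc x" "f c j = Suc y" by (meson not0_implies_Suc)
    let ?s1 = "s\<lparr>ireg := (ireg s)(16 := Suc y), imem := (imem s)(c * b + j := 0)\<rparr>"
    have K: "wp m link (\<lambda>t s'. \<forall>u \<le> 11 + t. R u s') ?s1"
      by (rule W[where p = n and r = c and x = x and y = y])
        (use 4 Par P0 r0 r1 r14 r15 xy xa rup ac R in \<open>auto simp: upd_def Par_def\<close>)
    show ?thesis unfolding merge_rank_def
      using xy 4 P0 r0 r1 r14 r15 ia ic le ne by (simp add: wp_simps) (rule wp_mono[OF K], simp)
  next
    case 5
    have "R t s'" if "t \<le> 14 + Q * 8" "\<forall>k. k \<notin> {15, 16} \<longrightarrow> ireg s' k = ireg s k" "ireg s' 15 = 0" "rmem s' = rmem s"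
      "imem s' = (imem s)(c * b + j := 0, a * b + j := f n j)" for t and s' :: state
    proof -
      have "\<exists>f'. merge_inv v s0 f0 a c (Suc j) f' s'"
        by (rule V[where p = n]) (use that 5 xa rup ac in \<open>auto simp: upd_def\<close>)
      then show ?thesis using R[of t _ s'] that r14 by auto
    qed
    then show ?thesis unfolding merge_rank_def
      using 5 P0 r0 r1 r14 r15 ia ic le ne by (simp add: wp_simps)
  next
    case 6
    then obtain x y where xy: "f n j = Suc x" "f a j = Suc y" by (meson not0_implies_Suc)
    let ?s1 = "s\<lparr>ireg := (ireg s)(16 := Suc y), imem := (imem s)(c * b + j := 0, a * b + j := 0)\<rparr>"
    have K: "wp m link (\<lambda>t s'. \<forall>u \<le> 11 + t. R u s') ?s1"
      by (rule W[where p = n and r = a and x = x and y = y])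
        (use 6 Par P0 r0 r1 r14 r15 xy xa rup ac R in \<open>auto simp: upd_def Par_def\<close>)
    show ?thesis unfolding merge_rank_def
      using xy 6 P0 r0 r1 r14 r15 ia ic le ne by (simp add: wp_simps) (rule wp_mono[OF K], simp)
  qed
qed

end

section \<open>The invariant of the data structure\<close>

context sizes
begin

definition merge_time :: nat where "merge_time = 3 + b * (16 + Q * 8)"

lemma wp_merge_prog:
  assumes Par: "Par s" and regs: "ireg s 0 = a" "ireg s 1 = c" and ac: "a < n" "c < n" "a \<noteq> c"
    and fm: "fam v (imem s) (rmem s) f" and rt: "\<And>a' j'. a' < n \<Longrightarrow> j' < b \<Longrightarrow> root (imem s) a' j' = f a' j'"
    and fn: "\<And>j. f n j = 0" and base: "base v (rmem s)"
    and R: "\<And>t s' f'. t \<le> merge_time \<Longrightarrow> Par s' \<Longrightarrow> ireg s' 0 = a \<Longrightarrow> fam v (imem s') (rmem s') f' \<Longrightarrow>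
      (\<And>a' j'. a' < n \<Longrightarrow> j' < b \<Longrightarrow> root (imem s') a' j' = f' a' j') \<Longrightarrow> (\<And>j. f' n j = 0) \<Longrightarrow>
      cont (imem s') f' a = cont (imem s) f a \<union> cont (imem s) f c \<Longrightarrow>
      (\<And>a'. a' < n \<Longrightarrow> a' \<noteq> a \<Longrightarrow> a' \<noteq> c \<Longrightarrow> cont (imem s') f' a' = cont (imem s) f a') \<Longrightarrow>
      base v (rmem s') \<Longrightarrow> (\<And>k. P \<le> k \<Longrightarrow> imem s' k = imem s k) \<Longrightarrow>
      (\<And>k. k < A \<Longrightarrow> rmem s' k = rmem s k) \<Longrightarrow> R t s'"
  shows "wp m merge_prog R s"
proof -
  let ?s0 = "s\<lparr>ireg := (ireg s)(14 := 0, 15 := 0)\<rparr>"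
  define I where "I = (\<lambda>j s'. ireg s' 14 = j \<and> (\<exists>f'. merge_inv v s f a c j f' s'))"
  have "wp m (While (ILess (IReg 14) vB) (merge_rank;; incr 14)) (\<lambda>t s'. R (Suc (Suc t)) s') ?s0"
  proof (rule wp_for[where N = b and \<tau> = "15 + Q * 8" and I = I], goal_cases)
    case 1
    have "merge_inv v s f a c 0 f ?s0"
      using Par regs fm rt fn base unfolding merge_inv_def Par_def by simp
    then show ?case unfolding I_def by auto
  next
    case (2 j s')
    then obtain f' where r: "ireg s' 14 = j" and I: "merge_inv v s f a c j f' s'" by (auto simp: I_def)
    have P': "Par s'" using I by (simp add: merge_inv_def)
    have jm: "j < m" "Suc j < m" using 2(1) bounds by auto
    have "wp m merge_rank (\<lambda>t s''. wp m (incr 14) (\<lambda>t' s3. t + t' \<le> 15 + Q * 8 \<and> I (Suc j) s3) s'') s'"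
    proof (rule wp_merge_rank[OF I r 2(1) ac])
      fix t s'' f'' assume h: "t \<le> 14 + Q * 8" "merge_inv v s f a c (Suc j) f'' s''" "ireg s'' 14 = j"
      have "merge_inv v s f a c (Suc j) f'' (s''\<lparr>ireg := (ireg s'')(14 := Suc j)\<rparr>)"
        using h(2) unfolding merge_inv_def Par_def by simp
      then have "I (Suc j) (s''\<lparr>ireg := (ireg s'')(14 := Suc j)\<rparr>)" unfolding I_def by auto
      then show "wp m (incr 14) (\<lambda>t' s3. t + t' \<le> 15 + Q * 8 \<and> I (Suc j) s3) s''"
        using h jm bounds by (simp add: wp_simps)
    qed
    then show ?case using P' r jm 2(1) bounds by (simp add: wp_Seq Par_def)
  next
    case (3 s')
    have "Par s'" using 3 by (auto simp: I_def merge_inv_def)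
    then show ?case using 3 bounds by (simp add: I_def Par_def)
  next
    case (4 t s')
    then obtain f' where I: "merge_inv v s f a c b f' s'" by (auto simp: I_def)
    have fm': "fam v (imem s') (rmem s') f'" using I by (simp add: merge_inv_def)
    \<comment> \<open>All trees have rank below \<open>b\<close>, so nothing is left in the carry
      after the last rank, and the second cluster is empty.\<close>
    have big: "f' z j = 0" if "b \<le> j" for z j
      using tree_rank fam_tree[OF fm', of z j] that by (metis not_le)
    have n0: "f' n j = 0" for j using I big[of j n] by (cases "j = b") (auto simp: merge_inv_def)
    have c0: "f' c j = 0" for j using I big[of j c] by (cases "j < b") (auto simp: merge_inv_def)
    have e: "cont (imem s') f' n = {}" "cont (imem s') f' c = {}" "cont (imem s) f n = {}"
      using n0 c0 fn by (auto simp: cont_def)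
    have u: "(\<Union>x\<in>{a, c, n}. cont (imem s') f' x) = (\<Union>x\<in>{a, c, n}. cont (imem s) f x)"
      using I by (simp add: merge_inv_def)
    show ?case
    proof (rule R[where f' = f'])
      show "Suc (Suc t) \<le> merge_time" using 4(1) by (simp add: merge_time_def)
      show "cont (imem s') f' a = cont (imem s) f a \<union> cont (imem s) f c" using u e by simp
    qed (use I n0 in \<open>auto simp: merge_inv_def\<close>)
  qed
  then show ?thesis unfolding merge_prog_def using bounds by (simp add: wp_simps)
qed

end

text \<open>\<open>\<omega>\<close> is one fixed outcome of all coins: up to the probabilistic part
  every statement holds for each outcome. \<open>e_upper\<close> makes \<open>e\<close> minimal, so
  that the loop computing \<open>W\<close> stops there.\<close>

locale afn = sizes +
  fixes \<alpha> :: real and xs :: "point list" and \<omega> :: "nat \<Rightarrow> real" and e :: nat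
  assumes len: "length xs = n" and dist: "distinct xs" and dims: "\<forall>p\<in>set xs. length p = d"
    and \<alpha>: "1 < \<alpha>" and W_eq: "W = 2 ^ e" and e_lower: "real b \<le> real e * \<alpha>\<^sup>2"
    and e_upper: "\<And>k. k < e \<Longrightarrow> real k * \<alpha>\<^sup>2 < real b"
begin

definition proj :: "nat \<Rightarrow> nat \<Rightarrow> real" where
  "proj i x = (\<Sum>j<d. \<omega> (i * d + j) * xs ! x ! j)"

definition pos :: "point set \<Rightarrow> nat set" where "pos S = {i. i < n \<and> xs ! i \<in> S}"

definition is_partition :: "point set set \<Rightarrow> bool" where
  "is_partition \<P> \<longleftrightarrow> (\<forall>S\<in>\<P>. S \<subseteq> set xs \<and> S \<noteq> {}) \<and> (\<forall>S\<in>\<P>. \<forall>S'\<in>\<P>. S \<noteq> S' \<longrightarrow> S \<inter> S' = {})"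

definition stored :: "(nat \<Rightarrow> real) \<Rightarrow> bool" where
  "stored rm \<longleftrightarrow> (\<forall>i<n. \<forall>j<d. rm (i * d + j) = xs ! i ! j)"

text \<open>Injectivity of \<open>h\<close> on the current partition is what allows a merge to reuse
  the handle of its first argument. \<open>codes\<close> is included because the queue is not
  cleared between queries.\<close>

definition ds_inv :: "point set set \<Rightarrow> state \<times> handles \<Rightarrow> bool" where
  "ds_inv \<P> c \<longleftrightarrow> (case c of (s, h) \<Rightarrow> Par s \<and> codes s \<and> base proj (rmem s) \<and> stored (rmem s) \<and> is_partition \<P> \<and>
     (\<exists>f. fam proj (imem s) (rmem s) f \<and> (\<forall>a<n. \<forall>j<b. root (imem s) a j = f a j) \<and> (\<forall>j. f n j = 0) \<and>
       (\<forall>S\<in>\<P>. h S < n \<and> cont (imem s) f (h S) = pos S) \<and> inj_on h \<P>))"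

lemma fam_forest:
  assumes "fam v im rm f" "\<forall>a<n. \<forall>j<b. root im a j = f a j" "a < n"
  shows "forest v im rm a (cont im f a)"
proof -
  have "{j. f a j \<noteq> 0} = {j. j < b \<and> root im a j \<noteq> 0}"
    using assms(2,3) tree_rank[OF fam_tree[OF assms(1)], of a] by auto
  then have "cont im f a = (\<Union>j\<in>{j. j < b \<and> root im a j \<noteq> 0}. pts im j (root im a j - 1))"
    unfolding cont_def using assms(2,3) by (intro SUP_cong) auto
  then show ?thesis unfolding forest_def
    using assms fam_tree[OF assms(1)] fam_disjoint[OF assms(1)] by auto
qed

lemma pos_nonempty: "S \<subseteq> set xs \<Longrightarrow> S \<noteq> {} \<Longrightarrow> pos S \<noteq> {}"
  unfolding pos_def using len by (auto simp: in_set_conv_nth subset_iff)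

lemma position_less: "q \<in> set xs \<Longrightarrow> position xs q < n \<and> xs ! position xs q = q"
proof -
  assume "q \<in> set xs"
  then obtain i where i: "i < length xs" "xs ! i = q" by (auto simp: in_set_conv_nth)
  have "position xs q = i" unfolding position_def
    by (rule the_equality) (use i dist in \<open>auto simp: nth_eq_iff_index_eq\<close>)
  then show ?thesis using i len by simp
qed

lemma dist2_l2:
  assumes "stored rm" "i < n" "j < n"
  shows "dist2 rm i j = (l2 (xs ! j) (xs ! i))\<^sup>2"
proof -
  have "length (xs ! j) = d" using dims len assms(3) by auto
  then have "(l2 (xs ! j) (xs ! i))\<^sup>2 = (\<Sum>k<d. (xs ! j ! k - xs ! i ! k)\<^sup>2)"
    by (simp add: l2_def L2_set_def sum_nonneg)
  also have "\<dots> = dist2 rm i j"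
    unfolding dist2_def using assms by (intro sum.cong) (auto simp: stored_def power2_commute)
  finally show ?thesis by simp
qed

text \<open>No probability is involved yet: whenever some group is good for a set \<open>B\<close>,
  the answer is at least as far from \<open>q\<close> as some point outside
  \<open>B\<close>.\<close>

lemma query_step:
  assumes "ds_inv \<P> (s, h)" "S \<in> \<P>" "q \<in> set xs"
  shows "\<exists>t s'. op_step m afn_structure xs (s, h) (Query S q) t (s', h) \<and> t \<le> query_time \<and> ds_inv \<P> (s', h) \<and>
    ireg s' 0 \<in> pos S \<and>
    (\<forall>g<3 * b. \<forall>B \<Delta> y. good_group proj (pos S) (position xs q) B \<Delta> y g \<longrightarrow> y \<in> pos S - B \<longrightarrow>
       (\<exists>w\<in>pos S - B. l2 q (xs ! w) \<le> l2 q (xs ! ireg s' 0)))"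
proof -
  obtain f where Par: "Par s" and cd: "codes s" and ba: "base proj (rmem s)" and st: "stored (rmem s)"
    and pt: "is_partition \<P>" and fm: "fam proj (imem s) (rmem s) f" and rt: "\<forall>a<n. \<forall>j<b. root (imem s) a j = f a j"
    and fn: "\<forall>j. f n j = 0" and hs: "\<forall>S\<in>\<P>. h S < n \<and> cont (imem s) f (h S) = pos S" and inj: "inj_on h \<P>"
    using assms(1) unfolding ds_inv_def by auto
  define q' where "q' = position xs q"
  have q': "q' < n" "xs ! q' = q" using position_less assms(3) by (auto simp: q'_def)
  have hS: "h S < n" "cont (imem s) f (h S) = pos S" using hs assms(2) by auto
  have F: "forest proj (imem s) (rmem s) (h S) (pos S)" using fam_forest[OF fm rt hS(1)] hS by simp
  have ne: "pos S \<noteq> {}" using pt assms(2) pos_nonempty by (auto simp: is_partition_def)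
  let ?s = "with_args (h S) q' s"
  have "wp m query_prog (\<lambda>t s'. t \<le> query_time \<and> ds_inv \<P> (s', h) \<and> ireg s' 0 \<in> pos S \<and>
    (\<forall>g<3 * b. \<forall>B \<Delta> y. good_group proj (pos S) q' B \<Delta> y g \<longrightarrow> y \<in> pos S - B \<longrightarrow>
       (\<exists>w\<in>pos S - B. l2 q (xs ! w) \<le> l2 q (xs ! ireg s' 0)))) ?s"
  proof (rule wp_query_prog[where a = "h S" and q = q' and v = proj and C = "pos S"], goal_cases)
    case (10 t s')
    have im: "imem s' k = imem s k" if "k < P" for k using 10(2) that by (simp add: frame_def with_args_def)
    have rm: "rmem s' = rmem s" using 10(2) by (simp add: frame_def with_args_def)
    have P': "Par s'"
    proof -
      have "ireg s' x = ireg s x" if "2 \<le> x" "x < 14" for x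
        using 10(2) that unfolding frame_def by (auto simp: with_args_def)
      then show ?thesis using Par unfolding Par_def by simp
    qed
    have tf: "tree proj (imem s') (rmem s) j (f a j - 1) \<and> pts (imem s') j (f a j - 1) = pts (imem s) j (f a j - 1)"
      if "f a j \<noteq> 0" for a j
      using tree_frame[OF im fam_tree[OF fm that]] by simp
    have fm': "fam proj (imem s') (rmem s') f"
      unfolding fam_def rm using tf fam_disjoint[OF fm] by auto
    have "cont (imem s') f a = cont (imem s) f a" for a using tf by (auto simp: cont_def)
    moreover have "\<forall>a<n. \<forall>j<b. root (imem s') a j = f a j"
      using rt im less_le_trans[OF root_index H_le_P] by (simp add: root_def)
    ultimately have "ds_inv \<P> (s', h)"
      unfolding ds_inv_def using P' 10(3) ba st pt fm' fn hs inj rm by auto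
    moreover have "\<exists>w\<in>pos S - B. l2 q (xs ! w) \<le> l2 q (xs ! ireg s' 0)"
      if hyp: "g < 3 * b" "good_group proj (pos S) q' B \<Delta> y g" "y \<in> pos S - B" for g B \<Delta> y
    proof -
      obtain w where w: "w \<in> pos S - B" "dist2 (rmem s) w q' \<le> dist2 (rmem s) (ireg s' 0) q'"
        using 10(5)[OF hyp] by (auto simp: with_args_def)
      have "w < n" "ireg s' 0 < n" using w 10(4) by (auto simp: pos_def)
      then have "(l2 q (xs ! w))\<^sup>2 \<le> (l2 q (xs ! ireg s' 0))\<^sup>2"
        using w(2) dist2_l2[OF st] q' by simp
      then have "l2 q (xs ! w) \<le> l2 q (xs ! ireg s' 0)"
        by (rule power2_le_imp_le) (simp add: l2_def)
      then show ?thesis using w(1) by blast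
    qed
    ultimately show ?case using 10(1,4) by blast
  qed (use Par hS q' cd F ne ba in \<open>auto simp: with_args_def Par_def codes_def\<close>)
  then obtain t s' where bs: "big_step m query_prog ?s t s'" and
    res: "t \<le> query_time \<and> ds_inv \<P> (s', h) \<and> ireg s' 0 \<in> pos S \<and>
    (\<forall>g<3 * b. \<forall>B \<Delta> y. good_group proj (pos S) q' B \<Delta> y g \<longrightarrow> y \<in> pos S - B \<longrightarrow>
       (\<exists>w\<in>pos S - B. l2 q (xs ! w) \<le> l2 q (xs ! ireg s' 0)))"
    unfolding wp_def by blast
  have "op_step m afn_structure xs (s, h) (Query S q) t (s', h)"
    by (rule op_step.Query) (use bs in \<open>simp add: afn_structure_def q'_def\<close>)
  then show ?thesis using res unfolding q'_def by blast
qed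

lemma merge_step:
  assumes "ds_inv \<P> (s, h)" "S \<in> \<P>" "S' \<in> \<P>" "S \<noteq> S'"
  shows "\<exists>t s'. op_step m afn_structure xs (s, h) (Merge S S') t (s', h(S \<union> S' := ireg s' 0)) \<and> t \<le> merge_time \<and>
     ds_inv (insert (S \<union> S') (\<P> - {S, S'})) (s', h(S \<union> S' := ireg s' 0))"
proof -
  obtain f where Par: "Par s" and cd: "codes s" and ba: "base proj (rmem s)" and st: "stored (rmem s)"
    and pt: "is_partition \<P>" and fm: "fam proj (imem s) (rmem s) f" and rt: "\<forall>a<n. \<forall>j<b. root (imem s) a j = f a j"
    and fn: "\<forall>j. f n j = 0" and hs: "\<forall>S\<in>\<P>. h S < n \<and> cont (imem s) f (h S) = pos S" and inj: "inj_on h \<P>"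
    using assms(1) unfolding ds_inv_def by auto
  have ne: "h S \<noteq> h S'" using inj assms by (auto dest: inj_onD)
  let ?s = "with_args (h S) (h S') s"
  let ?P = "insert (S \<union> S') (\<P> - {S, S'})"
  have "wp m merge_prog (\<lambda>t s'. t \<le> merge_time \<and> ds_inv ?P (s', h(S \<union> S' := ireg s' 0))) ?s"
  proof (rule wp_merge_prog[where a = "h S" and c = "h S'" and v = proj and f = f], goal_cases)
    case (11 t s' f')
    let ?h = "h(S \<union> S' := ireg s' 0)"
    have cd': "codes s'" using cd 11(10) by (simp add: codes_def with_args_def)
    have st': "stored (rmem s')"
    proof -
      have "n * d \<le> A" by (simp add: A_def)
      then have "rmem s' (i * d + j) = rmem s (i * d + j)" if "i < n" "j < d" for i j
        using 11(11)[of "i * d + j"] coord_index[OF that] by (simp add: with_args_def)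
      then show ?thesis using st by (simp add: stored_def)
    qed
    \<comment> \<open>Clusters are nonempty and disjoint, so no remaining cluster equals the union,
      and its handle survives the update of \<open>h\<close>.\<close>
    have old: "T \<noteq> S \<union> S' \<and> h T \<noteq> h S \<and> h T \<noteq> h S'" if "T \<in> \<P> - {S, S'}" for T
    proof -
      have "T \<inter> S = {}" "T \<noteq> {}" "S \<noteq> {}" using pt that assms unfolding is_partition_def by auto
      moreover have "h T \<noteq> h S" "h T \<noteq> h S'" using inj assms that by (auto dest: inj_onD)
      ultimately show ?thesis by blast
    qed
    have "is_partition ?P" using pt assms unfolding is_partition_def
      by (simp add: Int_Un_distrib Int_Un_distrib2) blast
    moreover have "?h T < n \<and> cont (imem s') f' (?h T) = pos T" if "T \<in> ?P" for T
    proof (cases "T = S \<union> S'")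
      case True
      then show ?thesis using 11(3,7) hs assms by (auto simp: pos_def with_args_def)
    next
      case False
      then have T: "T \<in> \<P> - {S, S'}" using that by auto
      then show ?thesis using 11(8)[of "h T"] old[OF T] hs False by (auto simp: with_args_def)
    qed
    moreover have "inj_on ?h ?P"
    proof (rule inj_onI)
      fix T T' assume TT: "T \<in> ?P" "T' \<in> ?P" "?h T = ?h T'"
      have "T = T'" if "T \<in> \<P>" "T' \<in> \<P>" "h T = h T'" using inj that by (auto dest: inj_onD)
      moreover have "?h X \<noteq> ?h (S \<union> S')" if "X \<in> ?P" "X \<noteq> S \<union> S'" for X
        using that old[of X] 11(3) by auto
      ultimately show "T = T'"
        using TT by (cases "T = S \<union> S'"; cases "T' = S \<union> S'") (metis Diff_iff fun_upd_other insert_iff)+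
    qed
    ultimately have "is_partition ?P \<and> (\<forall>T\<in>?P. ?h T < n \<and> cont (imem s') f' (?h T) = pos T) \<and> inj_on ?h ?P"
      by blast
    then have "ds_inv ?P (s', ?h)"
      unfolding ds_inv_def prod.case using 11(2,4,5,6,9) cd' st'
      by (intro conjI exI[of _ f']) blast+
    then show ?case using 11(1) by blast
  qed (use Par hs assms ne fm rt fn ba in \<open>auto simp: with_args_def Par_def\<close>)
  then obtain t s' where bs: "big_step m merge_prog ?s t s'" and
    res: "t \<le> merge_time" "ds_inv ?P (s', h(S \<union> S' := ireg s' 0))"
    unfolding wp_def by blast
  have "op_step m afn_structure xs (s, h) (Merge S S') t (s', h(S \<union> S' := ireg s' 0))"
    by (rule op_step.Merge) (use bs in \<open>simp add: afn_structure_def\<close>)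
  then show ?thesis using res by blast
qed

end

section \<open>Initialization\<close>

context afn
begin

lemma e_le: "e \<le> b"
proof -
  have "(2::nat) ^ e \<le> 2 ^ b" using W_upper W_eq by simp
  then show ?thesis by simp
qed

lemma two_b_less: "2 ^ b < m" using mem by linarith

text \<open>The counters stop exactly at \<open>b\<close> and \<open>e\<close>, since
  \<open>b\<close> is the bit length of \<open>n\<close> and \<open>e\<close> is minimal. The powers
  of two formed on the way are at most \<open>2 ^ b < m\<close>, hence words.\<close>

lemma wp_init_sizes:
  assumes regs: "ireg s 0 = n" "ireg s 1 = d" "rreg s 0 = \<alpha>"
    and R: "\<And>t s'. t \<le> 18 + 6 * b \<Longrightarrow> Par s' \<Longrightarrow> imem s' = imem s \<Longrightarrow> rmem s' = rmem s \<Longrightarrow>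
      coins s' = coins s \<Longrightarrow> used s' = used s \<Longrightarrow> R t s'"
  shows "wp m init_sizes R s"
proof -
  define rest where "rest = (ISet 6 (IMul (IConst 64) (IMul vB vW));;
     ISet 7 (IMul (IConst 3) vB);;
     ISet 8 (IMul vB vN);;
     ISet 9 (IAdd (IMul (IConst 2) vH) (IMul vN vD));;
     ISet 13 (IMul vG vL);;
     ISet 10 (IAdd vA (IMul vQ vH));;
     ISet 11 (IMul (IConst 5) (IMul vL vB));;
     ISet 12 (IMul (IConst 4) (IMul vL vB)))"
  let ?same = "\<lambda>s' :: state. imem s' = imem s \<and> rmem s' = rmem s \<and> coins s' = coins s \<and> used s' = used s \<and> rreg s' 0 = \<alpha>"
  define I where "I = (\<lambda>k s'. ?same s' \<and> ireg s' 2 = n \<and> ireg s' 3 = d \<and> ireg s' 4 = k \<and> ireg s' 14 = 2 ^ k)"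
  define J where "J = (\<lambda>k s'. ?same s' \<and> ireg s' 2 = n \<and> ireg s' 3 = d \<and> ireg s' 4 = b \<and> ireg s' 5 = 2 ^ k \<and> ireg s' 14 = k)"
  let ?s0 = "s\<lparr>ireg := (ireg s)(2 := n, 3 := d, 4 := 0, 14 := 1)\<rparr>"
  have small: "2 < m" "1 < m" "64 < m" "5 < m" "4 < m" "3 < m" using bounds(14) by auto
  have "wp m (While (BNot (ILess vN (IReg 14))) (ISet 14 (IMul (IReg 14) (IConst 2));; incr 4);;
     ISet 5 (IConst 1);; ISet 14 (IConst 0);;
     While (RLess (RMul (ROfInt (IReg 14)) (RMul (RReg 0) (RReg 0))) (ROfInt vB))
       (ISet 5 (IMul vW (IConst 2));; incr 14);; rest) (\<lambda>t s'. R (Suc (Suc (Suc (Suc t)))) s') ?s0"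
  proof (rule wp_SeqI[where P = "\<lambda>t s'. t \<le> 1 + b * 3 \<and> I b s'"], goal_cases)
    case 1
    show ?case
    proof (rule wp_for[where N = b and \<tau> = 2 and I = I], goal_cases)
      case 1
      show ?case using regs by (simp add: I_def)
    next
      case (2 k s')
      have "(2::nat) ^ k \<le> 2 ^ (b - 1)" using 2(1) by (intro power_increasing) auto
      then have kn: "2 ^ k \<le> n" using n_lower by (rule order_trans)
      have "(2::nat) ^ Suc k \<le> 2 ^ b" using 2(1) by (intro power_increasing) auto
      then have "2 ^ k * 2 < m" using two_b_less by (simp add: mult.commute)
      then show ?case using 2 kn small bounds by (simp add: I_def wp_simps)
    next
      case (3 s')
      then show ?case using n_upper bounds two_b_less by (simp add: I_def)
    next
      case (4 t s')
      then show ?case by simp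
    qed
  next
    case (2 t1 s1)
    note h1 = 2
    let ?s1 = "s1\<lparr>ireg := (ireg s1)(5 := 1, 14 := 0)\<rparr>"
    have "wp m (While (RLess (RMul (ROfInt (IReg 14)) (RMul (RReg 0) (RReg 0))) (ROfInt vB))
       (ISet 5 (IMul vW (IConst 2));; incr 14);; rest) (\<lambda>t s'. R (Suc (Suc (Suc (Suc (t1 + Suc (Suc t)))))) s') ?s1"
    proof (rule wp_SeqI[where P = "\<lambda>t s'. t \<le> 1 + e * 3 \<and> J e s'"], goal_cases)
      case 1
      show ?case
      proof (rule wp_for[where N = e and \<tau> = 2 and I = J], goal_cases)
        case 1
        show ?case using h1 by (simp add: I_def J_def)
      next
        case (2 k s')
        have "(2::nat) ^ Suc k \<le> 2 ^ b" using 2(1) e_le by (intro power_increasing) auto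
        then have k2: "2 ^ k * 2 < m" "2 ^ k < m" using two_b_less by (auto simp: mult.commute)
        have "k < b" using 2(1) e_le by simp
        then have km: "k < m" "Suc k < m" using bounds by auto
        have "real k * (\<alpha> * \<alpha>) < real b" using e_upper[OF 2(1)] by (simp add: power2_eq_square)
        then show ?case using 2 k2 km small bounds by (simp add: J_def wp_simps)
      next
        case (3 s')
        have "e < m" using e_le bounds by simp
        then show ?case using 3 e_lower bounds by (simp add: J_def power2_eq_square)
      next
        case (4 t s')
        then show ?case by simp
      qed
    next
      case (2 t2 s2)
      have W5: "ireg s2 5 = W" using 2 W_eq by (simp add: J_def)
      have r2: "ireg s2 2 = n" "ireg s2 3 = d" "ireg s2 4 = b" and same: "?same s2" using 2 by (auto simp: J_def)
      have E: "64 * (b * W) = L" "b * n = H" "2 * H + n * d = A" "3 * b * L = Q" "A + Q * H = P" "5 * (L * b) = Z" "4 * (L * b) = M"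
        by (auto simp: L_def H_def A_def Q_def P_def Z_def M_def)
      have le: "b * W < m" "W < m" "n * d < m" "2 * H < m"
        using bounds E(1,3) two_b_less W_upper by linarith+
      define s3 where "s3 = s2\<lparr>ireg := (ireg s2)(6 := L, 7 := 3 * b, 8 := H, 9 := A, 13 := Q, 10 := P, 11 := Z, 12 := M)\<rparr>"
      have RR: "R t s3" if "t \<le> 18 + 6 * b" for t
        by (rule R[OF that]) (use r2 same in \<open>auto simp: Par_def s3_def\<close>)
      show ?case unfolding rest_def using le W5 r2 small bounds E
        by (simp add: wp_simps) (rule RR[unfolded s3_def], use h1 2 e_le in simp)
    qed
    then show ?case using small by (simp add: wp_simps)
  qed
  then show ?thesis unfolding init_sizes_def rest_def[symmetric] using regs small bounds by (simp add: wp_simps)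
qed

lemma wp_init_forest:
  assumes Par: "Par s"
    and R: "\<And>t s'. t \<le> 2 + n * 3 \<Longrightarrow> Par s' \<Longrightarrow> rmem s' = rmem s \<Longrightarrow> coins s' = coins s \<Longrightarrow> used s' = used s \<Longrightarrow>
      (\<forall>a<n. imem s' (a * b) = Suc a) \<Longrightarrow> (\<forall>k. (\<forall>a<n. k \<noteq> a * b) \<longrightarrow> imem s' k = imem s k) \<Longrightarrow> R t s'"
  shows "wp m init_forest R s"
proof -
  define I where "I = (\<lambda>i s'. Par s' \<and> rmem s' = rmem s \<and> coins s' = coins s \<and> used s' = used s \<and> ireg s' 14 = i \<and>
      (\<forall>a<i. imem s' (a * b) = Suc a) \<and> (\<forall>k. (\<forall>a<i. k \<noteq> a * b) \<longrightarrow> imem s' k = imem s k))"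
  let ?s0 = "s\<lparr>ireg := (ireg s)(14 := 0)\<rparr>"
  have "wp m (While (ILess (IReg 14) vN)
       (IStore (IMul (IReg 14) vB) (IAdd (IReg 14) (IConst 1));; incr 14)) (\<lambda>t s'. R (Suc t) s') ?s0"
  proof (rule wp_for[where N = n and \<tau> = 2 and I = I], goal_cases)
    case 1
    show ?case using Par by (simp add: I_def Par_def)
  next
    case (2 i s')
    have ib: "i * b < m" using root_index[OF 2(1) b_pos] bounds by simp
    have ne: "a * b \<noteq> i * b" if "a < i" for a using that b_pos by simp
    have im: "i < m" "Suc i < m" using 2(1) bounds by auto
    let ?f = "s'\<lparr>imem := (imem s')(i * b := Suc i), ireg := (ireg s')(14 := Suc i)\<rparr>"
    have "I (Suc i) ?f" using 2(2) ne unfolding I_def by (auto simp: less_Suc_eq Par_def)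
    then show ?case using 2 ib im bounds unfolding I_def Par_def by (simp add: wp_simps)
  next
    case (3 s')
    then show ?case using bounds by (simp add: I_def Par_def)
  next
    case (4 t s')
    then show ?case by (intro R) (auto simp: I_def)
  qed
  then show ?thesis unfolding init_forest_def using bounds by (simp add: wp_simps)
qed

lemma slot_less: "i < Q \<Longrightarrow> x < n \<Longrightarrow> A + (i * H + x) < m"
  using proj_index[of i x] n_le_H bounds(8) by (simp add: P_def)

lemma slot_eq: "x < n \<Longrightarrow> x' < n \<Longrightarrow> A + (i * H + x) = A + (i' * H + x') \<longleftrightarrow> i = i' \<and> x = x'"
  using rank_index_eq[of 0 x 0 x' i i'] b_pos by simp

lemma wp_init_winners:
  assumes Par: "Par s" and r15: "ireg s 15 = A + i * H" and i: "i < Q"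
    and R: "\<And>t s'. t \<le> 2 + n * 3 \<Longrightarrow> Par s' \<Longrightarrow> rmem s' = rmem s \<Longrightarrow> coins s' = coins s \<Longrightarrow> used s' = used s \<Longrightarrow>
      (\<forall>k. k \<noteq> 16 \<longrightarrow> ireg s' k = ireg s k) \<Longrightarrow>
      (\<forall>x<n. imem s' (A + (i * H + x)) = x) \<Longrightarrow>
      (\<forall>k. (\<forall>x<n. k \<noteq> A + (i * H + x)) \<longrightarrow> imem s' k = imem s k) \<Longrightarrow> R t s'"
  shows "wp m init_winners R s"
proof -
  define I where "I = (\<lambda>y s'. Par s' \<and> rmem s' = rmem s \<and> coins s' = coins s \<and> used s' = used s \<and> ireg s' 16 = y \<and>
      (\<forall>k. k \<noteq> 16 \<longrightarrow> ireg s' k = ireg s k) \<and> (\<forall>x<y. imem s' (A + (i * H + x)) = x) \<and>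
      (\<forall>k. (\<forall>x<y. k \<noteq> A + (i * H + x)) \<longrightarrow> imem s' k = imem s k))"
  let ?s0 = "s\<lparr>ireg := (ireg s)(16 := 0)\<rparr>"
  have "wp m (While (ILess (IReg 16) vN)
       (IStore (IAdd (IReg 15) (IReg 16)) (IReg 16);; incr 16)) (\<lambda>t s'. R (Suc t) s') ?s0"
  proof (rule wp_for[where N = n and \<tau> = 2 and I = I], goal_cases)
    case 1
    show ?case using Par by (simp add: I_def Par_def)
  next
    case (2 y s')
    have le: "A + i * H + y < m" "A + i * H < m" "y < m" "Suc y < m"
      using slot_less[OF i 2(1)] 2(1) bounds by auto
    let ?f = "s'\<lparr>imem := (imem s')(A + i * H + y := y), ireg := (ireg s')(16 := Suc y)\<rparr>"
    have "I (Suc y) ?f" using 2(2) unfolding I_def by (auto simp: less_Suc_eq Par_def add.assoc)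
    then show ?case using 2 le r15 bounds unfolding I_def Par_def by (simp add: wp_simps)
  next
    case (3 s')
    then show ?case using bounds by (simp add: I_def Par_def)
  next
    case (4 t s')
    then show ?case by (intro R) (auto simp: I_def)
  qed
  then show ?thesis unfolding init_winners_def using bounds by (simp add: wp_simps)
qed

lemma wp_init_coordinate:
  assumes Par: "Par s" and r15: "ireg s 15 = A + i * H" and i: "i < Q" and r17: "ireg s 17 = j" and j: "j < d"
    and R: "\<And>t s'. t \<le> 3 + n * 3 \<Longrightarrow> Par s' \<Longrightarrow> imem s' = imem s \<Longrightarrow> coins s' = coins s \<Longrightarrow> used s' = Suc (used s) \<Longrightarrow>
      (\<forall>k. k \<noteq> 16 \<longrightarrow> ireg s' k = ireg s k) \<Longrightarrow>
      (\<forall>x<n. rmem s' (A + (i * H + x)) = rmem s (A + (i * H + x)) + coins s (used s) * rmem s (x * d + j)) \<Longrightarrow>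
      (\<forall>k. (\<forall>x<n. k \<noteq> A + (i * H + x)) \<longrightarrow> rmem s' k = rmem s k) \<Longrightarrow> R t s'"
  shows "wp m init_coordinate R s"
proof -
  define I where "I = (\<lambda>y s'. Par s' \<and> imem s' = imem s \<and> coins s' = coins s \<and> used s' = Suc (used s) \<and> ireg s' 16 = y \<and>
      rreg s' 1 = coins s (used s) \<and> (\<forall>k. k \<noteq> 16 \<longrightarrow> ireg s' k = ireg s k) \<and>
      (\<forall>x<y. rmem s' (A + (i * H + x)) = rmem s (A + (i * H + x)) + coins s (used s) * rmem s (x * d + j)) \<and>
      (\<forall>k. (\<forall>x<y. k \<noteq> A + (i * H + x)) \<longrightarrow> rmem s' k = rmem s k))"
  let ?s0 = "s\<lparr>rreg := (rreg s)(1 := coins s (used s)), used := Suc (used s), ireg := (ireg s)(16 := 0)\<rparr>"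
  have "wp m (While (ILess (IReg 16) vN)
       (RStore (IAdd (IReg 15) (IReg 16))
          (RAdd (RLoad (IAdd (IReg 15) (IReg 16)))
            (RMul (RReg 1) (RLoad (IAdd (IMul (IReg 16) vD) (IReg 17)))));;
        incr 16)) (\<lambda>t s'. R (Suc (Suc t)) s') ?s0"
  proof (rule wp_for[where N = n and \<tau> = 2 and I = I], goal_cases)
    case 1
    show ?case using Par by (simp add: I_def Par_def)
  next
    case (2 y s')
    have yj: "y * d + j < n * d" using coord_index 2(1) j by simp
    have ndA: "n * d \<le> A" by (simp add: A_def)
    have le: "A + i * H + y < m" "A + i * H < m" "y < m" "Suc y < m" "y * d < m" "y * d + j < m" "d < m" "j < m"
      using slot_less[OF i 2(1)] 2(1) bounds yj ndA j by auto
    have o: "rmem s' (A + i * H + y) = rmem s (A + (i * H + y))" "rmem s' (y * d + j) = rmem s (y * d + j)"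
    proof -
      have "\<forall>x<y. A + (i * H + y) \<noteq> A + (i * H + x)" by auto
      then show "rmem s' (A + i * H + y) = rmem s (A + (i * H + y))" using 2(2) unfolding I_def by (simp add: add.assoc)
      have "\<forall>x<y. y * d + j \<noteq> A + (i * H + x)" using yj ndA by auto
      then show "rmem s' (y * d + j) = rmem s (y * d + j)" using 2(2) unfolding I_def by blast
    qed
    let ?f = "s'\<lparr>rmem := (rmem s')(A + i * H + y := rmem s (A + (i * H + y)) + coins s (used s) * rmem s (y * d + j)),
      ireg := (ireg s')(16 := Suc y)\<rparr>"
    have "I (Suc y) ?f" using 2(2) unfolding I_def by (auto simp: less_Suc_eq Par_def add.assoc)
    then show ?case using 2 le r15 r17 o bounds unfolding I_def Par_def by (simp add: wp_simps)
  next
    case (3 s')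
    then show ?case using bounds by (simp add: I_def Par_def)
  next
    case (4 t s')
    then show ?case by (intro R) (auto simp: I_def)
  qed
  then show ?thesis unfolding init_coordinate_def using bounds by (simp add: wp_simps)
qed

definition row_time :: nat where "row_time = 6 + n * 3 + d * (5 + n * 3)"

definition init_time :: nat where "init_time = 25 + 6 * b + n * 3 + Q * (row_time + 2)"

lemma wp_init_projections:
  assumes Par: "Par s" and co: "coins s = \<omega>" and us: "used s = 0" and st: "stored (rmem s)"
    and z: "\<And>i x. i < Q \<Longrightarrow> x < n \<Longrightarrow> rmem s (A + (i * H + x)) = 0"
    and R: "\<And>t s'. t \<le> 2 + Q * (row_time + 2) \<Longrightarrow> Par s' \<Longrightarrow> stored (rmem s') \<Longrightarrow> base proj (rmem s') \<Longrightarrow>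
      (\<forall>i<Q. \<forall>x<n. imem s' (A + (i * H + x)) = x) \<Longrightarrow> (\<forall>k. k < A \<or> P \<le> k \<longrightarrow> imem s' k = imem s k) \<Longrightarrow> R t s'"
  shows "wp m init_projections R s"
proof -
  \<comment> \<open>Direction \<open>i\<close> consumes the \<open>d\<close> coins from index
    \<open>i * d\<close> on, which makes \<open>proj\<close> a fixed function of the outcome. The
    slots of later directions are still 0 because the projections are accumulated in place.\<close>
  define I where "I = (\<lambda>i s'. Par s' \<and> coins s' = \<omega> \<and> used s' = i * d \<and> ireg s' 14 = i \<and> stored (rmem s') \<and>
      (\<forall>i'<i. \<forall>x<n. rmem s' (A + (i' * H + x)) = proj i' x \<and> imem s' (A + (i' * H + x)) = x) \<and>
      (\<forall>i'<Q. i \<le> i' \<longrightarrow> (\<forall>x<n. rmem s' (A + (i' * H + x)) = 0)) \<and>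
      (\<forall>k. k < A \<or> P \<le> k \<longrightarrow> imem s' k = imem s k))"
  let ?s0 = "s\<lparr>ireg := (ireg s)(14 := 0)\<rparr>"
  have ndA: "n * d \<le> A" by (simp add: A_def)
  have "wp m (While (ILess (IReg 14) vQ)
       (ISet 15 (IAdd vA (IMul (IReg 14) vH));; init_winners;;
        ISet 17 (IConst 0);;
        While (ILess (IReg 17) vD) (init_coordinate;; incr 17);;
        incr 14)) (\<lambda>t s'. R (Suc t) s') ?s0"
  proof (rule wp_for[where N = Q and \<tau> = "row_time + 1" and I = I], goal_cases)
    case 1
    show ?case using Par co us st z by (simp add: I_def Par_def)
  next
    case (2 i s')
    have iQ: "i < Q" by fact
    have P': "Par s'" and r14: "ireg s' 14 = i" using 2 by (auto simp: I_def)
    have iH: "A + i * H < m" "i * H < m" "i < m" "Suc i < m"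
      using slot_less[OF iQ n_pos] iQ bounds by auto
    let ?s1 = "s'\<lparr>ireg := (ireg s')(15 := A + i * H)\<rparr>"
    have "wp m (init_winners;; ISet 17 (IConst 0);;
        While (ILess (IReg 17) vD) (init_coordinate;; incr 17);; incr 14)
        (\<lambda>t s''. Suc t \<le> row_time + 1 \<and> I (Suc i) s'') ?s1"
    proof (rule wp_SeqI[where P = "\<lambda>t s2. t \<le> 2 + n * 3 \<and> Par s2 \<and> rmem s2 = rmem s' \<and> coins s2 = coins s' \<and> used s2 = used s' \<and>
        (\<forall>k. k \<noteq> 16 \<longrightarrow> ireg s2 k = ireg ?s1 k) \<and> (\<forall>x<n. imem s2 (A + (i * H + x)) = x) \<and>
        (\<forall>k. (\<forall>x<n. k \<noteq> A + (i * H + x)) \<longrightarrow> imem s2 k = imem s' k)"], goal_cases)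
      case 1
      show ?case by (rule wp_init_winners[where i = i]) (use P' iQ in \<open>auto simp: Par_def\<close>)
    next
      case (2 t2 s2)
      note h2 = 2
      let ?s3 = "s2\<lparr>ireg := (ireg s2)(17 := 0)\<rparr>"
      define J where "J = (\<lambda>j s3. Par s3 \<and> imem s3 = imem s2 \<and> coins s3 = \<omega> \<and> used s3 = i * d + j \<and>
         ireg s3 14 = i \<and> ireg s3 15 = A + i * H \<and> ireg s3 17 = j \<and>
         (\<forall>x<n. rmem s3 (A + (i * H + x)) = (\<Sum>j'<j. \<omega> (i * d + j') * xs ! x ! j')) \<and>
         (\<forall>k. (\<forall>x<n. k \<noteq> A + (i * H + x)) \<longrightarrow> rmem s3 k = rmem s' k))"
      have st': "stored (rmem s')" using \<open>I i s'\<close> by (simp add: I_def)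
      have "wp m (While (ILess (IReg 17) vD) (init_coordinate;; incr 17);; incr 14)
        (\<lambda>t s''. Suc (t2 + Suc t) \<le> row_time + 1 \<and> I (Suc i) s'') ?s3"
      proof (rule wp_SeqI[where P = "\<lambda>t s4. t \<le> 1 + d * (5 + n * 3) \<and> J d s4"], goal_cases)
        case 1
        show ?case
        proof (rule wp_for[where N = d and \<tau> = "4 + n * 3" and I = J], goal_cases)
          case 1
          show ?case using h2 \<open>I i s'\<close> iQ by (auto simp: J_def I_def Par_def)
        next
          case (2 j s4)
          have j: "j < d" by fact
          have jm: "j < m" "Suc j < m" using j bounds by auto
          have P4: "Par s4" using 2 by (simp add: J_def)
          have rc: "rmem s4 (x * d + j) = xs ! x ! j" if "x < n" for x
          proof -
            have "x * d + j < A" using coord_index[OF that j] ndA by simp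
            then have "\<forall>y<n. x * d + j \<noteq> A + (i * H + y)" by auto
            then have "rmem s4 (x * d + j) = rmem s' (x * d + j)" using 2 unfolding J_def by blast
            then show ?thesis using st' that j by (simp add: stored_def)
          qed
          have "wp m init_coordinate (\<lambda>t s5. wp m (incr 17) (\<lambda>t' s6. t + t' \<le> 4 + n * 3 \<and> J (Suc j) s6) s5) s4"
          proof (rule wp_init_coordinate[where i = i and j = j], goal_cases)
            case (6 t s5)
            let ?f = "s5\<lparr>ireg := (ireg s5)(17 := Suc j)\<rparr>"
            have "J (Suc j) ?f"
              unfolding J_def
            proof (intro conjI allI impI)
              show "Par ?f" using 6 by (simp add: Par_def)
              show "imem ?f = imem s2" "coins ?f = \<omega>" "used ?f = i * d + Suc j" "ireg ?f 14 = i" "ireg ?f 15 = A + i * H"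
                "ireg ?f 17 = Suc j" using 6 2 by (auto simp: J_def)
              show "rmem ?f (A + (i * H + x)) = (\<Sum>j'<Suc j. \<omega> (i * d + j') * xs ! x ! j')" if "x < n" for x
                using 6(7) 2(2) rc[OF that] that by (simp add: J_def)
              show "rmem ?f k = rmem s' k" if "\<forall>x<n. k \<noteq> A + (i * H + x)" for k
                using 6(8) 2(2) that by (simp add: J_def)
            qed
            moreover have "ireg s5 17 = j" using 6 2 by (simp add: J_def)
            ultimately show ?case using 6(1) jm bounds by (simp add: wp_simps)
          qed (use 2 P4 iQ j in \<open>auto simp: J_def\<close>)
          moreover have "ireg s4 17 = j" using 2 by (simp add: J_def)
          ultimately show ?case using P4 jm j bounds by (simp add: wp_Seq Par_def)
        next
          case (3 s4)
          then show ?case using bounds by (simp add: J_def Par_def)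
        next
          case (4 t s4)
          then show ?case by (simp add: algebra_simps)
        qed
      next
        case (2 t4 s4)
        let ?f = "s4\<lparr>ireg := (ireg s4)(14 := Suc i)\<rparr>"
        have nk: "\<forall>x<n. k \<noteq> A + (i * H + x)" if "k < A \<or> P \<le> k" for k
        proof (intro allI impI)
          fix x assume "x < n"
          then have "i * H + x < Q * H" using proj_index[OF iQ, of x] n_le_H by simp
          then show "k \<noteq> A + (i * H + x)" using that by (auto simp: P_def)
        qed
        have other: "\<forall>x'<n. A + (i' * H + x) \<noteq> A + (i * H + x')" if "i' \<noteq> i" "x < n" for i' x
          using slot_eq that by auto
        have rm4: "rmem s4 k = rmem s' k" if "\<forall>x<n. k \<noteq> A + (i * H + x)" for k
          using 2 that by (simp add: J_def)
        have im4: "imem s4 k = imem s' k" if "\<forall>x<n. k \<noteq> A + (i * H + x)" for k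
          using 2 h2 that by (simp add: J_def)
        have "I (Suc i) ?f"
          unfolding I_def
        proof (intro conjI allI impI)
          show "Par ?f" using 2 by (simp add: J_def Par_def)
          show "coins ?f = \<omega>" "used ?f = Suc i * d" "ireg ?f 14 = Suc i" using 2 by (auto simp: J_def)
          show "stored (rmem ?f)"
            unfolding stored_def
          proof (intro allI impI)
            fix y j assume "y < n" "j < d"
            then have "y * d + j < A" using coord_index ndA less_le_trans by blast
            then have "rmem s4 (y * d + j) = rmem s' (y * d + j)" using rm4 nk by blast
            then show "rmem ?f (y * d + j) = xs ! y ! j" using st' \<open>y < n\<close> \<open>j < d\<close> by (simp add: stored_def)
          qed
          show "rmem ?f (A + (i' * H + x)) = proj i' x" if "i' < Suc i" "x < n" for i' x
          proof (cases "i' = i")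
            case True
            then show ?thesis using 2 that by (simp add: J_def proj_def)
          next
            case False
            then show ?thesis using rm4[OF other[OF False that(2)]] \<open>I i s'\<close> that by (simp add: I_def)
          qed
          show "imem ?f (A + (i' * H + x)) = x" if "i' < Suc i" "x < n" for i' x
          proof (cases "i' = i")
            case True
            then show ?thesis using 2 h2 that by (simp add: J_def)
          next
            case False
            then show ?thesis using im4[OF other[OF False that(2)]] \<open>I i s'\<close> that by (simp add: I_def)
          qed
          show "rmem ?f (A + (i' * H + x)) = 0" if "i' < Q" "Suc i \<le> i'" "x < n" for i' x
          proof -
            have ne: "i' \<noteq> i" using that by simp
            show ?thesis using rm4[OF other[OF ne that(3)]] \<open>I i s'\<close> that by (simp add: I_def)
          qed
          show "imem ?f k = imem s k" if "k < A \<or> P \<le> k" for k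
            using im4[OF nk[OF that]] \<open>I i s'\<close> that by (auto simp add: I_def)
        qed
        moreover have "Suc (t2 + Suc (t4 + 1)) \<le> row_time + 1" using h2 2 by (simp add: row_time_def)
        moreover have "ireg s4 14 = i" using 2 by (simp add: J_def)
        ultimately show ?case using iH bounds by (simp add: wp_simps)
      qed
      then show ?case using bounds by (simp add: wp_simps)
    qed
    then show ?case using P' r14 iH iQ bounds by (simp add: wp_simps Par_def)
  next
    case (3 s')
    then show ?case using bounds by (simp add: I_def Par_def)
  next
    case (4 t s')
    then show ?case by (intro R) (auto simp: I_def base_def)
  qed
  then show ?thesis unfolding init_projections_def using bounds by (simp add: wp_simps)
qed

lemma initialize_step:
  "\<exists>t s. big_step m init_prog (start xs d \<alpha> \<omega>) t s \<and> t \<le> init_time \<and>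
     ds_inv (singletons (set xs)) (s, \<lambda>S. position xs (the_elem S))"
proof -
  let ?s = "start xs d \<alpha> \<omega>"
  let ?h = "\<lambda>S. position xs (the_elem S)"
  have "wp m init_prog (\<lambda>t s. t \<le> init_time \<and> ds_inv (singletons (set xs)) (s, ?h)) ?s"
    unfolding init_prog_def
  proof (rule wp_SeqI[where P = "\<lambda>t s'. t \<le> 18 + 6 * b \<and> Par s' \<and> imem s' = imem ?s \<and> rmem s' = rmem ?s \<and>
      coins s' = coins ?s \<and> used s' = used ?s"], goal_cases)
    case 1
    show ?case by (rule wp_init_sizes) (auto simp: start_def len)
  next
    case (2 t1 s1)
    note h1 = 2
    show ?case
    proof (rule wp_SeqI[where P = "\<lambda>t s'. t \<le> 2 + n * 3 \<and> Par s' \<and> rmem s' = rmem s1 \<and> coins s' = coins s1 \<and> used s' = used s1 \<and>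
      (\<forall>a<n. imem s' (a * b) = Suc a) \<and> (\<forall>k. (\<forall>a<n. k \<noteq> a * b) \<longrightarrow> imem s' k = imem s1 k)"], goal_cases)
      case 1
      show ?case by (rule wp_init_forest) (use h1 in auto)
    next
      case (2 t2 s2)
      note h2 = 2
      have rm: "rmem s2 k = (if k < n * d then xs ! (k div d) ! (k mod d) else 0)" for k
        using h1 h2 by (simp add: start_def len)
      have st: "stored (rmem s2)"
        unfolding stored_def rm using coord_index by simp
      have ndA: "n * d \<le> A" by (simp add: A_def)
      show ?case
      proof (rule wp_init_projections, goal_cases)
        case 1 show ?case using h2 by simp
      next
        case 2 show ?case using h1 h2 by (simp add: start_def)
      next
        case 3 show ?case using h1 h2 by (simp add: start_def)
      next
        case 4 show ?case by (rule st)
      next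
        case (5 i x)
        then show ?case using ndA by (simp add: rm)
      next
        case (6 t s')
        \<comment> \<open>Each point starts as a tree of rank 0 whose handle is its own position;
          the root is shifted by one.\<close>
        define f where "f = (\<lambda>a (j::nat). if a < n \<and> j = 0 then Suc a else 0 :: nat)"
        have rt: "root (imem s') a j = f a j" if "a < n" "j < b" for a j
        proof -
          have "a * b + j < A" using root_index[OF that] by (simp add: A_def)
          then have "root (imem s') a j = imem s2 (a * b + j)" using 6 by (simp add: root_def)
          also have "\<dots> = f a j"
          proof (cases "j = 0")
            case True
            then show ?thesis using h2 that by (simp add: f_def)
          next
            case False
            then have "\<forall>a'<n. a * b + j \<noteq> a' * b" using root_index_eq[OF that(2) b_pos, of a] by auto
            then show ?thesis using h1 h2 False by (simp add: f_def start_def)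
          qed
          finally show ?thesis .
        qed
        have nd: "node proj (imem s') (rmem s') 0 a" if "a < n" for a
          unfolding node_def using 6(4,5) that by (simp add: base_def)
        have fm: "fam proj (imem s') (rmem s') f"
          unfolding fam_def f_def using nd by (auto split: if_splits)
        have ct: "cont (imem s') f a = {a}" if "a < n" for a
        proof -
          have "{j. f a j \<noteq> 0} = {0}" using that by (auto simp: f_def)
          then show ?thesis using that by (simp add: cont_def f_def)
        qed
        have pp: "pos {x} = {position xs x}" if "x \<in> set xs" for x
          using position_less[OF that] dist len unfolding pos_def by (auto simp: nth_eq_iff_index_eq)
        have hs: "?h S < n \<and> cont (imem s') f (?h S) = pos S" if "S \<in> singletons (set xs)" for S
          using that position_less ct pp unfolding singletons_def by auto
        have inj: "inj_on ?h (singletons (set xs))"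
          by (rule inj_onI) (use position_less in \<open>auto simp: singletons_def, metis\<close>)
        have cd: "codes s'"
          unfolding codes_def
        proof (intro allI impI)
          fix k :: nat assume "1 \<le> k \<and> k < 2 * Z"
          have "a * b < P" if "a < n" for a using root_index[OF that b_pos] H_le_P by simp
          then have "\<forall>a<n. P + k \<noteq> a * b" by (metis not_add_less1)
          then have "imem s' (P + k) = 0" using 6(6) h1 h2 by (simp add: start_def)
          then show "imem s' (P + k) \<le> Q * H" by simp
        qed
        have pt: "is_partition (singletons (set xs))"
          by (auto simp: is_partition_def singletons_def)
        have "ds_inv (singletons (set xs)) (s', ?h)"
          unfolding ds_inv_def prod.case using 6(2,3,4) cd pt fm rt hs inj
          by (intro conjI exI[of _ f]) (auto simp: f_def)
        moreover have "t1 + (t2 + t) \<le> init_time" using h1 h2 6(1) by (simp add: init_time_def)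
        ultimately show ?case by blast
      qed
    qed
  qed
  then show ?thesis unfolding wp_def by blast
qed

end

section \<open>Gaussian projections\<close>

text \<open>After squaring, the claim is \<open>exp 1 ^ 3 \<le> 20.25\<close>, and
  \<open>2.72 ^ 3\<close> is below 20.2.\<close>

lemma exp_three_halves_le: "exp (3 / 2 :: real) \<le> 9 / 2"
proof -
  have "exp (3 / 2 :: real) ^ 2 = exp 1 ^ 3"
    by (simp flip: exp_of_nat_mult)
  also have "\<dots> \<le> 2.72 ^ 3" using e_less_272 by (intro power_mono) auto
  also have "\<dots> \<le> (9 / 2 :: real) ^ 2" by (simp add: power2_eq_square power3_eq_cube)
  finally show ?thesis by (rule power2_le_imp_le) simp
qed

interpretation coin: prob_space coin_space
  unfolding coin_space_def
  by (intro prob_space_PiM prob_space_normal_density) simp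

lemma coin_component [measurable]: "(\<lambda>\<omega>. \<omega> i) \<in> coin_space \<rightarrow>\<^sub>M std_normal_distribution"
  unfolding coin_space_def by simp

lemma space_coin: "space coin_space = UNIV"
  by (auto simp: coin_space_def space_PiM)

lemma coin_indep: "coin.indep_vars (\<lambda>_. std_normal_distribution) (\<lambda>i \<omega>. \<omega> i) UNIV"
proof -
  have "distr coin_space (\<Pi>\<^sub>M i\<in>UNIV. std_normal_distribution) (\<lambda>x. \<lambda>i\<in>UNIV. x i) = coin_space"
    by (simp add: coin_space_def restrict_def)
  moreover have "distr coin_space std_normal_distribution (\<lambda>\<omega>. \<omega> i) = std_normal_distribution" for i
    unfolding coin_space_def by (rule distr_PiM_component) (auto intro: prob_space_normal_density)
  ultimately show ?thesis
    by (subst coin.indep_vars_iff_distr_eq_PiM) (auto simp: coin_space_def)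
qed

lemma coin_distributed: "distributed coin_space lborel (\<lambda>\<omega>. \<omega> i) std_normal_density"
proof -
  have "distr coin_space lborel (\<lambda>\<omega>. \<omega> i) = distr coin_space std_normal_distribution (\<lambda>\<omega>. \<omega> i)"
    by (intro distr_cong) auto
  also have "\<dots> = density lborel (\<lambda>x. ennreal (std_normal_density x))"
    unfolding coin_space_def by (rule distr_PiM_component) (auto intro: prob_space_normal_density)
  finally have "distr coin_space lborel (\<lambda>\<omega>. \<omega> i) = std_normal_distribution" .
  moreover have "(\<lambda>\<omega>. \<omega> i) \<in> coin_space \<rightarrow>\<^sub>M lborel"
    using coin_component[of i] by (simp add: measurable_def)
  ultimately show ?thesis unfolding distributed_def by simp
qed

definition lin :: "nat \<Rightarrow> (nat \<Rightarrow> real) \<Rightarrow> nat \<Rightarrow> (nat \<Rightarrow> real) \<Rightarrow> real" where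
  "lin d z i \<omega> = (\<Sum>j<d. \<omega> (i * d + j) * z j)"

text \<open>A linear form in independent standard normals is normal with the squared norm of the
  coefficients as its variance. Zero coefficients are dropped first, since a summand of variance 0
  has no density.\<close>

lemma lin_distributed:
  assumes "0 < (\<Sum>j<d. (z j)\<^sup>2)"
  shows "distributed coin_space lborel (lin d z i) (normal_density 0 (sqrt (\<Sum>j<d. (z j)\<^sup>2)))"
proof -
  define J where "J = {j. j < d \<and> z j \<noteq> 0}"
  have fin: "finite J" by (simp add: J_def)
  have sumJ: "(\<Sum>j<d. g j) = (\<Sum>j\<in>J. g j)" if "\<And>j. z j = 0 \<Longrightarrow> g j = 0" for g :: "nat \<Rightarrow> real"
    using that by (intro sum.mono_neutral_right) (auto simp: J_def)
  have ne: "J \<noteq> {}" using assms sumJ[of "\<lambda>j. (z j)\<^sup>2"] by auto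
  define X where "X j \<omega> = \<omega> (i * d + j) * z j" for j and \<omega> :: "nat \<Rightarrow> real"
  have "coin.indep_vars (\<lambda>_. borel) X J"
  proof -
    have "coin.indep_vars (\<lambda>j. PiM {i * d + j} (\<lambda>_. std_normal_distribution))
        (\<lambda>j \<omega>. restrict (\<lambda>i. \<omega> i) {i * d + j}) J"
      by (rule coin.indep_vars_restrict[OF coin_indep]) (auto simp: disjoint_family_on_def)
    then have "coin.indep_vars (\<lambda>_. borel) (\<lambda>j \<omega>. (\<lambda>x. x (i * d + j) * z j) (restrict (\<lambda>i. \<omega> i) {i * d + j})) J"
      by (rule coin.indep_vars_compose2) simp
    then show ?thesis by (simp add: X_def[abs_def])
  qed
  moreover have "distributed coin_space lborel (X j) (normal_density 0 \<bar>z j\<bar>)" if "j \<in> J" for j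
    using coin.normal_density_affine[OF coin_distributed, of "z j" 0 "i * d + j"] that
    by (simp add: X_def[abs_def] J_def mult.commute)
  ultimately have "distributed coin_space lborel (\<lambda>\<omega>. \<Sum>j\<in>J. X j \<omega>)
      (normal_density (\<Sum>j\<in>J. 0) (sqrt (\<Sum>j\<in>J. \<bar>z j\<bar>\<^sup>2)))"
    using fin ne by (intro coin.sum_indep_normal) (auto simp: J_def)
  moreover have "lin d z i = (\<lambda>\<omega>. \<Sum>j\<in>J. X j \<omega>)"
    by (rule ext) (auto simp: lin_def X_def intro!: sumJ)
  ultimately show ?thesis using sumJ[of "\<lambda>j. (z j)\<^sup>2"] by simp
qed

text \<open>For \<open>x \<ge> \<Delta> \<ge> 0\<close> the square of \<open>x\<close> is at least
  \<open>(x - \<Delta>)\<^sup>2 + \<Delta>\<^sup>2\<close>. So on the tail the density is at most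
  \<open>?c\<close> times the density with mean \<open>\<Delta>\<close>, whose integral is
  1.\<close>

lemma normal_upper_tail:
  assumes X: "distributed coin_space lborel X (normal_density 0 \<sigma>)" and \<sigma>: "0 < \<sigma>" and \<Delta>: "0 \<le> \<Delta>"
  shows "coin.prob {\<omega> \<in> space coin_space. \<Delta> \<le> X \<omega>} \<le> exp (- (\<Delta> / \<sigma>)\<^sup>2 / 2)"
proof -
  let ?c = "exp (- (\<Delta> / \<sigma>)\<^sup>2 / 2)"
  have le: "normal_density 0 \<sigma> x \<le> ?c * normal_density \<Delta> \<sigma> x" if "\<Delta> \<le> x" for x
  proof -
    have "(x - \<Delta>)\<^sup>2 + \<Delta>\<^sup>2 \<le> x\<^sup>2"
      using mult_left_mono[OF that \<Delta>] by (simp add: power2_eq_square algebra_simps)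
    then have "- x\<^sup>2 / (2 * \<sigma>\<^sup>2) \<le> - (\<Delta> / \<sigma>)\<^sup>2 / 2 + - (x - \<Delta>)\<^sup>2 / (2 * \<sigma>\<^sup>2)"
      using \<sigma> by (simp add: field_simps power_divide)
    then have "exp (- x\<^sup>2 / (2 * \<sigma>\<^sup>2)) \<le> ?c * exp (- (x - \<Delta>)\<^sup>2 / (2 * \<sigma>\<^sup>2))"
      by (simp flip: exp_add)
    then show ?thesis unfolding normal_density_def
      by (simp add: mult.left_commute mult_left_mono divide_right_mono)
  qed
  have "emeasure coin_space {\<omega> \<in> space coin_space. \<Delta> \<le> X \<omega>} = emeasure coin_space (X -` {\<Delta>..} \<inter> space coin_space)"
    by (intro arg_cong[where f = "emeasure coin_space"]) auto
  also have "\<dots> = (\<integral>\<^sup>+x. ennreal (normal_density 0 \<sigma> x) * indicator {\<Delta>..} x \<partial>lborel)"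
    by (rule distributed_emeasure[OF X]) simp
  also have "\<dots> \<le> (\<integral>\<^sup>+x. ennreal ?c * ennreal (normal_density \<Delta> \<sigma> x) \<partial>lborel)"
    by (intro nn_integral_mono) (use le in \<open>auto simp: indicator_def simp flip: ennreal_mult\<close>)
  also have "\<dots> = ennreal ?c * (\<integral>\<^sup>+x. ennreal (normal_density \<Delta> \<sigma> x) \<partial>lborel)"
    by (rule nn_integral_cmult) simp
  also have "(\<integral>\<^sup>+x. ennreal (normal_density \<Delta> \<sigma> x) \<partial>lborel) = 1"
    using prob_space.emeasure_space_1[OF prob_space_normal_density[OF \<sigma>, of \<Delta>]] by (simp add: emeasure_density)
  finally show ?thesis by (simp add: coin.emeasure_eq_measure)
qed

text \<open>The tail contains an interval of length \<open>\<sigma> / (1 + x)\<close>, over which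
  the exponent decreases by at most 3 / 2, because
  \<open>(x + \<delta>)\<^sup>2 \<le> x\<^sup>2 + 3\<close>. The constant 27 / 2 is the product of
  the bounds 9 / 2 for \<open>exp (3 / 2)\<close> and 3 for \<open>sqrt (2 * pi)\<close>.\<close>

lemma normal_lower_tail:
  assumes X: "distributed coin_space lborel X (normal_density 0 \<sigma>)" and \<sigma>: "0 < \<sigma>" and x: "0 \<le> x"
  shows "exp (- x\<^sup>2 / 2) / (27 / 2 * (1 + x)) \<le> coin.prob {\<omega> \<in> space coin_space. \<sigma> * x \<le> X \<omega>}"
proof -
  define \<delta> where "\<delta> = 1 / (1 + x)"
  have \<delta>: "0 < \<delta>" "\<delta> \<le> 1" "x * \<delta> \<le> 1" using x by (auto simp: \<delta>_def field_simps)
  define k where "k = exp (- (x + \<delta>)\<^sup>2 / 2) / (sqrt (2 * pi) * \<sigma>)"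
  have ge: "k \<le> normal_density 0 \<sigma> y" if "\<sigma> * x \<le> y" "y \<le> \<sigma> * x + \<sigma> * \<delta>" for y
  proof -
    have "0 \<le> y" using that(1) \<sigma> x by (meson mult_nonneg_nonneg less_imp_le order_trans)
    then have "y\<^sup>2 \<le> (\<sigma> * (x + \<delta>))\<^sup>2" using that(2) by (intro power_mono) (auto simp: algebra_simps)
    then have "y\<^sup>2 \<le> \<sigma>\<^sup>2 * (x + \<delta>)\<^sup>2" by (simp only: power_mult_distrib)
    then have "- (x + \<delta>)\<^sup>2 / 2 \<le> - y\<^sup>2 / (2 * \<sigma>\<^sup>2)"
      using \<sigma> by (simp add: field_simps)
    then have "exp (- (x + \<delta>)\<^sup>2 / 2) \<le> exp (- y\<^sup>2 / (2 * \<sigma>\<^sup>2))" by simp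
    moreover have "sqrt (2 * pi * \<sigma>\<^sup>2) = sqrt (2 * pi) * \<sigma>" using \<sigma> by (simp add: real_sqrt_mult)
    ultimately show ?thesis using \<sigma> unfolding k_def normal_density_def
      by (simp add: divide_right_mono)
  qed
  have k0: "0 \<le> k" using \<sigma> by (simp add: k_def)
  have "ennreal (k * (\<sigma> * \<delta>)) = (\<integral>\<^sup>+y. ennreal k * indicator {\<sigma> * x..\<sigma> * x + \<sigma> * \<delta>} y \<partial>lborel)"
    using k0 \<sigma> \<delta> by (simp add: nn_integral_cmult_indicator ennreal_mult)
  also have "\<dots> \<le> (\<integral>\<^sup>+y. ennreal (normal_density 0 \<sigma> y) * indicator {\<sigma> * x..} y \<partial>lborel)"
    by (intro nn_integral_mono) (auto simp: indicator_def ge)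
  also have "\<dots> = emeasure coin_space (X -` {\<sigma> * x..} \<inter> space coin_space)"
    by (rule distributed_emeasure[OF X, symmetric]) simp
  also have "X -` {\<sigma> * x..} \<inter> space coin_space = {\<omega> \<in> space coin_space. \<sigma> * x \<le> X \<omega>}" by auto
  finally have "k * (\<sigma> * \<delta>) \<le> coin.prob {\<omega> \<in> space coin_space. \<sigma> * x \<le> X \<omega>}"
    by (simp add: coin.emeasure_eq_measure)
  moreover have "exp (- x\<^sup>2 / 2) / (27 / 2 * (1 + x)) \<le> k * (\<sigma> * \<delta>)"
  proof -
    have "\<delta> * \<delta> \<le> 1" using \<delta> mult_mono[of \<delta> 1 \<delta> 1] by simp
    then have "(x + \<delta>)\<^sup>2 \<le> x\<^sup>2 + 3" using \<delta> by (simp add: power2_eq_square algebra_simps)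
    then have "exp (- x\<^sup>2 / 2 + - (3 / 2)) \<le> exp (- (x + \<delta>)\<^sup>2 / 2)" by simp
    then have 1: "exp (- x\<^sup>2 / 2) * exp (- (3 / 2)) \<le> exp (- (x + \<delta>)\<^sup>2 / 2)" by (simp only: exp_add)
    have s3: "sqrt (2 * pi) \<le> 3"
    proof (rule real_le_lsqrt)
      show "2 * pi \<le> 3\<^sup>2" using pi_less_4 by simp
    qed (auto)
    have "9 / 2 * exp (- (3 / 2)) \<ge> (1::real)" using exp_three_halves_le by (simp add: exp_minus field_simps)
    then have "exp (- x\<^sup>2 / 2) / (27 / 2) \<le> exp (- x\<^sup>2 / 2) * exp (- (3 / 2)) / 3"
      by (simp add: field_simps)
    also have "\<dots> \<le> exp (- (x + \<delta>)\<^sup>2 / 2) / 3" using 1 by (simp add: divide_right_mono)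
    also have "\<dots> \<le> exp (- (x + \<delta>)\<^sup>2 / 2) / sqrt (2 * pi)"
      using s3 by (intro divide_left_mono) auto
    finally have "exp (- x\<^sup>2 / 2) / (27 / 2) * \<delta> \<le> exp (- (x + \<delta>)\<^sup>2 / 2) / sqrt (2 * pi) * \<delta>"
      using \<delta> by (intro mult_right_mono) auto
    then show ?thesis using \<sigma> by (simp add: k_def \<delta>_def)
  qed
  ultimately show ?thesis by linarith
qed

section \<open>Independence of directions and of groups\<close>

lemma coin_blocks:
  assumes "finite J" "J \<noteq> {}" "disjoint_family_on K J"
    and "\<And>i. i \<in> J \<Longrightarrow> A i \<in> sets (PiM (K i) (\<lambda>_. std_normal_distribution))"
  shows "coin.prob {\<omega>. \<forall>i\<in>J. restrict \<omega> (K i) \<in> A i} = (\<Prod>i\<in>J. coin.prob {\<omega>. restrict \<omega> (K i) \<in> A i})"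
proof -
  have "coin.indep_vars (\<lambda>j. PiM (K j) (\<lambda>_. std_normal_distribution)) (\<lambda>j \<omega>. restrict (\<lambda>i. \<omega> i) (K j)) J"
    by (rule coin.indep_vars_restrict[OF coin_indep]) (auto simp: assms)
  from coin.indep_varsD_finite[OF this assms(2,1,4)]
  have "coin.prob (\<Inter>i\<in>J. (\<lambda>\<omega>. restrict \<omega> (K i)) -` A i) = (\<Prod>i\<in>J. coin.prob ((\<lambda>\<omega>. restrict \<omega> (K i)) -` A i))"
    by (simp add: space_coin)
  moreover have "(\<Inter>i\<in>J. (\<lambda>\<omega>. restrict \<omega> (K i)) -` A i) = {\<omega>. \<forall>i\<in>J. restrict \<omega> (K i) \<in> A i}" by auto
  ultimately show ?thesis by (simp add: vimage_def)
qed

lemma lin_restrict: "{i * d..<i * d + d} \<subseteq> K \<Longrightarrow> lin d z i (restrict \<omega> K) = lin d z i \<omega>"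
  unfolding lin_def by (intro sum.cong) (auto simp: subset_iff)

lemma measurable_lin:
  assumes "{i * d..<i * d + d} \<subseteq> K"
  shows "lin d z i \<in> borel_measurable (PiM K (\<lambda>_. std_normal_distribution))"
proof -
  have "(\<lambda>x. x (i * d + j)) \<in> borel_measurable (PiM K (\<lambda>_. std_normal_distribution))" if "j < d" for j
    using measurable_component_singleton[of "i * d + j" K "\<lambda>_. std_normal_distribution"] assms that
    by (auto simp: subset_iff)
  then show ?thesis unfolding lin_def[abs_def] by measurable
qed

text \<open>This is the complement of \<open>good_group\<close>, stated with the vectors from the
  query to the points instead of the stored projections, so that it is an event about one block of
  coins.\<close>

definition bad_group :: "nat \<Rightarrow> nat \<Rightarrow> (nat \<Rightarrow> real) \<Rightarrow> (nat \<Rightarrow> nat \<Rightarrow> real) \<Rightarrow> nat set \<Rightarrow> real \<Rightarrow> nat \<Rightarrow> (nat \<Rightarrow> real) \<Rightarrow> bool" where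
  "bad_group d L y z B \<Delta> g \<omega> \<longleftrightarrow> (\<forall>i\<in>{g * L..<g * L + L}. lin d y i \<omega> < \<Delta>) \<or>
     4 * L \<le> card (SIGMA i:{g * L..<g * L + L}. {w \<in> B. \<Delta> \<le> lin d (z w) i \<omega>})"

text \<open>As a sum of indicators the count is visibly measurable, and its expectation is a sum of
  probabilities.\<close>

lemma card_heavy_pairs:
  assumes "finite B"
  shows "real (card (SIGMA i:{g * L..<g * L + L}. {w \<in> B. \<Delta> \<le> lin d (z w) i \<omega>})) =
    (\<Sum>i\<in>{g * L..<g * L + L}. \<Sum>w\<in>B. indicator {\<omega>. \<Delta> \<le> lin d (z w) i \<omega>} \<omega>)"
proof -
  have "real (card {w \<in> B. \<Delta> \<le> lin d (z w) i \<omega>}) = (\<Sum>w\<in>B. indicator {\<omega>. \<Delta> \<le> lin d (z w) i \<omega>} \<omega>)" for i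
  proof -
    have "(\<Sum>w\<in>B. indicator {\<omega>. \<Delta> \<le> lin d (z w) i \<omega>} \<omega>) = (\<Sum>w\<in>{w \<in> B. \<Delta> \<le> lin d (z w) i \<omega>}. 1 :: real)"
      using assms by (intro sum.mono_neutral_cong_right) (auto simp: indicator_def)
    then show ?thesis by simp
  qed
  then show ?thesis using assms by simp
qed

lemma group_block: "(i::nat) \<in> {g * L..<g * L + L} \<Longrightarrow> {i * d..<i * d + d} \<subseteq> {g * L * d..<(g * L + L) * d}"
proof -
  assume i: "i \<in> {g * L..<g * L + L}"
  then have "g * L * d \<le> i * d" "Suc i * d \<le> (g * L + L) * d" by (intro mult_le_mono1; simp)+
  then show ?thesis by auto
qed

text \<open>Two instances of \<open>K\<close> are used: the block of the group, for independence,
  and the set of all indices, for measurability in the whole coin space.\<close>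

lemma measurable_bad_group:
  assumes "finite B" "{g * L * d..<(g * L + L) * d} \<subseteq> K"
  shows "{x \<in> space (PiM K (\<lambda>_. std_normal_distribution)). bad_group d L y z B \<Delta> g x}
    \<in> sets (PiM K (\<lambda>_. std_normal_distribution))"
proof -
  let ?M = "PiM K (\<lambda>_. std_normal_distribution)"
  let ?I = "{g * L..<g * L + L}"
  have m: "lin d w i \<in> borel_measurable ?M" if "i \<in> ?I" for w i
    using measurable_lin group_block[OF that] assms(2) by blast
  have 1: "{x \<in> space ?M. \<forall>i\<in>?I. lin d y i x < \<Delta>} \<in> sets ?M"
    using m by (intro sets.sets_Collect_finite_All) (auto intro: borel_measurable_less)
  have ind: "(\<lambda>x. indicator {\<omega>. \<Delta> \<le> lin d (z w) i \<omega>} x :: real) \<in> borel_measurable ?M" if "i \<in> ?I" for i w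
  proof -
    have [measurable]: "lin d (z w) i \<in> borel_measurable ?M" by (rule m[OF that])
    have "(\<lambda>x. if \<Delta> \<le> lin d (z w) i x then 1 else 0 :: real) \<in> borel_measurable ?M" by measurable
    then show ?thesis by (simp add: indicator_def)
  qed
  have "(\<lambda>x. \<Sum>i\<in>?I. \<Sum>w\<in>B. indicator {\<omega>. \<Delta> \<le> lin d (z w) i \<omega>} x :: real) \<in> borel_measurable ?M"
    by (intro borel_measurable_sum ind)
  then have "{x \<in> space ?M. real (4 * L) \<le> (\<Sum>i\<in>?I. \<Sum>w\<in>B. indicator {\<omega>. \<Delta> \<le> lin d (z w) i \<omega>} x)} \<in> sets ?M"
    by (intro borel_measurable_le) auto
  then have "{x \<in> space ?M. real (4 * L) \<le> real (card (SIGMA i:?I. {w \<in> B. \<Delta> \<le> lin d (z w) i x}))} \<in> sets ?M"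
    unfolding card_heavy_pairs[OF assms(1)] .
  then have 2: "{x \<in> space ?M. 4 * L \<le> card (SIGMA i:?I. {w \<in> B. \<Delta> \<le> lin d (z w) i x})} \<in> sets ?M"
    by (simp only: of_nat_le_iff)
  show ?thesis using sets.Un[OF 1 2] unfolding bad_group_def
    by (elim back_subst[where P = "\<lambda>S. S \<in> sets ?M"]) auto
qed

lemma bad_group_restrict:
  "bad_group d L y z B \<Delta> g (restrict \<omega> {g * L * d..<(g * L + L) * d}) = bad_group d L y z B \<Delta> g \<omega>"
proof -
  have e: "lin d w i (restrict \<omega> {g * L * d..<(g * L + L) * d}) = lin d w i \<omega>" if "i \<in> {g * L..<g * L + L}" for w i
    using lin_restrict group_block[OF that] by blast
  then have "(SIGMA i:{g * L..<g * L + L}. {w \<in> B. \<Delta> \<le> lin d (z w) i (restrict \<omega> {g * L * d..<(g * L + L) * d})}) =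
    (SIGMA i:{g * L..<g * L + L}. {w \<in> B. \<Delta> \<le> lin d (z w) i \<omega>})"
    by (intro Sigma_cong) auto
  then show ?thesis unfolding bad_group_def using e by simp
qed

text \<open>Different groups read disjoint blocks of coins, so they fail independently.\<close>

lemma bad_groups_prob:
  assumes B: "finite B" and G: "0 < G" and half: "\<And>g. g < G \<Longrightarrow> coin.prob {\<omega>. bad_group d L y z B \<Delta> g \<omega>} \<le> 1 / 2"
  shows "coin.prob {\<omega>. \<forall>g<G. bad_group d L y z B \<Delta> g \<omega>} \<le> (1 / 2) ^ G"
proof -
  define K where "K g = {g * L * d..<(g * L + L) * d}" for g
  define A where "A g = {x \<in> space (PiM (K g) (\<lambda>_. std_normal_distribution)). bad_group d L y z B \<Delta> g x}" for g
  have dis: "disjoint_family_on K {..<G}"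
  proof -
    have "K g \<inter> K g' = {}" if "g < g'" for g g'
    proof -
      have "Suc g * L \<le> g' * L" using that by (intro mult_le_mono1) simp
      then have "(g * L + L) * d \<le> g' * L * d" by (intro mult_le_mono1) (simp add: add.commute)
      then show ?thesis by (auto simp: K_def)
    qed
    then show ?thesis unfolding disjoint_family_on_def by (metis Int_commute linorder_neqE_nat)
  qed
  have mem: "restrict \<omega> (K g) \<in> A g \<longleftrightarrow> bad_group d L y z B \<Delta> g \<omega>" for \<omega> :: "nat \<Rightarrow> real" and g
    using bad_group_restrict[of d L y z B \<Delta> g \<omega>] by (auto simp: A_def K_def space_PiM)
  have "coin.prob {\<omega>. \<forall>g\<in>{..<G}. restrict \<omega> (K g) \<in> A g} = (\<Prod>g\<in>{..<G}. coin.prob {\<omega>. restrict \<omega> (K g) \<in> A g})"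
  proof (rule coin_blocks)
    show "A g \<in> sets (PiM (K g) (\<lambda>_. std_normal_distribution))" for g
      unfolding A_def by (rule measurable_bad_group[OF B]) (simp add: K_def)
  qed (use dis G in auto)
  also have "\<dots> \<le> (\<Prod>g\<in>{..<G}. 1 / 2)"
    unfolding mem using half by (intro prod_mono) auto
  finally show ?thesis by (simp add: mem Ball_def)
qed

lemma sets_lin: "{\<omega>. P (lin d y i \<omega>)} \<in> sets coin_space" if "Measurable.pred borel P"
proof -
  have "lin d y i \<in> borel_measurable coin_space"
    unfolding coin_space_def by (rule measurable_lin) simp
  then have "Measurable.pred coin_space (\<lambda>\<omega>. P (lin d y i \<omega>))" using that by measurable
  then show ?thesis by (simp add: pred_def space_coin)
qed

text \<open>A group fails in two ways, each with probability at most 1 / 4. All \<open>L\<close>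
  independent directions miss the far point with probability at most
  \<open>exp (- (p * L)) \<le> exp (- 2)\<close>. The expected number of near pairs is at most
  \<open>L * (card B / N) \<le> L\<close>, and Markov's inequality, here an integral of
  \<open>4 * L\<close> times an indicator, covers the second way.\<close>

lemma bad_group_half:
  assumes B: "finite B" "card B \<le> N" and N: "0 < N"
    and p: "\<And>i. p \<le> coin.prob {\<omega>. \<Delta> \<le> lin d y i \<omega>}" "2 \<le> p * real L"
    and light: "\<And>w i. w \<in> B \<Longrightarrow> coin.prob {\<omega>. \<Delta> \<le> lin d (z w) i \<omega>} \<le> 1 / real N"
  shows "coin.prob {\<omega>. bad_group d L y z B \<Delta> g \<omega>} \<le> 1 / 2"
proof -
  let ?I = "{g * L..<g * L + L}"
  have L: "0 < L" using p(2) by (cases L) auto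
  let ?E1 = "{\<omega>. \<forall>i\<in>?I. lin d y i \<omega> < \<Delta>}"
  let ?c = "\<lambda>\<omega>. card (SIGMA i:?I. {w \<in> B. \<Delta> \<le> lin d (z w) i \<omega>})"
  let ?E2 = "{\<omega>. 4 * L \<le> ?c \<omega>}"
  have E1: "coin.prob ?E1 \<le> 1 / 4"
  proof -
    define K where "K i = {i * d..<i * d + d}" for i
    define A where "A i = {x \<in> space (PiM (K i) (\<lambda>_. std_normal_distribution)). lin d y i x < \<Delta>}" for i
    have dis: "disjoint_family_on K ?I"
    proof -
      have "K i \<inter> K i' = {}" if "i < i'" for i i'
      proof -
        have "Suc i * d \<le> i' * d" using that by (intro mult_le_mono1) simp
        then show ?thesis by (auto simp: K_def)
      qed
      then show ?thesis unfolding disjoint_family_on_def by (metis Int_commute linorder_neqE_nat)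
    qed
    have mem: "restrict \<omega> (K i) \<in> A i \<longleftrightarrow> lin d y i \<omega> < \<Delta>" for \<omega> :: "nat \<Rightarrow> real" and i
      using lin_restrict[of i d "K i" y \<omega>] by (auto simp: A_def K_def space_PiM)
    have "coin.prob {\<omega>. \<forall>i\<in>?I. restrict \<omega> (K i) \<in> A i} = (\<Prod>i\<in>?I. coin.prob {\<omega>. restrict \<omega> (K i) \<in> A i})"
    proof (rule coin_blocks)
      have "lin d y i \<in> borel_measurable (PiM (K i) (\<lambda>_. std_normal_distribution))" for i
        by (rule measurable_lin) (simp add: K_def)
      then show "A i \<in> sets (PiM (K i) (\<lambda>_. std_normal_distribution))" for i
        unfolding A_def by (intro borel_measurable_less) auto
    qed (use dis L in auto)
    then have "coin.prob ?E1 = (\<Prod>i\<in>?I. coin.prob {\<omega>. lin d y i \<omega> < \<Delta>})" by (simp add: mem)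
    also have "\<dots> \<le> (\<Prod>i\<in>?I. exp (- p))"
    proof (intro prod_mono conjI)
      fix i
      have "{\<omega>. lin d y i \<omega> < \<Delta>} = space coin_space - {\<omega>. \<Delta> \<le> lin d y i \<omega>}" by (auto simp: space_coin)
      then have "coin.prob {\<omega>. lin d y i \<omega> < \<Delta>} = 1 - coin.prob {\<omega>. \<Delta> \<le> lin d y i \<omega>}"
        using coin.prob_compl[of "{\<omega>. \<Delta> \<le> lin d y i \<omega>}"] sets_lin[of "\<lambda>x. \<Delta> \<le> x"] by simp
      also have "\<dots> \<le> 1 + - p" using p(1)[of i] by simp
      also have "\<dots> \<le> exp (- p)" by (rule exp_ge_add_one_self)
      finally show "coin.prob {\<omega>. lin d y i \<omega> < \<Delta>} \<le> exp (- p)" .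
    qed simp
    also have "\<dots> = exp (- (p * real L))" by (simp flip: exp_of_nat_mult add: mult.commute)
    also have "\<dots> \<le> exp (- 2)" using p(2) by simp
    also have "\<dots> \<le> 1 / 4"
    proof -
      have "(2::real) * 2 \<le> exp 1 * exp 1" using exp_ge_add_one_self[of 1] by (intro mult_mono) auto
      then have "4 \<le> exp (2::real)" by (simp flip: exp_add)
      then show ?thesis by (simp add: exp_minus field_simps)
    qed
    finally show ?thesis .
  qed
  have m2: "?E2 \<in> sets coin_space"
  proof -
    have [measurable]: "lin d (z w) i \<in> borel_measurable coin_space" for w i
      unfolding coin_space_def by (rule measurable_lin) simp
    have "(\<lambda>x. if \<Delta> \<le> lin d (z w) i x then 1 else 0 :: real) \<in> borel_measurable coin_space" for w i by measurable
    then have ind: "(\<lambda>x. indicator {\<omega>. \<Delta> \<le> lin d (z w) i \<omega>} x :: real) \<in> borel_measurable coin_space" for w i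
      by (simp add: indicator_def)
    have "(\<lambda>x. \<Sum>i\<in>?I. \<Sum>w\<in>B. indicator {\<omega>. \<Delta> \<le> lin d (z w) i \<omega>} x :: real) \<in> borel_measurable coin_space"
      by (intro borel_measurable_sum ind)
    then have "{x \<in> space coin_space. real (4 * L) \<le> real (?c x)} \<in> sets coin_space"
      unfolding card_heavy_pairs[OF B(1)] by (intro borel_measurable_le) auto
    then show ?thesis by (simp only: of_nat_le_iff space_coin) simp
  qed
  have E2: "coin.prob ?E2 \<le> 1 / 4"
  proof -
    have int: "integrable coin_space (\<lambda>\<omega>. indicator {\<omega>. \<Delta> \<le> lin d (z w) i \<omega>} \<omega> :: real)" for i w
      using sets_lin[of "\<lambda>x. \<Delta> \<le> x" d "z w" i] by (intro integrable_real_indicator) (auto simp: coin.emeasure_eq_measure)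
    have "real (4 * L) * coin.prob ?E2 = (\<integral>\<omega>. real (4 * L) * indicator ?E2 \<omega> \<partial>coin_space)"
      using m2 by (simp add: space_coin)
    also have "\<dots> \<le> (\<integral>\<omega>. (\<Sum>i\<in>?I. \<Sum>w\<in>B. indicator {\<omega>. \<Delta> \<le> lin d (z w) i \<omega>} \<omega>) \<partial>coin_space)"
    proof (rule integral_mono)
      show "integrable coin_space (\<lambda>\<omega>. real (4 * L) * indicator ?E2 \<omega>)"
        using m2 by (intro integrable_mult_right integrable_real_indicator) (auto simp: coin.emeasure_eq_measure)
      show "integrable coin_space (\<lambda>\<omega>. \<Sum>i\<in>?I. \<Sum>w\<in>B. indicator {\<omega>. \<Delta> \<le> lin d (z w) i \<omega>} \<omega> :: real)"
        by (intro Bochner_Integration.integrable_sum int)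
      show "real (4 * L) * indicator ?E2 \<omega> \<le> (\<Sum>i\<in>?I. \<Sum>w\<in>B. indicator {\<omega>. \<Delta> \<le> lin d (z w) i \<omega>} \<omega>)" for \<omega>
        unfolding card_heavy_pairs[OF B(1), symmetric] by (auto simp: indicator_def simp del: of_nat_mult)
    qed
    also have "\<dots> = (\<Sum>i\<in>?I. \<Sum>w\<in>B. coin.prob {\<omega>. \<Delta> \<le> lin d (z w) i \<omega>})"
      using int sets_lin[of "\<lambda>x. \<Delta> \<le> x"] by (simp add: space_coin)
    also have "\<dots> \<le> (\<Sum>i\<in>?I. \<Sum>w\<in>B. 1 / real N)" using light by (intro sum_mono) auto
    also have "\<dots> = real L * (real (card B) / real N)" by simp
    also have "\<dots> \<le> real L * 1" using B(2) N by (intro mult_left_mono) auto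
    finally show ?thesis using L by simp
  qed
  have "?E1 \<in> sets coin_space"
  proof -
    have "{\<omega> \<in> space coin_space. \<forall>i\<in>?I. lin d y i \<omega> < \<Delta>} \<in> sets coin_space"
      using sets_lin[of "\<lambda>x. x < \<Delta>"] by (intro sets.sets_Collect_finite_All) (auto simp: space_coin)
    then show ?thesis by (simp add: space_coin)
  qed
  then have "coin.prob (?E1 \<union> ?E2) \<le> coin.prob ?E1 + coin.prob ?E2" using m2 by (intro measure_Un_le)
  moreover have "{\<omega>. bad_group d L y z B \<Delta> g \<omega>} = ?E1 \<union> ?E2" by (auto simp: bad_group_def)
  ultimately show ?thesis using E1 E2 by simp
qed

section \<open>Operation sequences and failure probability\<close>

fun after :: "point set set \<Rightarrow> operation list \<Rightarrow> point set set" where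
  "after \<P> [] = \<P>"
| "after \<P> (Query S q # ops) = after \<P> ops"
| "after \<P> (Merge S S' # ops) = after (insert (S \<union> S') (\<P> - {S, S'})) ops"

lemma admissible_append:
  "admissible X \<P> (ops @ ops') \<longleftrightarrow> admissible X \<P> ops \<and> admissible X (after \<P> ops) ops'"
  by (induction X \<P> ops rule: admissible.induct) auto

lemma after_append: "after \<P> (ops @ ops') = after (after \<P> ops) ops'"
  by (induction \<P> ops rule: after.induct) auto

lemma op_step_deterministic: "op_step m D xs c opn t1 c1 \<Longrightarrow> op_step m D xs c opn t2 c2 \<Longrightarrow> c1 = c2"
  by (auto elim!: op_step.cases dest: big_step_deterministic)

context afn
begin

lemma op_step_inv:
  assumes "ds_inv \<P> c" "admissible (set xs) \<P> [opn]"
  shows "\<exists>t c'. op_step m afn_structure xs c opn t c' \<and> ds_inv (after \<P> [opn]) c'"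
proof (cases opn)
  case (Query S q)
  then show ?thesis using query_step[of \<P> "fst c" "snd c" S q] assms by auto
next
  case (Merge S S')
  then show ?thesis using merge_step[of \<P> "fst c" "snd c" S S'] assms by auto
qed

text \<open>\<open>run\<close> is a relation, whereas the step lemmas provide one execution with the
  invariant; determinism identifies that execution with the given one.\<close>

lemma run_inv:
  assumes "run m afn_structure xs d \<alpha> \<omega> ops c" "admissible (set xs) (singletons (set xs)) ops"
  shows "ds_inv (after (singletons (set xs)) ops) c"
  using assms
proof (induction rule: run.induct)
  case (Init t s)
  obtain t' s' where "big_step m init_prog (start xs d \<alpha> \<omega>) t' s'"
    "ds_inv (singletons (set xs)) (s', \<lambda>S. position xs (the_elem S))"
    using initialize_step by blast
  moreover from this Init have "s' = s" using big_step_deterministic by (fastforce simp: afn_structure_def)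
  ultimately show ?case by simp
next
  case (Step ops c opn t c')
  have adm: "admissible (set xs) (singletons (set xs)) ops"
    "admissible (set xs) (after (singletons (set xs)) ops) [opn]"
    using Step.prems by (auto simp: admissible_append)
  obtain t' c'' where "op_step m afn_structure xs c opn t' c''" "ds_inv (after (after (singletons (set xs)) ops) [opn]) c''"
    using op_step_inv[OF Step.IH[OF adm(1)] adm(2)] by blast
  moreover have "c'' = c'" using op_step_deterministic[OF _ Step.hyps(2)] calculation(1) by blast
  ultimately show ?case by (simp add: after_append)
qed

lemma run_exists:
  assumes "admissible (set xs) (singletons (set xs)) ops"
  shows "\<exists>c. run m afn_structure xs d \<alpha> \<omega> ops c"
  using assms
proof (induction ops rule: rev_induct)
  case Nil
  then show ?case using initialize_step run.Init[of m afn_structure xs d \<alpha> \<omega>] by (auto simp: afn_structure_def)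
next
  case (snoc opn ops)
  then obtain c where c: "run m afn_structure xs d \<alpha> \<omega> ops c" by (auto simp: admissible_append)
  then have "ds_inv (after (singletons (set xs)) ops) c" using run_inv snoc.prems by (auto simp: admissible_append)
  then obtain t c' where "op_step m afn_structure xs c opn t c'"
    using op_step_inv[of _ c opn] snoc.prems unfolding admissible_append by blast
  then show ?case using run.Step[OF c] by blast
qed

lemma query_run:
  assumes "admissible (set xs) (singletons (set xs)) (ops @ [Query S q])" "run m afn_structure xs d \<alpha> \<omega> ops c"
  shows "\<exists>t c'. op_step m afn_structure xs c (Query S q) t c' \<and> t \<le> query_time"
proof -
  obtain s h where c: "c = (s, h)" by (cases c)
  have "ds_inv (after (singletons (set xs)) ops) (s, h)" using run_inv[OF assms(2)] assms(1) c by (auto simp: admissible_append)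
  from query_step[OF this] show ?thesis using assms(1) c by (fastforce simp: admissible_append)
qed

lemma cluster_nonempty:
  assumes "admissible (set xs) (singletons (set xs)) ops" "S \<in> after (singletons (set xs)) ops"
  shows "S \<noteq> {}" "S \<subseteq> set xs"
proof -
  obtain c where "run m afn_structure xs d \<alpha> \<omega> ops c" using run_exists assms(1) by blast
  then have "ds_inv (after (singletons (set xs)) ops) c" using run_inv assms(1) by blast
  then have "is_partition (after (singletons (set xs)) ops)" by (cases c) (simp add: ds_inv_def)
  then show "S \<noteq> {}" "S \<subseteq> set xs" using assms(2) by (auto simp: is_partition_def)
qed

lemma merge_run:
  assumes "admissible (set xs) (singletons (set xs)) (ops @ [Merge S S'])" "run m afn_structure xs d \<alpha> \<omega> ops c"
  shows "\<exists>t c'. op_step m afn_structure xs c (Merge S S') t c' \<and> t \<le> merge_time"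
    and "1 \<le> card S" "1 \<le> card S'"
proof -
  obtain s h where c: "c = (s, h)" by (cases c)
  have "ds_inv (after (singletons (set xs)) ops) (s, h)" using run_inv[OF assms(2)] assms(1) c by (auto simp: admissible_append)
  from merge_step[OF this] show "\<exists>t c'. op_step m afn_structure xs c (Merge S S') t c' \<and> t \<le> merge_time"
    using assms(1) c by (fastforce simp: admissible_append)
  have "S \<noteq> {}" "S \<subseteq> set xs" "S' \<noteq> {}" "S' \<subseteq> set xs"
    using cluster_nonempty[of ops] assms(1) by (auto simp: admissible_append)
  then show "1 \<le> card S" "1 \<le> card S'"
    by (auto simp: Suc_le_eq card_gt_0_iff intro: finite_subset)
qed

section \<open>The failure event of a query\<close>

definition radius :: "point set \<Rightarrow> point \<Rightarrow> real" where "radius S q = Max (l2 q ` S)"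

text \<open>The inequality is strict, so the points of \<open>S\<close> outside this set are exactly
  the approximate farthest neighbors.\<close>

definition near :: "point set \<Rightarrow> point \<Rightarrow> nat set" where
  "near S q = {w \<in> pos S. l2 q (xs ! w) < radius S q / \<alpha>}"

text \<open>Neither the operations nor the machine state occur, so a bound for the complement
  applies after every admissible sequence. The threshold is left open here and is chosen only when
  the probability is estimated.\<close>

definition success :: "point set \<Rightarrow> point \<Rightarrow> (nat \<Rightarrow> real) \<Rightarrow> bool" where
  "success S q \<omega>' \<longleftrightarrow> (\<exists>\<Delta> y g. y \<in> pos S - near S q \<and> g < 3 * b \<and>
     good_group (\<lambda>i x. \<Sum>j<d. \<omega>' (i * d + j) * xs ! x ! j) (pos S) (position xs q) (near S q) \<Delta> y g)"

lemma success_query: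
  assumes adm: "admissible (set xs) (singletons (set xs)) (ops @ [Query S q])" and "success S q \<omega>"
  shows "query_succeeds m afn_structure xs d \<alpha> \<omega> ops S q"
proof -
  obtain c where run: "run m afn_structure xs d \<alpha> \<omega> ops c" using run_exists adm unfolding admissible_append by blast
  obtain s h where c: "c = (s, h)" by (cases c)
  have adm': "admissible (set xs) (singletons (set xs)) ops" "S \<in> after (singletons (set xs)) ops" "q \<in> set xs"
    using adm by (auto simp: admissible_append)
  have "ds_inv (after (singletons (set xs)) ops) (s, h)" using run_inv[OF run adm'(1)] c by simp
  from query_step[OF this adm'(2,3)]
  obtain t s' where os: "op_step m afn_structure xs (s, h) (Query S q) t (s', h)" and r: "ireg s' 0 \<in> pos S"
    and far: "\<forall>g<3 * b. \<forall>B \<Delta> y. good_group proj (pos S) (position xs q) B \<Delta> y g \<longrightarrow> y \<in> pos S - B \<longrightarrow>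
       (\<exists>w\<in>pos S - B. l2 q (xs ! w) \<le> l2 q (xs ! ireg s' 0))"
    by blast
  have pe: "proj = (\<lambda>i x. \<Sum>j<d. \<omega> (i * d + j) * xs ! x ! j)" by (intro ext) (simp add: proj_def)
  obtain w where w: "w \<in> pos S - near S q" "l2 q (xs ! w) \<le> l2 q (xs ! ireg s' 0)"
    using assms(2) far unfolding success_def pe by blast
  then have "radius S q / \<alpha> \<le> l2 q (xs ! ireg s' 0)" by (auto simp: near_def)
  then have "approx_farthest \<alpha> S q (xs ! ireg s' 0)"
    using r by (simp add: approx_farthest_def radius_def pos_def)
  moreover have "ireg s' 0 < length xs" using r len by (simp add: pos_def)
  ultimately show ?thesis unfolding query_succeeds_def using run os c by blast
qed

text \<open>
  With this choice a fixed near point exceeds the threshold with probability at most \<open>2\<^sup>-\<^sup>b < 1 / n\<close>, and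
  the farthest point with probability about \<open>2 powr (- b / \<alpha>\<^sup>2)\<close>, which is at least \<open>1 / W\<close>.
\<close>

definition threshold :: real where "threshold = sqrt (2 * real b * ln 2)"

definition delta :: "point \<Rightarrow> nat \<Rightarrow> nat \<Rightarrow> real" where "delta q w j = xs ! w ! j - q ! j"

lemma l2_delta:
  assumes "q \<in> set xs" shows "l2 q (xs ! w) = sqrt (\<Sum>j<d. (delta q w j)\<^sup>2)"
proof -
  have "length q = d" using dims assms by auto
  then show ?thesis by (simp add: l2_def L2_set_def delta_def power2_commute)
qed

text \<open>As \<open>2 * ln 2\<close> is below \<open>1.69 = 1.3 ^ 2\<close> and
  \<open>b \<ge> 1\<close>, the threshold is at most \<open>1.3 * b\<close>.\<close>

lemma threshold_bounds: "0 < threshold" "1 + threshold \<le> 23 / 10 * real b" "threshold\<^sup>2 = 2 * real b * ln 2"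
proof -
  have b1: "1 \<le> real b" using b_pos by simp
  show "0 < threshold" using b_pos by (simp add: threshold_def)
  show "threshold\<^sup>2 = 2 * real b * ln 2" by (simp add: threshold_def)
  have "2 * real b * ln 2 \<le> 2 * real b * (25 / 36)" using ln2_le_25_over_36 by (intro mult_left_mono) auto
  also have "\<dots> \<le> 169 / 100 * (real b * 1)" by simp
  also have "\<dots> \<le> 169 / 100 * (real b * real b)" using b1 by (intro mult_left_mono) auto
  also have "\<dots> = (13 / 10 * real b)\<^sup>2" by (simp add: power2_eq_square)
  finally have "threshold \<le> 13 / 10 * real b" unfolding threshold_def by (intro real_le_lsqrt) auto
  then show "1 + threshold \<le> 23 / 10 * real b" using b1 by linarith
qed

lemma exp_threshold: "exp (- threshold\<^sup>2 / 2) = 1 / 2 ^ b"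
proof -
  have "exp (- threshold\<^sup>2 / 2) = exp (- (real b * ln 2))" using threshold_bounds(3) by simp
  also have "\<dots> = 1 / exp (ln 2) ^ b" by (simp add: exp_minus exp_of_nat_mult inverse_eq_divide)
  finally show ?thesis by simp
qed

text \<open>At \<open>x = threshold / \<alpha>\<close> the factor \<open>exp (x\<^sup>2 / 2)\<close>
  is \<open>2 powr (b / \<alpha>\<^sup>2)\<close>, at most \<open>2 ^ e = W\<close>. The remaining
  factor is at most \<open>27 / 2 * (23 / 10 * b)\<close>, below \<open>32 * b\<close>. The
  probability is wanted as \<open>2 / L\<close>, and doubling 32 gives the 64 in
  \<open>L\<close>.\<close>

lemma far_probability:
  assumes "distributed coin_space lborel X (normal_density 0 \<sigma>)" "0 < \<sigma>"
  shows "2 / real L \<le> coin.prob {\<omega>. \<sigma> * (threshold / \<alpha>) \<le> X \<omega>}"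
proof -
  let ?x = "threshold / \<alpha>"
  have x0: "0 \<le> ?x" using threshold_bounds(1) \<alpha> by simp
  have "?x \<le> threshold" using threshold_bounds(1) \<alpha> by (simp add: field_simps)
  then have x1: "1 + ?x \<le> 23 / 10 * real b" using threshold_bounds(2) by linarith
  have "?x\<^sup>2 / 2 = real b / \<alpha>\<^sup>2 * ln 2" using threshold_bounds(3) by (simp add: power_divide)
  also have "\<dots> \<le> real e * ln 2" using e_lower \<alpha> by (intro mult_right_mono) (auto simp: field_simps)
  finally have "exp (?x\<^sup>2 / 2) \<le> exp (real e * ln 2)" by simp
  also have "\<dots> = real W" using W_eq by (simp add: exp_of_nat_mult)
  finally have ex: "exp (?x\<^sup>2 / 2) \<le> real W" .
  have "27 / 2 * (1 + ?x) * exp (?x\<^sup>2 / 2) \<le> 27 / 2 * (23 / 10 * real b) * real W"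
    using x1 x0 ex by (intro mult_mono) auto
  also have "\<dots> \<le> 32 * real b * real W" using b_pos W_pos by simp
  finally have "27 / 2 * (1 + ?x) * exp (?x\<^sup>2 / 2) \<le> real L / 2" by (simp add: L_def mult.commute mult.left_commute)
  moreover have "0 < 27 / 2 * (1 + ?x) * exp (?x\<^sup>2 / 2)" using x0 by simp
  ultimately have "1 / (real L / 2) \<le> 1 / (27 / 2 * (1 + ?x) * exp (?x\<^sup>2 / 2))"
    by (intro divide_left_mono) auto
  also have "\<dots> = exp (- ?x\<^sup>2 / 2) / (27 / 2 * (1 + ?x))" by (simp add: exp_minus field_simps)
  also have "\<dots> \<le> coin.prob {\<omega>. \<sigma> * ?x \<le> X \<omega>}"
    using normal_lower_tail[OF assms x0] by (simp add: space_coin)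
  finally show ?thesis by simp
qed

text \<open>The event that all groups are bad is measurable and contains the failure. Both tails are
  taken at the same value \<open>\<Delta> = r * threshold / \<alpha>\<close>: it is
  \<open>threshold / \<alpha>\<close> standard deviations for the farthest point, but at least
  \<open>threshold\<close> of them for a near point.\<close>

lemma failure_probability:
  assumes S: "S \<subseteq> set xs" "S \<noteq> {}" and q: "q \<in> set xs"
  shows "\<exists>E\<in>sets coin_space. {\<omega>'. \<not> success S q \<omega>'} \<subseteq> E \<and> measure coin_space E \<le> 1 / real n ^ 3"
proof -
  define q' where "q' = position xs q"
  have q': "q' < n" "xs ! q' = q" using position_less[OF q] by (auto simp: q'_def)
  define r where "r = radius S q"
  have finS: "finite S" using S(1) finite_subset by blast
  have "r \<in> l2 q ` S" unfolding r_def radius_def using finS S(2) by (intro Max_in) auto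
  then obtain p where p: "p \<in> S" "r = l2 q p" by auto
  then obtain y where y: "y < n" "xs ! y = p" using S(1) len by (auto simp: in_set_conv_nth subset_iff)
  have ry: "r = l2 q (xs ! y)" and yS: "y \<in> pos S" using p y by (auto simp: pos_def)
  have r0: "0 \<le> r" unfolding ry by (simp add: l2_def)
  have "r * 1 \<le> r * \<alpha>" using r0 \<alpha> by (intro mult_left_mono) auto
  then have yn: "y \<in> pos S - near S q"
    using yS \<alpha> by (simp add: near_def ry[symmetric] r_def[symmetric] field_simps)
  define \<Delta> where "\<Delta> = r * (threshold / \<alpha>)"
  define B where "B = near S q"
  have fB: "finite B" "card B \<le> 2 ^ b"
  proof -
    have sub: "B \<subseteq> {..<n}" by (auto simp: B_def near_def pos_def)
    then show "finite B" using finite_subset by blast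
    have "card B \<le> n" using card_mono[OF _ sub] by simp
    then show "card B \<le> 2 ^ b" using n_upper by simp
  qed
  define E where "E = {\<omega>. \<forall>g<3 * b. bad_group d L (delta q y) (delta q) B \<Delta> g \<omega>}"
  have le: "(\<Sum>j<d. \<omega>' (i * d + j) * xs ! w ! j) - (\<Sum>j<d. \<omega>' (i * d + j) * xs ! q' ! j) = lin d (delta q w) i \<omega>'"
    for \<omega>' :: "nat \<Rightarrow> real" and i w
    by (simp add: lin_def delta_def q' sum_subtractf[symmetric] algebra_simps)
  have good: "success S q \<omega>'" if g: "g < 3 * b" "\<not> bad_group d L (delta q y) (delta q) B \<Delta> g \<omega>'" for g \<omega>'
  proof -
    let ?v = "\<lambda>i x. \<Sum>j<d. \<omega>' (i * d + j) * xs ! x ! j"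
    have BB: "pos S \<inter> B = B" by (auto simp: B_def near_def)
    have "good_group ?v (pos S) q' B \<Delta> y g"
      unfolding good_group_def heavy_def BB le using g(2) unfolding bad_group_def by (auto simp: not_less not_le)
    then show ?thesis unfolding success_def using yn g(1) unfolding q'_def B_def by blast
  qed
  then have sub: "{\<omega>'. \<not> success S q \<omega>'} \<subseteq> E" by (auto simp: E_def)
  have meas: "E \<in> sets coin_space"
  proof -
    have "{x \<in> space coin_space. bad_group d L (delta q y) (delta q) B \<Delta> g x} \<in> sets coin_space" for g
      using measurable_bad_group[OF fB(1), of g L d UNIV "delta q y" "delta q" \<Delta>] by (simp add: coin_space_def)
    then have "{x \<in> space coin_space. \<forall>g\<in>{..<3 * b}. bad_group d L (delta q y) (delta q) B \<Delta> g x} \<in> sets coin_space"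
      by (intro sets.sets_Collect_finite_All) auto
    then show ?thesis by (simp add: E_def space_coin Ball_def)
  qed
  have half: "coin.prob {\<omega>. bad_group d L (delta q y) (delta q) B \<Delta> g \<omega>} \<le> 1 / 2" for g
  \<comment> \<open>For \<open>r = 0\<close> the projections have variance 0 and no density. But
    then no point is near, \<open>\<Delta>\<close> is 0, and every direction reaches it, so no group
    is bad.\<close>
  proof (cases "r = 0")
    case True
    have "(\<Sum>j<d. (delta q y j)\<^sup>2) = 0" using True ry l2_delta[OF q, of y] by simp
    then have "delta q y j = 0" if "j < d" for j using that by (simp add: sum_nonneg_eq_0_iff)
    then have "lin d (delta q y) i \<omega> = 0" for i \<omega> by (simp add: lin_def)
    moreover have "B = {}" using True by (auto simp: B_def near_def r_def[symmetric] l2_def not_less)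
    ultimately have "{\<omega>. bad_group d L (delta q y) (delta q) B \<Delta> g \<omega>} = {}"
      using True L_pos by (auto simp: bad_group_def \<Delta>_def)
    then show ?thesis by simp
  next
    case False
    then have rp: "0 < r" using r0 by simp
    show ?thesis
    proof (rule bad_group_half[OF fB, where p = "2 / real L"])
      show "2 / real L \<le> coin.prob {\<omega>. \<Delta> \<le> lin d (delta q y) i \<omega>}" for i
      proof -
        have "0 < (\<Sum>j<d. (delta q y j)\<^sup>2)" using rp unfolding ry l2_delta[OF q] by simp
        from lin_distributed[OF this, of i]
        have "distributed coin_space lborel (lin d (delta q y) i) (normal_density 0 r)"
          unfolding ry l2_delta[OF q] .
        from far_probability[OF this rp] show ?thesis by (simp add: \<Delta>_def)
      qed
      show "2 \<le> 2 / real L * real L" using L_pos by simp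
      show "coin.prob {\<omega>. \<Delta> \<le> lin d (delta q w) i \<omega>} \<le> 1 / real (2 ^ b)" if w: "w \<in> B" for w i
      proof -
        let ?\<sigma> = "l2 q (xs ! w)"
        have \<sigma>: "?\<sigma> < r / \<alpha>" "0 \<le> ?\<sigma>" using w by (auto simp: B_def near_def r_def l2_def)
        have \<Delta>0: "0 < \<Delta>" using rp threshold_bounds(1) \<alpha> by (simp add: \<Delta>_def)
        show ?thesis
        \<comment> \<open>The query itself may be a near point. Its projection is constantly 0,
          which is below the positive \<open>\<Delta>\<close>.\<close>
        proof (cases "?\<sigma> = 0")
          case True
          then have "(\<Sum>j<d. (delta q w j)\<^sup>2) = 0" using l2_delta[OF q, of w] by simp
          then have "delta q w j = 0" if "j < d" for j using that by (simp add: sum_nonneg_eq_0_iff)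
          then have "lin d (delta q w) i \<omega> = 0" for \<omega> by (simp add: lin_def)
          then have "{\<omega>. \<Delta> \<le> lin d (delta q w) i \<omega>} = {}" using \<Delta>0 by simp
          then show ?thesis by simp
        next
          case False
          then have \<sigma>p: "0 < ?\<sigma>" using \<sigma> by simp
          then have "0 < (\<Sum>j<d. (delta q w j)\<^sup>2)" unfolding l2_delta[OF q] by simp
          from lin_distributed[OF this, of i]
          have "distributed coin_space lborel (lin d (delta q w) i) (normal_density 0 ?\<sigma>)"
            unfolding l2_delta[OF q] .
          from normal_upper_tail[OF this \<sigma>p, of \<Delta>] \<Delta>0
          have "coin.prob {\<omega>. \<Delta> \<le> lin d (delta q w) i \<omega>} \<le> exp (- (\<Delta> / ?\<sigma>)\<^sup>2 / 2)"
            by (simp add: space_coin)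
          also have "\<dots> \<le> exp (- threshold\<^sup>2 / 2)"
          proof -
            have "threshold * ?\<sigma> \<le> \<Delta>"
              using mult_left_mono[of ?\<sigma> "r / \<alpha>" threshold] \<sigma> threshold_bounds(1) by (simp add: \<Delta>_def mult.commute)
            then have "threshold \<le> \<Delta> / ?\<sigma>" using \<sigma>p by (simp add: field_simps)
            then have "threshold\<^sup>2 \<le> (\<Delta> / ?\<sigma>)\<^sup>2" using threshold_bounds(1) by (intro power_mono) auto
            then show ?thesis by simp
          qed
          finally show ?thesis unfolding exp_threshold by simp
        qed
      qed
    qed simp
  qed
  have "measure coin_space E \<le> (1 / 2) ^ (3 * b)"
    unfolding E_def using b_pos by (intro bad_groups_prob fB half) simp
  also have "\<dots> = 1 / (2 ^ b) ^ 3" by (simp add: power_divide mult.commute flip: power_mult)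
  also have "\<dots> \<le> 1 / real n ^ 3"
  proof (intro divide_left_mono power_mono)
    show "real n \<le> 2 ^ b" using n_upper by (metis less_imp_le numeral_power_le_of_nat_cancel_iff of_nat_le_numeral_power_cancel_iff)
  qed (use n_pos in auto)
  finally show ?thesis using sub meas by blast
qed

end

section \<open>Asymptotics\<close>

text \<open>Minimality of \<open>e\<close> gives \<open>e - 1 < b / \<alpha>\<^sup>2\<close>, and
  \<open>2 ^ b \<le> 2 * n\<close>. Hence \<open>2 ^ e\<close> is at most
  \<open>2 * (2 * n) powr (1 / \<alpha>\<^sup>2)\<close>, where the inner 2 contributes at most
  another factor 2 because the exponent is at most 1.\<close>

lemma sizes_exist:
  fixes n :: nat and \<alpha> :: real
  assumes n: "1 \<le> n" and \<alpha>: "1 < \<alpha>"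
  obtains b e where "0 < b" "2 ^ (b - 1) \<le> n" "n < 2 ^ b" "real b \<le> real e * \<alpha>\<^sup>2" "\<And>k. k < e \<Longrightarrow> real k * \<alpha>\<^sup>2 < real b"
    "e \<le> b" "2 ^ e \<le> 4 * real n powr (1 / \<alpha>\<^sup>2)" "real b \<le> 2 * log 2 (real n + 1)"
proof -
  define b where "b = (LEAST b. n < 2 ^ b)"
  have nb: "n < 2 ^ b" unfolding b_def by (rule LeastI[of _ n]) simp
  have b0: "0 < b" using nb n by (cases b) auto
  have nl: "2 ^ (b - 1) \<le> n"
    using not_less_Least[of "b - 1" "\<lambda>b. n < 2 ^ b"] b0 by (simp add: b_def[symmetric] not_less)
  have a2: "1 < \<alpha>\<^sup>2" using \<alpha> by (simp add: power2_eq_square less_1_mult)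
  define e where "e = (LEAST e. real b \<le> real e * \<alpha>\<^sup>2)"
  have bb: "real b \<le> real b * \<alpha>\<^sup>2" using a2 mult_left_mono[of 1 "\<alpha>\<^sup>2" "real b"] by simp
  have el: "real b \<le> real e * \<alpha>\<^sup>2" unfolding e_def by (rule LeastI[of _ b]) (rule bb)
  have eu: "real k * \<alpha>\<^sup>2 < real b" if "k < e" for k
    using not_less_Least[of k "\<lambda>e. real b \<le> real e * \<alpha>\<^sup>2"] that by (simp add: e_def not_le)
  have eb: "e \<le> b" unfolding e_def by (rule Least_le) (rule bb)
  have e0: "0 < e" using el b0 by (cases e) auto
  have two: "2 ^ b \<le> 2 * real n"
  proof -
    have "(2::nat) ^ b = 2 * 2 ^ (b - 1)" using b0 by (cases b) auto
    then have "2 ^ b \<le> 2 * n" using nl by simp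
    then have "real (2 ^ b) \<le> real (2 * n)" by (simp only: of_nat_le_iff)
    then show ?thesis by simp
  qed
  have W: "2 ^ e \<le> 4 * real n powr (1 / \<alpha>\<^sup>2)"
  proof -
    have "real (e - 1) * \<alpha>\<^sup>2 < real b" using eu[of "e - 1"] e0 by simp
    moreover have "0 < \<alpha>\<^sup>2" using a2 by linarith
    ultimately have "real (e - 1) \<le> real b / \<alpha>\<^sup>2" by (simp only: pos_le_divide_eq less_imp_le)
    then have "real e - 1 \<le> real b / \<alpha>\<^sup>2" using e0 by (simp add: of_nat_diff)
    then have "(2::real) powr real e \<le> 2 powr (1 + real b * (1 / \<alpha>\<^sup>2))" by (intro powr_mono) auto
    also have "\<dots> = 2 * (2 powr real b) powr (1 / \<alpha>\<^sup>2)" by (simp only: powr_add powr_powr) simp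
    also have "2 powr real b = (2::real) ^ b" by (simp add: powr_realpow)
    also have "2 * ((2::real) ^ b) powr (1 / \<alpha>\<^sup>2) \<le> 2 * (2 * real n) powr (1 / \<alpha>\<^sup>2)"
      using two by (intro mult_left_mono powr_mono2) auto
    also have "(2 * real n) powr (1 / \<alpha>\<^sup>2) = 2 powr (1 / \<alpha>\<^sup>2) * real n powr (1 / \<alpha>\<^sup>2)"
      by (simp add: powr_mult)
    also have "2 * (2 powr (1 / \<alpha>\<^sup>2) * real n powr (1 / \<alpha>\<^sup>2)) \<le> 2 * (2 powr 1 * real n powr (1 / \<alpha>\<^sup>2))"
    proof -
      have "1 / \<alpha>\<^sup>2 \<le> 1" using a2 by (subst divide_le_eq_1) auto
      then show ?thesis by (intro mult_left_mono mult_right_mono powr_mono) auto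
    qed
    finally show ?thesis by (simp add: powr_realpow)
  qed
  have lg: "real b \<le> 2 * log 2 (real n + 1)"
  proof -
    have "real b = log 2 (2 ^ b)" by simp
    also have "\<dots> \<le> log 2 (2 * (real n + 1))" using two by (subst log_le_cancel_iff) auto
    also have "\<dots> = 1 + log 2 (real n + 1)" by (subst log_mult) (auto simp: add_nonneg_eq_0_iff)
    finally have "real b \<le> 1 + log 2 (real n + 1)" .
    moreover have "1 \<le> log 2 (real n + 1)" using n by simp
    ultimately show ?thesis by linarith
  qed
  show thesis using that b0 nl nb el eu eb W lg by blast
qed

context sizes
begin

text \<open>Everything is measured in powers of \<open>b + d\<close>, which is logarithmic in
  \<open>n\<close> under the assumption on the dimension.\<close>

lemma size_bounds:
  shows "Q \<le> 192 * (b + d) ^ 2 * W" "Z \<le> 320 * (b + d) ^ 2 * W" "M \<le> 256 * (b + d) ^ 2 * W"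
proof -
  have bb: "b * b \<le> (b + d) ^ 2" unfolding power2_eq_square by (intro mult_le_mono) auto
  have bbW: "b * b * W \<le> (b + d) ^ 2 * W" using bb by (rule mult_le_mono1)
  have "Q = 192 * (b * b * W)" "Z = 320 * (b * b * W)" "M = 256 * (b * b * W)"
    by (simp_all add: Q_def Z_def M_def L_def)
  then show "Q \<le> 192 * (b + d) ^ 2 * W" "Z \<le> 320 * (b + d) ^ 2 * W" "M \<le> 256 * (b + d) ^ 2 * W" using bbW by linarith+
qed

lemma power_W_mono: "k \<le> l \<Longrightarrow> (b + d) ^ k * W \<le> (b + d) ^ l * W"
  using b_pos by (intro mult_le_mono1 power_increasing) auto

lemma one_le_power_W: "1 \<le> (b + d) ^ k * W"
  using b_pos W_pos by (simp add: Suc_le_eq)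

text \<open>A group makes \<open>4 * L * b\<close> pops, that is \<open>O(b\<^sup>2 * W)\<close>, of
  \<open>O(b + d)\<close> steps each; the \<open>3 * b\<close> groups raise this to the fourth power
  of \<open>b + d\<close>.\<close>

lemma query_time_bound: "query_time \<le> 200000 * ((b + d) ^ 4 * W)"
proof -
  let ?s = "b + d"
  have s: "1 \<le> ?s" using b_pos by simp
  have "28 + 4 * d + 15 * depth \<le> 227 * ?s" using b_pos by (simp add: depth_def)
  then have "M * (28 + 4 * d + 15 * depth) \<le> (256 * ?s ^ 2 * W) * (227 * ?s)"
    using size_bounds(3) by (intro mult_le_mono)
  also have "\<dots> = 58112 * (?s ^ 3 * W)" by (simp add: power2_eq_square power3_eq_cube)
  finally have "group_time \<le> 61639 * (?s ^ 3 * W)"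
    using size_bounds(2) power_W_mono[of 2 3] one_le_power_W[of 3] unfolding group_time_def by linarith
  then have "group_time + 2 \<le> 61641 * (?s ^ 3 * W)" using one_le_power_W[of 3] by linarith
  then have "3 * b * (group_time + 2) \<le> (3 * ?s) * (61641 * (?s ^ 3 * W))" by (intro mult_le_mono) auto
  also have "\<dots> = 184923 * (?s ^ 4 * W)" by (simp add: power_numeral_reduce)
  finally show ?thesis using one_le_power_W[of 4] unfolding query_time_def by linarith
qed

lemma merge_time_bound: "merge_time \<le> 200000 * ((b + d) ^ 4 * W)"
proof -
  let ?s = "b + d"
  have "16 + Q * 8 \<le> 1552 * (?s ^ 2 * W)" using size_bounds(1) one_le_power_W[of 2] by linarith
  then have "b * (16 + Q * 8) \<le> ?s * (1552 * (?s ^ 2 * W))" by (intro mult_le_mono) auto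
  also have "\<dots> = 1552 * (?s ^ 3 * W)" by (simp add: power2_eq_square power3_eq_cube)
  finally show ?thesis using one_le_power_W[of 4] power_W_mono[of 3 4] unfolding merge_time_def by linarith
qed

end

text \<open>The dominant cost is one multiplication for each direction, point and
  coordinate.\<close>

lemma (in afn) init_time_bound: "init_time \<le> 200000 * ((b + d) ^ 4 * W) * n"
proof -
  let ?s = "b + d"
  have s: "1 \<le> ?s" using b_pos by simp
  define T where "T = ?s * n"
  define U where "U = (?s ^ 4 * W) * n"
  have sT: "?s \<le> T" "n \<le> T" "d * n \<le> T" using n_pos s by (simp_all add: T_def)
  have "row_time + 2 = 8 + n * 3 + d * 5 + d * n * 3" by (simp add: row_time_def algebra_simps)
  then have "row_time + 2 \<le> 19 * T" using sT s by linarith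
  then have "Q * (row_time + 2) \<le> (192 * ?s ^ 2 * W) * (19 * T)" using size_bounds(1) by (intro mult_le_mono)
  also have "\<dots> = 3648 * ((?s ^ 3 * W) * n)" by (simp add: T_def power2_eq_square power3_eq_cube)
  also have "\<dots> \<le> 3648 * U" unfolding U_def by (intro mult_le_mono2 mult_le_mono mult_le_mono2 order_refl power_increasing) (use s in auto)
  finally have 1: "Q * (row_time + 2) \<le> 3648 * U" .
  have "?s \<le> ?s * W" using W_pos by simp
  also have "\<dots> \<le> ?s ^ 4 * W" using power_W_mono[of 1 4] by simp
  finally have "T \<le> U" unfolding T_def U_def by (rule mult_le_mono1)
  then have "init_time \<le> 200000 * U" using 1 sT s unfolding init_time_def by linarith
  then show ?thesis by (simp add: U_def mult.assoc)
qed

theorem theorem5: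
  shows "\<exists>D. sample_free (query D) \<and> sample_free (merge D) \<and>
    (\<forall>\<alpha>>1. \<forall>C>0. \<exists>K k. \<forall>n d m xs.
       n \<ge> 1 \<and> real d \<le> C * log 2 (real n + 1) \<and>
       length xs = n \<and> distinct xs \<and> (\<forall>p\<in>set xs. length p = d) \<and>
       m = nat \<lfloor>polylog K k n * real n powr (1 + 1 / \<alpha>\<^sup>2)\<rfloor> \<longrightarrow>
       (\<forall>\<omega>. \<exists>t s. big_step m (initialize D) (start xs d \<alpha> \<omega>) t s \<and>
          real t \<le> polylog K k n * real n powr (1 + 1 / \<alpha>\<^sup>2)) \<and>
       (\<forall>\<omega> ops S q c.
          admissible (set xs) (singletons (set xs)) (ops @ [Query S q]) \<and>
          run m D xs d \<alpha> \<omega> ops c \<longrightarrow>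
          (\<exists>t c'. op_step m D xs c (Query S q) t c' \<and>
             real t \<le> polylog K k n * real n powr (1 / \<alpha>\<^sup>2))) \<and>
       (\<forall>\<omega> ops S S' c.
          admissible (set xs) (singletons (set xs)) (ops @ [Merge S S']) \<and>
          run m D xs d \<alpha> \<omega> ops c \<longrightarrow>
          (\<exists>t c'. op_step m D xs c (Merge S S') t c' \<and>
             real t \<le> polylog K k n * (real n powr (1 / \<alpha>\<^sup>2) *
               Min {real (card S), real (card S'), real n powr (1 / \<alpha>\<^sup>2)}))) \<and>
       (\<forall>ops S q.
          admissible (set xs) (singletons (set xs)) (ops @ [Query S q]) \<longrightarrow>
          (\<exists>A\<in>sets coin_space. {\<omega>. \<not> query_succeeds m D xs d \<alpha> \<omega> ops S q} \<subseteq> A \<and>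
             measure coin_space A \<le> 1 / real n ^ 3)))"
proof (intro exI[of _ afn_structure] conjI sample_free_afn allI impI, goal_cases)
  case (1 \<alpha> C)
  then have \<alpha>: "1 < \<alpha>" and C: "0 < C" by auto
  \<comment> \<open>800000 is 200000 from the time bounds times 4 from
    \<open>2 ^ e \<le> 4 * n powr (1 / \<alpha>\<^sup>2)\<close>; the power comes from
    \<open>b + d \<le> (2 + C) * log 2 (n + 1)\<close>.\<close>
  define K where "K = 800000 * (2 + C) ^ 4"
  show ?case
  proof (rule exI[of _ K], rule exI[of _ 4], intro allI impI, elim conjE, goal_cases)
    case (1 n d m xs)
    then have n: "1 \<le> n" and d: "real d \<le> C * log 2 (real n + 1)" and len: "length xs = n" and dis: "distinct xs"
      and dims: "\<forall>p\<in>set xs. length p = d" and m: "m = nat \<lfloor>polylog K 4 n * real n powr (1 + 1 / \<alpha>\<^sup>2)\<rfloor>" by auto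
    let ?lg = "log 2 (real n + 1)" and ?na = "real n powr (1 / \<alpha>\<^sup>2)"
    obtain b e where be: "0 < b" "2 ^ (b - 1) \<le> n" "n < 2 ^ b" "real b \<le> real e * \<alpha>\<^sup>2"
      "\<And>k. k < e \<Longrightarrow> real k * \<alpha>\<^sup>2 < real b" "e \<le> b" "2 ^ e \<le> 4 * ?na" "real b \<le> 2 * ?lg"
      using sizes_exist[OF n \<alpha>] by blast
    define W :: nat where "W = 2 ^ e"
    let ?s = "b + d"
    have lg1: "1 \<le> ?lg" using n by simp
    have rb: "200000 * (real ?s ^ 4 * real W) \<le> polylog K 4 n * ?na"
    proof -
      have "real ?s \<le> (2 + C) * ?lg" using be(8) d by (simp add: algebra_simps)
      then have "real ?s ^ 4 \<le> ((2 + C) * ?lg) ^ 4" by (intro power_mono) auto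
      moreover have "real W \<le> 4 * ?na" using be(7) by (simp add: W_def)
      ultimately have "real ?s ^ 4 * real W \<le> ((2 + C) * ?lg) ^ 4 * (4 * ?na)"
        by (intro mult_mono) auto
      then have "200000 * (real ?s ^ 4 * real W) \<le> 200000 * (((2 + C) * ?lg) ^ 4 * (4 * ?na))"
        by (intro mult_left_mono) auto
      also have "\<dots> = polylog K 4 n * ?na" by (simp add: polylog_def K_def power_mult_distrib)
      finally show ?thesis .
    qed
    have n1: "real n powr (1 + 1 / \<alpha>\<^sup>2) = real n * ?na" using n by (simp add: powr_add)
    have rbn: "200000 * (real ?s ^ 4 * real W) * real n \<le> polylog K 4 n * real n powr (1 + 1 / \<alpha>\<^sup>2)"
      using mult_right_mono[OF rb, of "real n"] by (simp add: n1 mult.assoc mult.commute mult.left_commute)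
    have mbig: "200000 * (?s ^ 4 * W) * n \<le> m"
    proof -
      have "real (200000 * (?s ^ 4 * W) * n) \<le> polylog K 4 n * real n powr (1 + 1 / \<alpha>\<^sup>2)" using rbn by simp
      then show ?thesis unfolding m by linarith
    qed
    have W0: "0 < W" by (simp add: W_def)
    \<comment> \<open>The machine has room for 200000 units of \<open>(b + d) ^ 4 * W * n\<close>,
      while each summand is a small multiple of this unit and all of them together need fewer than
      1000 units.\<close>
    have mem: "2 * (b * n) + n * d + 192 * b * b * W * (b * n) + 640 * b * b * W + 2 ^ b < m"
    proof -
      let ?T = "?s ^ 4 * W * n"
      have s1: "1 \<le> ?s" using be(1) by simp
      have sp: "?s ^ k \<le> ?s ^ 4" if "k \<le> 4" for k using s1 that by (intro power_increasing) auto
      have T: "x * y * z \<le> ?T" if "x \<le> ?s ^ 4" "y \<le> W" "z \<le> n" for x y z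
        using that by (intro mult_le_mono)
      have 1: "b * 1 * n \<le> ?T" using sp[of 1] W0 by (intro T) auto
      have 2: "d * 1 * n \<le> ?T" using sp[of 1] W0 by (intro T) auto
      have b3: "b * b * b \<le> ?s ^ 4"
      proof -
        have "b * b * b \<le> ?s ^ 3" unfolding power3_eq_cube by (intro mult_le_mono) auto
        then show ?thesis using sp[of 3] by simp
      qed
      have b2: "b * b \<le> ?s ^ 4"
      proof -
        have "b * b \<le> ?s ^ 2" unfolding power2_eq_square by (intro mult_le_mono) auto
        then show ?thesis using sp[of 2] by simp
      qed
      have 3: "b * b * b * W * n \<le> ?T" using b3 by (intro T) auto
      have 4: "b * b * W * 1 \<le> ?T" using b2 n by (intro T) auto
      have 5: "1 * 1 * n \<le> ?T" using sp[of 0] W0 by (intro T) auto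
      have "(2::nat) ^ b = 2 * 2 ^ (b - 1)" using be(1) by (cases b) auto
      then have 6: "2 ^ b \<le> 2 * n" using be(2) by simp
      have "192 * b * b * W * (b * n) = 192 * (b * b * b * W * n)" by (simp add: algebra_simps)
      moreover have "640 * b * b * W = 640 * (b * b * W * 1)" by simp
      moreover have "200000 * ?T \<le> m" using mbig by (simp only: mult.assoc)
      moreover have "n * d = d * 1 * n" "b * n = b * 1 * n" "0 < 1 * 1 * n" using n by simp_all
      ultimately show ?thesis using 1 2 3 4 5 6 by linarith
    qed
    have afn: "afn m n d b W \<alpha> xs e"
      by unfold_locales (use be W0 mem len dis dims \<alpha> in \<open>auto simp: W_def\<close>)
    have tq: "real t \<le> polylog K 4 n * ?na" if "t \<le> 200000 * (?s ^ 4 * W)" for t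
    proof -
      have "real t \<le> real (200000 * (?s ^ 4 * W))" using that by (simp only: of_nat_le_iff)
      then show ?thesis using rb by simp
    qed
    show ?case
    proof (intro conjI allI impI, goal_cases)
      case (1 \<omega>)
      interpret afn m n d b W \<alpha> xs \<omega> e by (rule afn)
      obtain t s where ts: "big_step m init_prog (start xs d \<alpha> \<omega>) t s" "t \<le> init_time"
        using initialize_step by blast
      have "real t \<le> real (200000 * (?s ^ 4 * W) * n)"
        using order_trans[OF ts(2) init_time_bound] by (simp only: of_nat_le_iff)
      then have "real t \<le> polylog K 4 n * real n powr (1 + 1 / \<alpha>\<^sup>2)" using rbn by simp
      then show ?case using ts(1) by (auto simp: afn_structure_def)
    next
      case (2 \<omega> ops S q c)
      interpret afn m n d b W \<alpha> xs \<omega> e by (rule afn)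
      obtain t c' where "op_step m afn_structure xs c (Query S q) t c'" "t \<le> query_time"
        using query_run 2 by blast
      then show ?case using tq order_trans[OF _ query_time_bound] by blast
    next
      case (3 \<omega> ops S S' c)
      interpret afn m n d b W \<alpha> xs \<omega> e by (rule afn)
      obtain t c' where tc: "op_step m afn_structure xs c (Merge S S') t c'" "t \<le> merge_time"
        using merge_run(1) 3 by blast
      have card: "1 \<le> card S" "1 \<le> card S'" using merge_run(2,3) 3 by blast+
      have na: "1 \<le> ?na" using n by (simp add: ge_one_powr_ge_zero)
      \<comment> \<open>Clusters are nonempty and \<open>n \<ge> 1\<close>, so the minimum is at
        least 1 and may be inserted as a factor into the bound, which holds without it.\<close>
      have "1 \<le> Min {real (card S), real (card S'), ?na}" using card na by simp
      moreover have "0 \<le> polylog K 4 n * ?na" using C lg1 by (simp add: polylog_def K_def)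
      ultimately have "polylog K 4 n * ?na * 1 \<le> polylog K 4 n * ?na * Min {real (card S), real (card S'), ?na}"
        by (intro mult_left_mono)
      then have "real t \<le> polylog K 4 n * (?na * Min {real (card S), real (card S'), ?na})"
        using tq[OF order_trans[OF tc(2) merge_time_bound]] by (simp only: mult.assoc mult_1_right)
      then show ?case using tc(1) by blast
    next
      case (4 ops S q)
      \<comment> \<open>The event and its probability concern all outcomes at once, so any single
        outcome serves to enter the locale; here all coins are 0.\<close>
      interpret z: afn m n d b W \<alpha> xs "\<lambda>_. 0" e by (rule afn)
      have "S \<in> after (singletons (set xs)) ops" "q \<in> set xs" "admissible (set xs) (singletons (set xs)) ops"
        using 4 by (auto simp: admissible_append)
      then obtain E where E: "E \<in> sets coin_space" "{\<omega>. \<not> z.success S q \<omega>} \<subseteq> E" "measure coin_space E \<le> 1 / real n ^ 3"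
        using z.failure_probability[of S q] z.cluster_nonempty[of ops S] by blast
      have "query_succeeds m afn_structure xs d \<alpha> \<omega> ops S q" if "z.success S q \<omega>" for \<omega>
        using afn.success_query[OF afn 4 that] .
      then show ?case using E by blast
    qed
  qed
qed

end
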